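(* Let $V\in W^{2,2}(B)$ be radially symmetric and let $k=\det\nabla^2 V$. Then $V$ is a stationary point of $\mathcal{W}_k$.
   Context: $B\subset\mathbb{R}^2$ is the open unit disk and $\nabla^2 V$ is the (weak) Hessian matrix of $V$. A function $V$ on $B$ is radially symmetric if $V(x)=v(|x|)$ for some function $v$ on $[0,1)$. For matrices, $A:C=\sum_{i,j}A_{ij}C_{ij}$ and $|A|^2=A:A$. For $k=\det\nabla^2 U_0$ with some $U_0\in W^{2,2}(B)$, the functional $\mathcal{W}_k: W^{2,2}(B)\to[0,\infty]$ is defined by $\mathcal{W}_k(V)=\int_B|\nabla^2 V(x)|^2\,dx$ if $\det\nabla^2 V=k$ a.e. on $B$, and $\mathcal{W}_k(V)=+\infty$ otherwise. A function $V\in W^{2,2}(B)$ with $\det\nabla^2 V=k$ is called stationary for $\mathcal{W}_k$ (a stationary point of $\mathcal{W}_k$) if $$\frac{d}{dt}\Big|_{t=0}\int_B|\nabla^2 u(t)|^2=0$$ for all strongly $W^{2,2}$-continuous maps $t\mapsto u(t)$ from a neighbourhood of zero in $\mathbb{R}$ into $\{\mathcal{W}_k<\infty\}=\{u\in W^{2,2}(B):\mathcal{W}_k(u)<\infty\}$ such that $u(0)=V$ and such that the derivative $u'(0)$ exists (at least weakly in $W^{2,2}(B)$). *)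

theory Defs
  imports "HOL-Analysis.Analysis"
begin

section \<open>Weak derivatives and the Sobolev spaces of order m and exponent 2\<close>

definition partial_deriv :: "'n::finite \<Rightarrow> (real^'n \<Rightarrow> real) \<Rightarrow> real^'n \<Rightarrow> real" where
  "partial_deriv i f x = frechet_derivative f (at x) (axis i 1)"

text \<open>Higher derivatives are indexed by lists of directions instead of multi-indices:
  the list \<open>[i, j]\<close> stands for the derivative in direction \<open>j\<close> followed by the one in direction \<open>i\<close>.\<close>

definition iterated_deriv :: "'n::finite list \<Rightarrow> (real^'n \<Rightarrow> real) \<Rightarrow> real^'n \<Rightarrow> real" where
  "iterated_deriv is f = foldr partial_deriv is f"

definition smooth :: "(real^'n::finite \<Rightarrow> real) \<Rightarrow> bool" where
  "smooth f \<longleftrightarrow> (\<forall>is x. iterated_deriv is f differentiable (at x))"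

definition test_functions :: "(real^'n::finite) set \<Rightarrow> (real^'n \<Rightarrow> real) set" where
  "test_functions \<Omega> =
     {\<phi>. smooth \<phi> \<and> compact (closure {x. \<phi> x \<noteq> 0}) \<and> closure {x. \<phi> x \<noteq> 0} \<subseteq> \<Omega>}"

definition locally_integrable :: "(real^'n::finite) set \<Rightarrow> (real^'n \<Rightarrow> real) \<Rightarrow> bool" where
  "locally_integrable \<Omega> f \<longleftrightarrow> (\<forall>K. compact K \<and> K \<subseteq> \<Omega> \<longrightarrow> integrable (lebesgue_on K) f)"

definition has_weak_deriv ::
  "(real^'n::finite) set \<Rightarrow> 'n list \<Rightarrow> (real^'n \<Rightarrow> real) \<Rightarrow> (real^'n \<Rightarrow> real) \<Rightarrow> bool" where
  "has_weak_deriv \<Omega> is u g \<longleftrightarrow>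
     locally_integrable \<Omega> u \<and> locally_integrable \<Omega> g \<and>
     (\<forall>\<phi>\<in>test_functions \<Omega>.
        (LINT x|lebesgue_on \<Omega>. u x * iterated_deriv is \<phi> x) =
        (-1) ^ length is * (LINT x|lebesgue_on \<Omega>. g x * \<phi> x))"

text \<open>Elements of Sobolev spaces are represented by functions, of which only the values almost
  everywhere on \<open>\<Omega>\<close> matter. On an open set weak derivatives are unique up to null sets,
  so the choice below only picks a representative.\<close>

definition weak_deriv ::
  "(real^'n::finite) set \<Rightarrow> 'n list \<Rightarrow> (real^'n \<Rightarrow> real) \<Rightarrow> real^'n \<Rightarrow> real" where
  "weak_deriv \<Omega> is u = (SOME g. has_weak_deriv \<Omega> is u g)"

definition L2 :: "(real^'n::finite) set \<Rightarrow> (real^'n \<Rightarrow> real) set" where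
  "L2 \<Omega> = {f \<in> borel_measurable (lebesgue_on \<Omega>). integrable (lebesgue_on \<Omega>) (\<lambda>x. (f x)\<^sup>2)}"

definition sobolev :: "nat \<Rightarrow> (real^'n::finite) set \<Rightarrow> (real^'n \<Rightarrow> real) set" where
  "sobolev m \<Omega> = {u \<in> L2 \<Omega>. \<forall>is. length is \<le> m \<longrightarrow> (\<exists>g\<in>L2 \<Omega>. has_weak_deriv \<Omega> is u g)}"

text \<open>Summing over lists counts each mixed derivative once per ordering of its directions; for
  \<open>m = 2\<close> the squared norm is the integral of \<open>u\<^sup>2 + |\<nabla>u|\<^sup>2 + |\<nabla>\<^sup>2u|\<^sup>2\<close>.\<close>

definition sobolev_norm :: "nat \<Rightarrow> (real^'n::finite) set \<Rightarrow> (real^'n \<Rightarrow> real) \<Rightarrow> real" where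
  "sobolev_norm m \<Omega> u =
     sqrt (\<Sum>is | length is \<le> m. LINT x|lebesgue_on \<Omega>. (weak_deriv \<Omega> is u x)\<^sup>2)"

definition sobolev_dual :: "nat \<Rightarrow> (real^'n::finite) set \<Rightarrow> ((real^'n \<Rightarrow> real) \<Rightarrow> real) set" where
  "sobolev_dual m \<Omega> =
     {l. (\<forall>u\<in>sobolev m \<Omega>. \<forall>v\<in>sobolev m \<Omega>. l (\<lambda>x. u x + v x) = l u + l v) \<and>
         (\<forall>c. \<forall>u\<in>sobolev m \<Omega>. l (\<lambda>x. c * u x) = c * l u) \<and>
         (\<exists>C. \<forall>u\<in>sobolev m \<Omega>. \<bar>l u\<bar> \<le> C * sobolev_norm m \<Omega> u)}"

definition weak_hessian :: "(real^'n::finite) set \<Rightarrow> (real^'n \<Rightarrow> real) \<Rightarrow> real^'n \<Rightarrow> real^'n^'n" where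
  "weak_hessian \<Omega> u x = (\<chi> i j. weak_deriv \<Omega> [i, j] u x)"


section \<open>The functional on the unit disk\<close>

abbreviation disk :: "(real^2) set" where
  "disk \<equiv> ball 0 1"

abbreviation W22 :: "(real^2 \<Rightarrow> real) set" where
  "W22 \<equiv> sobolev 2 disk"

abbreviation hess :: "(real^2 \<Rightarrow> real) \<Rightarrow> real^2 \<Rightarrow> real^2^2" where
  "hess \<equiv> weak_hessian disk"

definition radially_symmetric :: "(real^2 \<Rightarrow> real) \<Rightarrow> bool" where
  "radially_symmetric V \<longleftrightarrow> (\<exists>v :: real \<Rightarrow> real. AE x in lebesgue_on disk. V x = v (norm x))"

text \<open>The inner product of the type \<open>real^2^2\<close> is the Frobenius product \<open>A : C\<close>.\<close>

definition W_functional :: "(real^2 \<Rightarrow> real) \<Rightarrow> (real^2 \<Rightarrow> real) \<Rightarrow> ennreal" where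
  "W_functional k V =
     (if AE x in lebesgue_on disk. det (hess V x) = k x
      then \<integral>\<^sup>+ x. ennreal (hess V x \<bullet> hess V x) \<partial>lebesgue_on disk
      else \<infinity>)"

definition W_finite :: "(real^2 \<Rightarrow> real) \<Rightarrow> (real^2 \<Rightarrow> real) set" where
  "W_finite k = {u \<in> W22. W_functional k u < \<infinity>}"

definition strongly_continuous_on :: "real set \<Rightarrow> (real \<Rightarrow> real^2 \<Rightarrow> real) \<Rightarrow> bool" where
  "strongly_continuous_on T u \<longleftrightarrow>
     (\<forall>s\<in>T. ((\<lambda>t. sobolev_norm 2 disk (\<lambda>x. u t x - u s x)) \<longlongrightarrow> 0) (at s within T))"

definition has_weak_velocity_at_0 :: "(real \<Rightarrow> real^2 \<Rightarrow> real) \<Rightarrow> (real^2 \<Rightarrow> real) \<Rightarrow> bool" where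
  "has_weak_velocity_at_0 u w \<longleftrightarrow>
     w \<in> W22 \<and>
     (\<forall>l\<in>sobolev_dual 2 disk. ((\<lambda>t. l (\<lambda>x. (u t x - u 0 x) / t)) \<longlongrightarrow> l w) (at 0))"

definition stationary :: "(real^2 \<Rightarrow> real) \<Rightarrow> (real^2 \<Rightarrow> real) \<Rightarrow> bool" where
  "stationary k V \<longleftrightarrow>
     V \<in> W22 \<and> (AE x in lebesgue_on disk. det (hess V x) = k x) \<and>
     (\<forall>T u. open T \<and> 0 \<in> T \<and>
            (\<forall>t\<in>T. u t \<in> W_finite k) \<and>
            strongly_continuous_on T u \<and>
            (AE x in lebesgue_on disk. u 0 x = V x) \<and>
            (\<exists>w. has_weak_velocity_at_0 u w)
        \<longrightarrow> ((\<lambda>t. LINT x|lebesgue_on disk. hess (u t) x \<bullet> hess (u t) x) has_real_derivative 0) (at 0))"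

end

theory Submission
  imports Defs
begin

text \<open>
  Let \<open>H\<close> and \<open>G\<close> be the Hessians of \<open>V\<close> and of the velocity \<open>w\<close>. Differentiating the energy gives
  \<open>2 \<integral> H : G\<close>, and differentiating the constraint gives \<open>cof H : G = 0\<close>; both limits use that the
  weakly convergent difference quotients are bounded. Since \<open>V\<close> is radial, \<open>H\<close> is diagonal in the
  radial and tangential directions, with entries depending only on \<open>s = |x|\<^sup>2\<close>, so that \<open>H : G\<close> equals
  \<open>tr H tr G\<close> almost everywhere. Let \<open>f, m\<close> be the circle means of \<open>tr H, tr G\<close> and \<open>F, M\<close> their
  primitives vanishing at \<open>0\<close>. Testing with radial functions shows that \<open>F, M\<close> are \<open>2 s\<close> times the
  circle means of the tangential entries, and the constraint becomes \<open>(F M)' = F M / s\<close>, whence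
  \<open>F M = c s\<close>. As \<open>F M / s\<^sup>2\<close> is integrable, \<open>c = 0\<close>; a primitive has zero density almost everywhere
  on its zero set, so \<open>f m = 0\<close> and \<open>\<integral> H : G = 0\<close>.
\<close>

section \<open>Smooth functions and bumps\<close>

text \<open>The velocity \<open>w\<close> need not be radial, so its Hessian satisfies no ordinary
  differential equation pointwise. The linearized constraint, however, is linear in \<open>G\<close>
  with coefficients that are constant on circles, and so it passes to circle means. The identity
  \<open>H : G = tr H tr G\<close> combines \<open>cof H : G = 0\<close> with
  \<open>cof H = (tr H) I - H\<close> for symmetric \<open>H\<close>. The link between primitives
  and tangential entries is the divergence theorem on disks in weak form: with
  \<open>r = |x|\<close>, the tangential entry of a radial Hessian is \<open>V_r / r\<close>, and
  the Laplacian integrates to \<open>2 pi r V_r\<close> over the disk of radius \<open>r\<close>.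
  Putting \<open>H_tt = F / (2 s)\<close>, \<open>H_rr = f - F / (2 s)\<close> and likewise for the
  means of \<open>G\<close> into \<open>H_tt G_rr + H_rr G_tt = 0\<close> gives the equation for
  \<open>F M\<close>. The variable \<open>s = |x|^2\<close> carries area on the disk to
  \<open>pi ds\<close>. That \<open>F M / s^2\<close> is integrable reflects the square
  integrability of the tangential entries, and it rules out the solutions singular at the centre.
  \<open>F\<close> and \<open>M\<close> may vanish on different sets, whence the argument on zero
  sets.\<close>

fun times_differentiable_real :: "nat \<Rightarrow> (real \<Rightarrow> real) \<Rightarrow> bool" where
  "times_differentiable_real 0 h \<longleftrightarrow> True"
| "times_differentiable_real (Suc n) h \<longleftrightarrow>
     (\<exists>h'. (\<forall>x. (h has_real_derivative h' x) (at x)) \<and> times_differentiable_real n h')"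

text \<open>Counting orders replaces the lists of directions in \<open>smooth\<close>: product and
  chain rules produce sums of terms with one derivative less to take, which suits induction on a
  number.\<close>

fun times_differentiable :: "nat \<Rightarrow> (real^'n::finite \<Rightarrow> real) \<Rightarrow> bool" where
  "times_differentiable 0 f \<longleftrightarrow> True"
| "times_differentiable (Suc n) f \<longleftrightarrow>
     (\<forall>x. f differentiable (at x)) \<and> (\<forall>i. times_differentiable n (partial_deriv i f))"

lemma times_differentiable_real_Suc_imp:
  "times_differentiable_real (Suc n) h \<Longrightarrow> times_differentiable_real n h"
proof (induction n arbitrary: h)
  case (Suc n)
  then obtain h' where "\<forall>x. (h has_real_derivative h' x) (at x)" "times_differentiable_real (Suc n) h'"
    by auto
  with Suc.IH show ?case by auto
qed simp

lemma times_differentiable_real_add: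
  "times_differentiable_real n f \<Longrightarrow> times_differentiable_real n g \<Longrightarrow>
   times_differentiable_real n (\<lambda>x. f x + g x)"
proof (induction n arbitrary: f g)
  case (Suc n)
  then obtain f' g' where
    "\<forall>x. (f has_real_derivative f' x) (at x)" "times_differentiable_real n f'"
    "\<forall>x. (g has_real_derivative g' x) (at x)" "times_differentiable_real n g'"
    by auto
  with Suc.IH show ?case by (auto intro!: exI[of _ "\<lambda>x. f' x + g' x"] DERIV_add)
qed simp

lemma times_differentiable_real_mult:
  "times_differentiable_real n f \<Longrightarrow> times_differentiable_real n g \<Longrightarrow>
   times_differentiable_real n (\<lambda>x. f x * g x)"
proof (induction n arbitrary: f g)
  case (Suc n)
  then obtain f' g' where *:
    "\<forall>x. (f has_real_derivative f' x) (at x)" "times_differentiable_real n f'"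
    "\<forall>x. (g has_real_derivative g' x) (at x)" "times_differentiable_real n g'"
    by auto
  have "times_differentiable_real n f" "times_differentiable_real n g"
    using Suc.prems times_differentiable_real_Suc_imp by blast+
  with * Suc.IH have "times_differentiable_real n (\<lambda>x. f' x * g x + g' x * f x)"
    by (intro times_differentiable_real_add) auto
  with * show ?case by (auto intro!: exI[of _ "\<lambda>x. f' x * g x + g' x * f x"] DERIV_mult)
qed simp

text \<open>Each differentiation brings out a factor \<open>a\<close>; the free constant
  \<open>c\<close> absorbs it in the induction.\<close>

lemma times_differentiable_real_affine:
  "times_differentiable_real n f \<Longrightarrow> times_differentiable_real n (\<lambda>x. c * f (a * x + b))"
proof (induction n arbitrary: f c)
  case (Suc n)
  then obtain f' where *:
    "\<forall>x. (f has_real_derivative f' x) (at x)" "times_differentiable_real n f'"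
    by auto
  have "((\<lambda>x. c * f (a * x + b)) has_real_derivative (c * a) * f' (a * x + b)) (at x)" for x
    using *(1) by (auto intro!: derivative_eq_intros DERIV_chain'[of "\<lambda>x. a * x + b" _ _ _ f])
  with Suc.IH[OF *(2), of "c * a"] show ?case
    unfolding times_differentiable_real.simps
    by (intro exI[of _ "\<lambda>x. (c * a) * f' (a * x + b)"] conjI allI)
qed simp

section \<open>Rules for partial derivatives\<close>

lemma partial_deriv_eq:
  assumes "(f has_derivative f') (at x)"
  shows "partial_deriv i f x = f' (axis i 1)"
  unfolding partial_deriv_def using frechet_derivative_at[OF assms] by simp

lemma has_derivative_frechet_derivative:
  "f differentiable (at x) \<Longrightarrow> (f has_derivative frechet_derivative f (at x)) (at x)"
  by (simp add: frechet_derivative_works)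

lemma partial_deriv_const: "partial_deriv i (\<lambda>x. c) x = 0"
  by (rule partial_deriv_eq[THEN trans]) (auto intro!: derivative_eq_intros)

lemma partial_deriv_component: "partial_deriv i (\<lambda>x. x $ j) x = (if i = j then 1 else 0)"
  by (subst partial_deriv_eq[OF bounded_linear_imp_has_derivative[OF bounded_linear_vec_nth]])
     (simp add: axis_def)

lemma partial_deriv_add:
  assumes "f differentiable (at x)" "g differentiable (at x)"
  shows "partial_deriv i (\<lambda>x. f x + g x) x = partial_deriv i f x + partial_deriv i g x"
  by (subst partial_deriv_eq[OF has_derivative_add[OF assms[THEN has_derivative_frechet_derivative]]])
     (simp add: partial_deriv_def)

lemma partial_deriv_mult:
  assumes "f differentiable (at x)" "g differentiable (at x)"
  shows "partial_deriv i (\<lambda>x. f x * g x) x = f x * partial_deriv i g x + partial_deriv i f x * g x"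
  by (subst partial_deriv_eq[OF has_derivative_mult[OF assms[THEN has_derivative_frechet_derivative]]])
     (simp add: partial_deriv_def)

lemma has_derivative_compose_real:
  assumes "f differentiable (at x)" "(h has_real_derivative d) (at (f x))"
  shows "((\<lambda>x. h (f x)) has_derivative (\<lambda>v. d * frechet_derivative f (at x) v)) (at x)"
  using has_derivative_compose[OF has_derivative_frechet_derivative[OF assms(1)], of h "\<lambda>v. d * v"] assms(2)
  by (simp add: has_field_derivative_def mult_commute_abs)

lemma partial_deriv_compose_real:
  assumes "f differentiable (at x)" "(h has_real_derivative d) (at (f x))"
  shows "partial_deriv i (\<lambda>x. h (f x)) x = d * partial_deriv i f x"
  by (subst partial_deriv_eq[OF has_derivative_compose_real[OF assms]]) (simp add: partial_deriv_def)

lemma frechet_derivative_eq_sum_partial_deriv: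
  fixes f :: "real^'n::finite \<Rightarrow> real"
  assumes "f differentiable (at x)"
  shows "frechet_derivative f (at x) v = (\<Sum>j\<in>UNIV. v $ j * partial_deriv j f x)"
proof -
  interpret l: linear "frechet_derivative f (at x)"
    using has_derivative_frechet_derivative[OF assms] has_derivative_linear by blast
  have "v = (\<Sum>j\<in>UNIV. v $ j *\<^sub>R axis j 1)"
    using basis_expansion[of v] by (simp add: scalar_mult_eq_scaleR)
  then have "frechet_derivative f (at x) v = frechet_derivative f (at x) (\<Sum>j\<in>UNIV. v $ j *\<^sub>R axis j 1)"
    by (rule arg_cong)
  also have "\<dots> = (\<Sum>j\<in>UNIV. v $ j * partial_deriv j f x)"
    by (simp add: l.sum l.scale partial_deriv_def)
  finally show ?thesis .
qed

lemma has_derivative_compose_linear: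
  fixes L :: "real^'n::finite \<Rightarrow> real^'m::finite"
  assumes "linear L" "f differentiable (at (L x))"
  shows "((\<lambda>x. f (L x)) has_derivative (\<lambda>v. frechet_derivative f (at (L x)) (L v))) (at x)"
  using has_derivative_compose[OF linear_imp_has_derivative[OF assms(1)] has_derivative_frechet_derivative[OF assms(2)]] .

lemma partial_deriv_compose_linear:
  fixes L :: "real^'n::finite \<Rightarrow> real^'m::finite"
  assumes "linear L" "f differentiable (at (L x))"
  shows "partial_deriv i (\<lambda>x. f (L x)) x = (\<Sum>j\<in>UNIV. L (axis i 1) $ j * partial_deriv j f (L x))"
  by (subst partial_deriv_eq[OF has_derivative_compose_linear[OF assms]])
     (simp add: frechet_derivative_eq_sum_partial_deriv[OF assms(2)])

lemma times_differentiable_Suc_imp: "times_differentiable (Suc n) f \<Longrightarrow> times_differentiable n f"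
  by (induction n arbitrary: f) auto

lemma times_differentiable_const: "times_differentiable n (\<lambda>x. c)"
proof (induction n arbitrary: c)
  case (Suc n)
  have "partial_deriv i (\<lambda>x. c) = (\<lambda>x. 0)" for i :: 'a
    by (rule ext) (rule partial_deriv_const)
  with Suc show ?case by simp
qed simp

lemma times_differentiable_component: "times_differentiable n (\<lambda>x. x $ j)"
proof (cases n)
  case (Suc m)
  have "partial_deriv i (\<lambda>x. x $ j) = (\<lambda>x. if i = j then 1 else 0)" for i
    by (rule ext) (rule partial_deriv_component)
  moreover have "(\<lambda>x. x $ j) differentiable (at x)" for x :: "real^'a"
    by (metis bounded_linear_vec_nth bounded_linear_imp_differentiable)
  moreover have "times_differentiable m (\<lambda>x::real^'a. if i = j then 1 else 0)" for i
    by (cases "i = j") (simp_all add: times_differentiable_const)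
  ultimately show ?thesis using Suc by simp
qed simp

lemma times_differentiable_add:
  "times_differentiable n f \<Longrightarrow> times_differentiable n g \<Longrightarrow> times_differentiable n (\<lambda>x. f x + g x)"
proof (induction n arbitrary: f g)
  case (Suc n)
  then have "partial_deriv i (\<lambda>x. f x + g x) = (\<lambda>x. partial_deriv i f x + partial_deriv i g x)" for i
    by (intro ext partial_deriv_add) auto
  with Suc show ?case by auto
qed simp

lemma times_differentiable_mult:
  "times_differentiable n f \<Longrightarrow> times_differentiable n g \<Longrightarrow> times_differentiable n (\<lambda>x. f x * g x)"
proof (induction n arbitrary: f g)
  case (Suc n)
  then have "partial_deriv i (\<lambda>x. f x * g x) = (\<lambda>x. f x * partial_deriv i g x + partial_deriv i f x * g x)" for i
    by (intro ext partial_deriv_mult) auto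
  moreover have "times_differentiable n f" "times_differentiable n g"
    using Suc.prems times_differentiable_Suc_imp by blast+
  ultimately show ?case using Suc by (auto intro!: times_differentiable_add)
qed simp

lemma times_differentiable_sum:
  "finite I \<Longrightarrow> (\<And>i. i \<in> I \<Longrightarrow> times_differentiable n (f i)) \<Longrightarrow> times_differentiable n (\<lambda>x. \<Sum>i\<in>I. f i x)"
  by (induction I rule: finite_induct) (auto intro: times_differentiable_add times_differentiable_const)

lemma times_differentiable_prod:
  "finite I \<Longrightarrow> (\<And>i. i \<in> I \<Longrightarrow> times_differentiable n (f i)) \<Longrightarrow> times_differentiable n (\<lambda>x. \<Prod>i\<in>I. f i x)"
  by (induction I rule: finite_induct) (auto intro: times_differentiable_mult times_differentiable_const)

lemma times_differentiable_compose_real: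
  "times_differentiable_real n h \<Longrightarrow> times_differentiable n f \<Longrightarrow> times_differentiable n (\<lambda>x. h (f x))"
proof (induction n arbitrary: h f)
  case (Suc n)
  then obtain h' where h': "\<And>x. (h has_real_derivative h' x) (at x)" "times_differentiable_real n h'"
    by auto
  from Suc.prems have "partial_deriv i (\<lambda>x. h (f x)) = (\<lambda>x. h' (f x) * partial_deriv i f x)" for i
    by (intro ext partial_deriv_compose_real h') auto
  moreover have "times_differentiable n f"
    using Suc.prems times_differentiable_Suc_imp by blast
  moreover have "(\<lambda>x. h (f x)) differentiable (at x)" for x
    using has_derivative_compose_real[OF _ h'(1), of f x] Suc.prems(2) by (auto intro: differentiableI)
  ultimately show ?case using Suc h'(2) by (auto intro!: times_differentiable_mult)
qed simp

lemma times_differentiable_compose_linear: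
  fixes L :: "real^'n::finite \<Rightarrow> real^'m::finite"
  assumes "linear L"
  shows "times_differentiable n f \<Longrightarrow> times_differentiable n (\<lambda>x. f (L x))"
proof (induction n arbitrary: f)
  case (Suc n)
  then have "partial_deriv i (\<lambda>x. f (L x)) = (\<lambda>x. \<Sum>j\<in>UNIV. L (axis i 1) $ j * partial_deriv j f (L x))" for i
    by (intro ext partial_deriv_compose_linear assms) auto
  moreover have "(\<lambda>x. f (L x)) differentiable (at x)" for x
    using has_derivative_compose_linear[OF assms, of f x] Suc.prems by (auto intro: differentiableI)
  ultimately show ?case using Suc
    by (auto intro!: times_differentiable_sum times_differentiable_mult times_differentiable_const)
qed simp

lemma iterated_deriv_simps [simp]:
  "iterated_deriv [] f = f"
  "iterated_deriv (i # is) f = partial_deriv i (iterated_deriv is f)"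
  "iterated_deriv (is @ js) f = iterated_deriv is (iterated_deriv js f)"
  by (simp_all add: iterated_deriv_def)

text \<open>The two directions peel a list from opposite ends. From left to right the innermost
  derivative, the last entry of the list, is split off; from right to left the outermost one, its
  head.\<close>

lemma smooth_iff_times_differentiable: "smooth f \<longleftrightarrow> (\<forall>n. times_differentiable n f)"
proof
  have "(\<And>is x. length is < n \<Longrightarrow> iterated_deriv is f differentiable (at x)) \<Longrightarrow> times_differentiable n f"
    for n
  proof (induction n arbitrary: f)
    case (Suc n)
    have "iterated_deriv is (partial_deriv i f) differentiable (at x)" if "length is < n" for "is" i x
      using Suc.prems[of "is @ [i]" x] that by simp
    moreover have "f differentiable (at x)" for x
      using Suc.prems[of "[]"] by simp
    ultimately show ?case using Suc.IH by auto
  qed simp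
  then show "smooth f \<Longrightarrow> \<forall>n. times_differentiable n f"
    by (simp add: smooth_def)
next
  have "times_differentiable (length is + n) f \<Longrightarrow> times_differentiable n (iterated_deriv is f)" for "is" n
    by (induction "is" arbitrary: n rule: list.induct)
       (simp, metis add_Suc_right iterated_deriv_simps(2) length_Cons add_Suc times_differentiable.simps(2))
  then show "\<forall>n. times_differentiable n f \<Longrightarrow> smooth f"
    unfolding smooth_def by (metis times_differentiable.simps(2))
qed

lemma smooth_differentiable: "smooth f \<Longrightarrow> f differentiable (at x)"
  by (metis iterated_deriv_simps(1) smooth_def)

lemma smooth_continuous_on: "smooth f \<Longrightarrow> continuous_on S f"
  by (meson smooth_differentiable continuous_at_imp_continuous_on differentiable_imp_continuous_within)

lemma smooth_partial_deriv: "smooth f \<Longrightarrow> smooth (partial_deriv i f)"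
  by (metis smooth_iff_times_differentiable times_differentiable.simps(2))

section \<open>Exponential smooth steps and bumps\<close>

definition smooth_step :: "real \<Rightarrow> real \<Rightarrow> real" where
  "smooth_step c x = (if x > 0 then exp (- c / x) else 0)"

lemma tendsto_poly_mult_exp_0:
  fixes c :: real
  assumes "c > 0"
  shows "((\<lambda>y. poly p y * exp (- c * y)) \<longlongrightarrow> 0) at_top"
proof -
  have "((\<lambda>y. coeff p i / c ^ i * ((c * y) ^ i / exp (c * y))) \<longlongrightarrow> coeff p i / c ^ i * 0) at_top" for i
    using assms
    by (intro tendsto_mult tendsto_const filterlim_compose[OF tendsto_power_div_exp_0])
       (auto intro: filterlim_tendsto_pos_mult_at_top filterlim_ident)
  moreover have "(\<lambda>y. coeff p i / c ^ i * ((c * y) ^ i / exp (c * y))) = (\<lambda>y. coeff p i * y ^ i * exp (- c * y))" for i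
    using assms by (simp add: power_mult_distrib exp_minus field_simps)
  ultimately have "((\<lambda>y. coeff p i * y ^ i * exp (- c * y)) \<longlongrightarrow> 0) at_top" for i
    by simp
  then have "((\<lambda>y. \<Sum>i\<le>degree p. coeff p i * y ^ i * exp (- c * y)) \<longlongrightarrow> (\<Sum>i\<le>degree p. 0)) at_top"
    by (intro tendsto_sum)
  then show ?thesis by (simp add: poly_altdef sum_distrib_right)
qed

text \<open>The functions \<open>p(1/x) exp(-c/x)\<close> on \<open>x > 0\<close>, extended by zero,
  are closed under differentiation: with \<open>y = 1/x\<close> the derivative belongs to the
  polynomial \<open>y^2 (c p(y) - p'(y))\<close>. Only differentiability at \<open>0\<close> needs a
  limit.\<close>

lemma times_differentiable_real_poly_exp:
  fixes c :: real
  assumes "c > 0"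
  shows "times_differentiable_real n (\<lambda>x. if x > 0 then poly p (1 / x) * exp (- c / x) else 0)"
proof (induction n arbitrary: p)
  case (Suc n)
  let ?f = "\<lambda>p x. if x > 0 then poly p (1 / x) * exp (- c / x) else (0::real)"
  let ?q = "monom 1 2 * (smult c p - pderiv p)"
  have "(?f p has_real_derivative ?f ?q x) (at x)" for x
  proof (cases x "0::real" rule: linorder_cases)
    case less
    show ?thesis
      by (rule has_field_derivative_transform_within_open[where f = "\<lambda>_. 0" and S = "{..<0}"])
         (use less in auto)
  next
    case greater
    have 1: "((\<lambda>x. exp (- c / x)) has_real_derivative exp (- c / x) * (c / x ^ 2)) (at x)"
      using greater by (auto intro!: derivative_eq_intros simp: field_simps power2_eq_square)
    have 2: "((\<lambda>x. 1 / x) has_real_derivative - 1 / x ^ 2) (at x)"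
      using greater by (auto intro!: derivative_eq_intros simp: field_simps power2_eq_square)
    have "((\<lambda>x. poly p (1 / x) * exp (- c / x)) has_real_derivative
        poly p (1 / x) * (exp (- c / x) * (c / x ^ 2)) + poly (pderiv p) (1 / x) * (- 1 / x ^ 2) * exp (- c / x)) (at x)"
      using DERIV_mult[OF DERIV_chain2[OF poly_DERIV 2] 1] by (simp add: algebra_simps)
    also have "poly p (1 / x) * (exp (- c / x) * (c / x ^ 2)) + poly (pderiv p) (1 / x) * (- 1 / x ^ 2) * exp (- c / x)
       = ?f ?q x"
      using greater by (simp add: poly_monom field_simps power2_eq_square)
    finally show ?thesis
      by (rule has_field_derivative_transform_within_open[where S = "{0<..}"]) (use greater in auto)
  next
    case equal
    have "((\<lambda>h. ?f p h / h) \<longlongrightarrow> 0) (at_right 0)"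
    proof (rule Lim_transform_eventually)
      \<comment> \<open>The polynomial \<open>pCons 0 p\<close> is \<open>y p(y)\<close>: dividing
        by \<open>h\<close> multiplies by \<open>y = 1/h\<close>, and the exponential still
        wins.\<close>
      show "((\<lambda>h. poly (pCons 0 p) (inverse h) * exp (- c * inverse h)) \<longlongrightarrow> 0) (at_right 0)"
        by (rule filterlim_compose[OF tendsto_poly_mult_exp_0[OF assms] filterlim_inverse_at_top_right])
      show "\<forall>\<^sub>F h in at_right 0. poly (pCons 0 p) (inverse h) * exp (- c * inverse h) = ?f p h / h"
        by (auto simp: eventually_at_right_less field_simps intro!: eventually_at_right_less[THEN eventually_mono])
    qed
    moreover have "((\<lambda>h. ?f p h / h) \<longlongrightarrow> 0) (at_left 0)"
      by (rule Lim_transform_eventually[OF tendsto_const])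
         (auto simp: eventually_at_filter)
    ultimately have "((\<lambda>h. ?f p h / h) \<longlongrightarrow> 0) (at 0)"
      by (simp add: filterlim_split_at)
    then show ?thesis unfolding equal DERIV_def add_0_left by simp
  qed
  with Suc show ?case
    unfolding times_differentiable_real.simps by (intro exI[of _ "?f ?q"] conjI allI)
qed simp

lemma times_differentiable_real_smooth_step: "c > 0 \<Longrightarrow> times_differentiable_real n (smooth_step c)"
  using times_differentiable_real_poly_exp[of c n 1]
  by (simp add: smooth_step_def[abs_def] cong: if_cong)

lemma smooth_step_bounds: "c > 0 \<Longrightarrow> 0 \<le> smooth_step c x" "c > 0 \<Longrightarrow> smooth_step c x \<le> 1"
  by (auto simp: smooth_step_def)

lemma smooth_step_tendsto: "(\<lambda>n. smooth_step (1 / real (Suc n)) x) \<longlonglongrightarrow> indicator {0<..} x"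
proof -
  have "(\<lambda>n. exp (- (1 / real (Suc n)) / x)) \<longlonglongrightarrow> exp (- 0 / x)" if "x > 0"
    using that by (intro tendsto_intros LIMSEQ_Suc[OF lim_1_over_n]) auto
  then show ?thesis by (auto simp: smooth_step_def indicator_def)
qed

text \<open>The parameter \<open>c = 1 / (n + 1)\<close> of the two steps tends to \<open>0\<close>,
  so that the bumps approach the indicator of the open interval while staying in
  \<open>[0, 1]\<close>. This is made for dominated convergence, hence no normalisation.\<close>

definition bump :: "nat \<Rightarrow> real \<Rightarrow> real \<Rightarrow> real \<Rightarrow> real" where
  "bump n a b x = smooth_step (1 / real (Suc n)) (x - a) * smooth_step (1 / real (Suc n)) (b - x)"

lemma times_differentiable_real_bump: "times_differentiable_real k (bump n a b)"
proof -
  have "times_differentiable_real k (\<lambda>x. 1 * smooth_step (1 / real (Suc n)) (1 * x + - a))"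
       "times_differentiable_real k (\<lambda>x. 1 * smooth_step (1 / real (Suc n)) (-1 * x + b))"
    by (intro times_differentiable_real_affine times_differentiable_real_smooth_step; simp)+
  from times_differentiable_real_mult[OF this] show ?thesis
    by (simp add: bump_def[abs_def])
qed

lemma bump_nonneg: "0 \<le> bump n a b x"
  by (simp add: bump_def smooth_step_bounds)

lemma bump_le_1: "bump n a b x \<le> 1"
  by (simp add: bump_def smooth_step_bounds mult_le_one)

lemma bump_eq_0: "x \<notin> {a<..<b} \<Longrightarrow> bump n a b x = 0"
  by (auto simp: bump_def smooth_step_def)

lemma bump_tendsto: "(\<lambda>n. bump n a b x) \<longlonglongrightarrow> indicator {a<..<b} x"
proof -
  have "(\<lambda>n. bump n a b x) \<longlonglongrightarrow> indicator {0<..} (x - a) * indicator {0<..} (b - x)"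
    unfolding bump_def by (intro tendsto_mult smooth_step_tendsto)
  then show ?thesis by (auto simp: indicator_def split: if_splits)
qed

lemma continuous_on_bump: "continuous_on S (bump n a b)"
  using times_differentiable_real_bump[of 1 n a b]
  by (auto intro!: continuous_at_imp_continuous_on intro: DERIV_isCont)

lemma smooth_prod_bump: "smooth (\<lambda>x::real^'n::finite. \<Prod>i\<in>UNIV. bump n (a $ i) (b $ i) (x $ i))"
  unfolding smooth_iff_times_differentiable
  by (auto intro!: times_differentiable_prod times_differentiable_real_bump
      times_differentiable_component times_differentiable_compose_real[where h = "bump n (a $ i) (b $ i)" for i])

section \<open>The fundamental lemma of the calculus of variations\<close>

text \<open>Lebesgue measure is complete, so measurability survives a change on a null set.
  Statements about chosen weak derivatives can then be moved freely to other
  representatives.\<close>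

lemma borel_measurable_lebesgue_on_AE:
  fixes f :: "'a::euclidean_space \<Rightarrow> 'b::euclidean_space"
  assumes S: "S \<in> sets lebesgue" and f: "f \<in> borel_measurable (lebesgue_on S)"
    and ae: "AE x in lebesgue_on S. f x = g x"
  shows "g \<in> borel_measurable (lebesgue_on S)"
proof -
  have "(\<lambda>x. if x \<in> S then f x else 0) \<in> borel_measurable lebesgue"
    using f S by (simp add: borel_measurable_if)
  moreover have "AE x in lebesgue. (if x \<in> S then f x else 0) = (if x \<in> S then g x else 0)"
    using ae S by (auto simp: AE_restrict_space_iff elim!: eventually_mono)
  ultimately have "(\<lambda>x. if x \<in> S then g x else 0) \<in> borel_measurable lebesgue"
    by (rule borel_measurable_AE)
  then show ?thesis using S by (simp add: borel_measurable_if)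
qed

lemma AE_lebesgue_on_mono:
  assumes "AE x in lebesgue_on S. P x" "T \<subseteq> S" "S \<in> sets lebesgue" "T \<in> sets lebesgue"
  shows "AE x in lebesgue_on T. P x"
  using assms by (auto simp: AE_restrict_space_iff elim!: eventually_mono)

lemma integrable_lebesgue_on_AE_cong:
  fixes f g :: "'a::euclidean_space \<Rightarrow> 'b::euclidean_space"
  assumes S: "S \<in> sets lebesgue" and ae: "AE x in lebesgue_on S. f x = g x"
    and f: "integrable (lebesgue_on S) f"
  shows "integrable (lebesgue_on S) g"
  using integrable_cong_AE_imp[OF f borel_measurable_lebesgue_on_AE[OF S borel_measurable_integrable[OF f] ae]] ae
  by simp

text \<open>Completeness makes \<open>f\<close> and \<open>g\<close> measurable together; if they
  are not, both integrals take the default value \<open>0\<close>.\<close>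

lemma integral_lebesgue_on_AE_cong:
  fixes f g :: "'a::euclidean_space \<Rightarrow> 'b::euclidean_space"
  assumes S: "S \<in> sets lebesgue" and ae: "AE x in lebesgue_on S. f x = g x"
  shows "integral\<^sup>L (lebesgue_on S) f = integral\<^sup>L (lebesgue_on S) g"
proof (cases "f \<in> borel_measurable (lebesgue_on S)")
  case True
  then show ?thesis
    using borel_measurable_lebesgue_on_AE[OF S True ae] ae by (intro integral_cong_AE)
next
  case False
  then have "g \<notin> borel_measurable (lebesgue_on S)"
    using borel_measurable_lebesgue_on_AE[OF S, of g f] ae by (auto simp: eq_commute)
  with False show ?thesis
    by (metis borel_measurable_integrable not_integrable_integral_eq)
qed

text \<open>The positive and negative parts of \<open>f\<close> are densities of finite measures
  that agree on boxes. Boxes form an intersection-stable generator of the Borel sets, so the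
  measures and hence the densities agree.\<close>

lemma AE_eq_0_if_integral_box_eq_0_lborel:
  fixes f :: "'a::euclidean_space \<Rightarrow> real"
  assumes f: "integrable lborel f"
    and box: "\<And>a b. (LINT x|lborel. indicator (box a b) x * f x) = 0"
  shows "AE x in lborel. f x = 0"
proof -
  have [measurable]: "f \<in> borel_measurable borel"
    using f by auto
  have part: "emeasure (density lborel (\<lambda>x. ennreal (g x))) X = ennreal (LINT x|lborel. indicator X x * max 0 (g x))"
    if "X \<in> sets borel" and g: "integrable lborel g" for X and g :: "'a \<Rightarrow> real"
  proof -
    have [measurable]: "X \<in> sets borel" "g \<in> borel_measurable borel"
      using that by auto
    have "integrable lborel (\<lambda>x. indicator X x * max 0 (g x))"
      by (rule Bochner_Integration.integrable_bound[OF g]) (auto simp: indicator_def)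
    then have "ennreal (LINT x|lborel. indicator X x * max 0 (g x)) = (\<integral>\<^sup>+x. ennreal (indicator X x * max 0 (g x)) \<partial>lborel)"
      by (intro nn_integral_eq_integral[symmetric]) (auto simp: indicator_def)
    also have "\<dots> = (\<integral>\<^sup>+x. ennreal (g x) * indicator X x \<partial>lborel)"
      by (intro nn_integral_cong) (auto simp: indicator_def max_def ennreal_neg)
    finally show ?thesis by (simp add: emeasure_density)
  qed
  have eq: "emeasure (density lborel (\<lambda>x. ennreal (f x))) X = emeasure (density lborel (\<lambda>x. ennreal (- f x))) X"
    if "X \<in> range (\<lambda>(a, b). box a b)" for X
  proof -
    from that obtain a b where X: "X = box a b" by auto
    have int: "integrable lborel (\<lambda>x. indicator X x * max 0 (f x))" "integrable lborel (\<lambda>x. indicator X x * max 0 (- f x))"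
      by (rule Bochner_Integration.integrable_bound[OF f]; auto simp: indicator_def X)+
    have "(LINT x|lborel. indicator X x * max 0 (f x)) - (LINT x|lborel. indicator X x * max 0 (- f x)) =
        (LINT x|lborel. indicator X x * f x)"
      by (subst Bochner_Integration.integral_diff[OF int, symmetric])
         (intro Bochner_Integration.integral_cong, auto simp: indicator_def max_def)
    then have "(LINT x|lborel. indicator X x * max 0 (f x)) = (LINT x|lborel. indicator X x * max 0 (- f x))"
      using box[of a b] by (simp add: X)
    then show ?thesis using part[of X f] part[of X "\<lambda>x. - f x"] f X by simp
  qed
  have fin: "emeasure (density lborel (\<lambda>x. ennreal (f x))) X \<noteq> \<infinity>" if "X \<in> sets borel" for X
    using part[OF that f] by simp
  have "density lborel (\<lambda>x. ennreal (f x)) = density lborel (\<lambda>x. ennreal (- f x))"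
  proof (rule measure_eqI_generator_eq[OF _ _ eq])
    let ?E = "range (\<lambda>(a, b). box a b::'a set)"
    show "Int_stable ?E"
      by (auto simp: Int_stable_def box_Int_box)
    show "?E \<subseteq> Pow UNIV" "sets (density lborel (\<lambda>x. ennreal (f x))) = sigma_sets UNIV ?E"
      "sets (density lborel (\<lambda>x. ennreal (- f x))) = sigma_sets UNIV ?E"
      by (simp_all add: borel_eq_box)
    let ?A = "\<lambda>n::nat. box (- (real n *\<^sub>R One)) (real n *\<^sub>R One) :: 'a set"
    show "range ?A \<subseteq> ?E" "(\<Union>i. ?A i) = UNIV"
      unfolding UN_box_eq_UNIV by auto
    show "emeasure (density lborel (\<lambda>x. ennreal (f x))) (?A i) \<noteq> \<infinity>" for i
      by (intro fin) auto
  qed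
  then have "AE x in lborel. ennreal (f x) = ennreal (- f x)"
    by (subst (asm) sigma_finite_measure.density_unique_iff[OF sigma_finite_lborel]) auto
  then show ?thesis
    \<comment> \<open>\<open>ennreal\<close> truncates negative numbers to \<open>0\<close>, so one
      of the two equal sides is \<open>0\<close>; then both \<open>f x\<close> and
      \<open>- f x\<close> are nonpositive.\<close>
    by eventually_elim (metis ennreal_neg ennreal_eq_0_iff linorder_linear neg_le_0_iff_le order_antisym)
qed

lemma AE_eq_0_if_integral_box_eq_0:
  fixes f :: "'a::euclidean_space \<Rightarrow> real"
  assumes f: "integrable lebesgue f"
    and box: "\<And>a b. (LINT x|lebesgue. indicator (box a b) x * f x) = 0"
  shows "AE x in lebesgue. f x = 0"
proof -
  obtain g where g [measurable]: "g \<in> borel_measurable lborel" and fg: "AE x in lborel. f x = g x"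
    using completion_ex_borel_measurable_real f by blast
  have fg': "AE x in lebesgue. f x = g x"
    using fg by (rule AE_completion)
  have "integrable lebesgue g"
    by (rule integrable_cong_AE_imp[OF f measurable_completion[OF g]]) (use fg' in \<open>auto simp: eq_commute\<close>)
  then have "integrable lborel g"
    by (simp add: integrable_completion)
  moreover have "(LINT x|lborel. indicator (box a b) x * g x) = 0" for a b
  proof -
    have "(LINT x|lborel. indicator (box a b) x * g x) = (LINT x|lebesgue. indicator (box a b) x * g x)"
      by (subst integral_completion) auto
    also have "\<dots> = (LINT x|lebesgue. indicator (box a b) x * f x)"
    proof (rule integral_cong_AE)
      show "(\<lambda>x. indicator (box a b) x * g x) \<in> borel_measurable lebesgue"
        by (rule borel_measurable_times[OF _ measurable_completion[OF g]])
          (rule borel_measurable_indicator fmeasurableD lmeasurable_box)+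
      show "(\<lambda>x. indicator (box a b) x * f x) \<in> borel_measurable lebesgue"
        by (rule borel_measurable_times[OF _ borel_measurable_integrable[OF f]])
          (rule borel_measurable_indicator fmeasurableD lmeasurable_box)+
      show "AE x in lebesgue. indicator (box a b) x * g x = indicator (box a b) x * f x"
        using fg' by eventually_elim simp
    qed
    finally show ?thesis using box by simp
  qed
  ultimately have "AE x in lborel. g x = 0"
    by (rule AE_eq_0_if_integral_box_eq_0_lborel)
  then have "AE x in lebesgue. g x = 0"
    by (rule AE_completion)
  with fg' show ?thesis by eventually_elim simp
qed

section \<open>Test functions\<close>

lemma test_functions_smooth: "\<phi> \<in> test_functions \<Omega> \<Longrightarrow> smooth \<phi>"
  by (simp add: test_functions_def)

lemma test_functionsI:
  assumes "smooth \<phi>" "compact K" "K \<subseteq> \<Omega>" "\<And>x. x \<notin> K \<Longrightarrow> \<phi> x = 0"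
  shows "\<phi> \<in> test_functions \<Omega>"
proof -
  have "closure {x. \<phi> x \<noteq> 0} \<subseteq> K"
    using assms by (intro closure_minimal) (auto intro: compact_imp_closed)
  moreover from this have "compact (closure {x. \<phi> x \<noteq> 0})"
    by (metis assms(2) closed_closure compact_Int_closed inf.absorb2)
  ultimately show ?thesis
    using assms by (auto simp: test_functions_def)
qed

lemma partial_deriv_test_functions:
  assumes "\<phi> \<in> test_functions \<Omega>"
  shows "partial_deriv i \<phi> \<in> test_functions \<Omega>"
proof (rule test_functionsI)
  show "smooth (partial_deriv i \<phi>)"
    using assms by (auto intro: smooth_partial_deriv test_functions_smooth)
  show "compact (closure {x. \<phi> x \<noteq> 0})" "closure {x. \<phi> x \<noteq> 0} \<subseteq> \<Omega>"
    using assms by (auto simp: test_functions_def)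
  fix x assume x: "x \<notin> closure {x. \<phi> x \<noteq> 0}"
  have "(\<phi> has_derivative (\<lambda>_. 0)) (at x)"
    by (rule has_derivative_transform_within_open[where f = "\<lambda>_. 0" and s = "- closure {x. \<phi> x \<noteq> 0}"])
       (use x closure_subset[of "{x. \<phi> x \<noteq> 0}"] in \<open>auto simp: open_Compl\<close>)
  then show "partial_deriv i \<phi> x = 0" by (simp add: partial_deriv_eq)
qed

lemma iterated_deriv_test_functions:
  "\<phi> \<in> test_functions \<Omega> \<Longrightarrow> iterated_deriv is \<phi> \<in> test_functions \<Omega>"
  by (induction "is") (auto intro: partial_deriv_test_functions)

text \<open>The product lives on the compact support \<open>K\<close>, where \<open>u\<close> is
  integrable and the test function is bounded.\<close>

lemma integrable_mult_test_function:
  assumes "\<phi> \<in> test_functions \<Omega>" "locally_integrable \<Omega> u" "\<Omega> \<in> sets lebesgue"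
  shows "integrable (lebesgue_on \<Omega>) (\<lambda>x. u x * \<phi> x)"
proof -
  define K where "K = closure {x. \<phi> x \<noteq> 0}"
  have K: "compact K" "K \<subseteq> \<Omega>" and sm: "smooth \<phi>"
    using assms by (auto simp: test_functions_def K_def)
  have zero: "\<phi> x = 0" if "x \<notin> K" for x
    using that closure_subset[of "{x. \<phi> x \<noteq> 0}"] by (auto simp: K_def)
  have Kl: "K \<in> sets lebesgue" using K compact_imp_closed lmeasurable_compact by blast
  have u: "integrable (lebesgue_on K) u"
    using assms K by (simp add: locally_integrable_def)
  have "bounded (\<phi> ` K)"
    using K sm by (intro compact_imp_bounded compact_continuous_image smooth_continuous_on)
  then obtain C where C: "\<And>x. x \<in> K \<Longrightarrow> norm (\<phi> x) \<le> C"
    unfolding bounded_iff by blast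
  have "integrable (lebesgue_on K) (\<lambda>x. u x * \<phi> x)"
  proof (rule Bochner_Integration.integrable_bound)
    show "integrable (lebesgue_on K) (\<lambda>x. C * norm (u x))"
      using u by (intro integrable_mult_right integrable_norm)
    show "(\<lambda>x. u x * \<phi> x) \<in> borel_measurable (lebesgue_on K)"
      using borel_measurable_times[OF borel_measurable_integrable[OF u]
          continuous_imp_measurable_on_sets_lebesgue[OF smooth_continuous_on[OF sm] Kl]] .
    show "AE x in lebesgue_on K. norm (u x * \<phi> x) \<le> norm (C * norm (u x))"
    proof (rule AE_I2)
      fix x assume "x \<in> space (lebesgue_on K)"
      then have "norm (\<phi> x) \<le> C" using C by simp
      then show "norm (u x * \<phi> x) \<le> norm (C * norm (u x))"
        by (simp add: abs_mult mult.commute[of C] mult_left_mono)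
    qed
  qed
  then have "integrable lebesgue (\<lambda>x. indicator K x *\<^sub>R (u x * \<phi> x))"
    using Kl by (subst integrable_restrict_space[symmetric]) auto
  also have "(\<lambda>x. indicator K x *\<^sub>R (u x * \<phi> x)) = (\<lambda>x. indicator \<Omega> x *\<^sub>R (u x * \<phi> x))"
    using K zero by (auto simp: indicator_def fun_eq_iff)
  finally show ?thesis
    using assms by (subst integrable_restrict_space) auto
qed

lemma prod_bump_eq_0: "x \<notin> box a b \<Longrightarrow> (\<Prod>i\<in>UNIV. bump n (a $ i) (b $ i) (x $ i)) = 0"
  by (auto simp: mem_box_cart intro!: bump_eq_0)

lemma prod_bump_test_functions:
  "cbox a b \<subseteq> \<Omega> \<Longrightarrow> (\<lambda>x::real^'n::finite. \<Prod>i\<in>UNIV. bump n (a $ i) (b $ i) (x $ i)) \<in> test_functions \<Omega>"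
  by (rule test_functionsI[OF smooth_prod_bump compact_cbox])
     (use box_subset_cbox in \<open>auto intro!: prod_bump_eq_0[simplified]\<close>)

lemma prod_bump_tendsto:
  fixes x :: "real^'n::finite"
  shows "(\<lambda>n. \<Prod>i\<in>UNIV. bump n (a $ i) (b $ i) (x $ i)) \<longlonglongrightarrow> indicator (box a b) x"
proof -
  have "(\<lambda>n. \<Prod>i\<in>UNIV. bump n (a $ i) (b $ i) (x $ i)) \<longlonglongrightarrow> (\<Prod>i\<in>UNIV. indicator {a $ i<..<b $ i} (x $ i))"
    by (intro tendsto_prod bump_tendsto)
  also have "(\<Prod>i\<in>UNIV. indicator {a $ i<..<b $ i} (x $ i)) = (indicator (box a b) x :: real)"
    by (auto simp: indicator_def mem_box_cart)
  finally show ?thesis .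
qed

lemma prod_bump_bounds:
  "0 \<le> (\<Prod>i\<in>UNIV. bump n (a $ i) (b $ i) (x $ i))" "(\<Prod>i\<in>UNIV. bump n (a $ i) (b $ i) (x $ i)) \<le> 1"
  by (auto intro!: prod_nonneg prod_le_1 simp: bump_nonneg bump_le_1)

text \<open>Products of bumps are test functions that converge to the indicator of the open box. The
  closed box contains all their supports, and \<open>g\<close> restricted to it dominates.\<close>

lemma fundamental_lemma_box:
  fixes g :: "real^'n::finite \<Rightarrow> real"
  assumes g: "locally_integrable \<Omega> g" and \<Omega>: "open \<Omega>" and K: "cbox a b \<subseteq> \<Omega>"
    and zero: "\<And>\<phi>. \<phi> \<in> test_functions \<Omega> \<Longrightarrow> (LINT x|lebesgue_on \<Omega>. g x * \<phi> x) = 0"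
  shows "(LINT x|lebesgue. indicator (box a b) x * g x) = 0"
proof -
  let ?\<phi> = "\<lambda>n x. \<Prod>i\<in>UNIV. bump n (a $ i) (b $ i) (x $ i)"
  have \<Omega>l: "\<Omega> \<in> sets lebesgue" using \<Omega> by auto
  have "integrable (lebesgue_on (cbox a b)) g"
    using g K by (auto simp: locally_integrable_def)
  then have gK: "integrable lebesgue (\<lambda>x. indicator (cbox a b) x * g x)"
    by (subst (asm) integrable_restrict_space) auto
  have eq: "indicator (cbox a b) x * g x * ?\<phi> n x = indicator \<Omega> x * (g x * ?\<phi> n x)" for n x
    using K prod_bump_eq_0[of x a b n] box_subset_cbox[of a b] by (auto simp: indicator_def)
  have 0: "(LINT x|lebesgue. indicator (cbox a b) x * g x * ?\<phi> n x) = 0" for n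
  proof -
    have "(LINT x|lebesgue_on \<Omega>. g x * ?\<phi> n x) = (LINT x|lebesgue. indicator \<Omega> x *\<^sub>R (g x * ?\<phi> n x))"
      using \<Omega>l by (subst integral_restrict_space) auto
    with zero[OF prod_bump_test_functions[OF K]] show ?thesis unfolding eq by simp
  qed
  have "(\<lambda>n. LINT x|lebesgue. indicator (cbox a b) x * g x * ?\<phi> n x) \<longlonglongrightarrow>
        (LINT x|lebesgue. indicator (cbox a b) x * g x * indicator (box a b) x)"
  proof (rule integral_dominated_convergence[where w = "\<lambda>x. norm (indicator (cbox a b) x * g x)"])
    show "integrable lebesgue (\<lambda>x. norm (indicator (cbox a b) x * g x))"
      using gK by (rule integrable_norm)
    show "AE x in lebesgue. (\<lambda>n. indicator (cbox a b) x * g x * ?\<phi> n x) \<longlonglongrightarrow> indicator (cbox a b) x * g x * indicator (box a b) x"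
      by (intro AE_I2 tendsto_mult tendsto_const prod_bump_tendsto)
    show "AE x in lebesgue. norm (indicator (cbox a b) x * g x * ?\<phi> n x) \<le> norm (indicator (cbox a b) x * g x)" for n
      using prod_bump_bounds[of n a b] by (auto simp: abs_mult mult_left_le)
    have "?\<phi> n \<in> borel_measurable lebesgue" for n
      using continuous_imp_measurable_on_sets_lebesgue[OF smooth_continuous_on[OF smooth_prod_bump], of UNIV]
      by (simp add: lebesgue_on_UNIV_eq)
    then show "(\<lambda>x. indicator (cbox a b) x * g x * ?\<phi> n x) \<in> borel_measurable lebesgue" for n
      by (rule borel_measurable_times[OF borel_measurable_integrable[OF gK]])
    show "(\<lambda>x. indicator (cbox a b) x * g x * indicator (box a b) x) \<in> borel_measurable lebesgue"
      by (rule borel_measurable_times[OF borel_measurable_integrable[OF gK]])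
        (rule borel_measurable_indicator fmeasurableD lmeasurable_box)+
  qed
  then have "(LINT x|lebesgue. indicator (cbox a b) x * g x * indicator (box a b) x) = 0"
    unfolding 0 using LIMSEQ_unique tendsto_const by blast
  moreover have "indicator (cbox a b) x * g x * indicator (box a b) x = indicator (box a b) x * g x" for x
    using box_subset_cbox[of a b] by (auto simp: indicator_def)
  ultimately show ?thesis by simp
qed

text \<open>An open set is a countable union of closed boxes, so one box suffices. Its boundary is a
  null set, and on its interior the integrals of \<open>g\<close> over all smaller boxes vanish
  because the intersection of two boxes is a box.\<close>

theorem fundamental_lemma_calculus_of_variations:
  fixes g :: "real^'n::finite \<Rightarrow> real"
  assumes g: "locally_integrable \<Omega> g" and \<Omega>: "open \<Omega>"
    and zero: "\<And>\<phi>. \<phi> \<in> test_functions \<Omega> \<Longrightarrow> (LINT x|lebesgue_on \<Omega>. g x * \<phi> x) = 0"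
  shows "AE x in lebesgue_on \<Omega>. g x = 0"
proof -
  have *: "AE x in lebesgue. x \<in> cbox c d \<longrightarrow> g x = 0" if K: "cbox c d \<subseteq> \<Omega>" for c d
  proof -
    have "integrable (lebesgue_on (cbox c d)) g"
      using g K by (auto simp: locally_integrable_def)
    then have gK: "integrable lebesgue (\<lambda>x. indicator (cbox c d) x * g x)"
      by (subst (asm) integrable_restrict_space) auto
    have "integrable lebesgue (\<lambda>x. indicator (box c d) x * g x)"
    proof (rule Bochner_Integration.integrable_bound[OF gK])
      have "(\<lambda>x. indicator (box c d) x * (indicator (cbox c d) x * g x)) \<in> borel_measurable lebesgue"
        by (rule borel_measurable_times[OF _ borel_measurable_integrable[OF gK]])
          (rule borel_measurable_indicator fmeasurableD lmeasurable_box)+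
      also have "(\<lambda>x. indicator (box c d) x * (indicator (cbox c d) x * g x)) = (\<lambda>x. indicator (box c d) x * g x)"
        using box_subset_cbox[of c d] by (auto simp: indicator_def fun_eq_iff)
      finally show "(\<lambda>x. indicator (box c d) x * g x) \<in> borel_measurable lebesgue" .
    qed (use box_subset_cbox[of c d] in \<open>auto simp: indicator_def\<close>)
    then have "AE x in lebesgue. indicator (box c d) x * g x = 0"
    proof (rule AE_eq_0_if_integral_box_eq_0)
      fix a b :: "real^'n"
      obtain e f where ef: "box a b \<inter> box c d = box e f"
        using box_Int_box[of a b c d] by blast
      show "(LINT x|lebesgue. indicator (box a b) x * (indicator (box c d) x * g x)) = 0"
      proof (cases "box e f = {}")
        case True
        with ef have "(\<lambda>x. indicator (box a b) x * (indicator (box c d) x * g x)) = (\<lambda>x. 0)"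
          by (auto simp: indicator_def fun_eq_iff)
        then show ?thesis by (simp only: integral_zero)
      next
        case False
        have "box e f \<subseteq> cbox c d" using ef box_subset_cbox[of c d] by blast
        \<comment> \<open>A nonempty open box has \<open>cbox e f\<close> as its closure. An empty
          one would leave \<open>cbox e f\<close> uncontrolled, which is why that case is
          separate.\<close>
        then have "cbox e f \<subseteq> cbox c d" using False
          by (metis closure_box closure_minimal closed_cbox)
        then have "(LINT x|lebesgue. indicator (box e f) x * g x) = 0"
          using fundamental_lemma_box[OF g \<Omega> _ zero] K by blast
        moreover have "(\<lambda>x. indicator (box a b) x * (indicator (box c d) x * g x)) = (\<lambda>x. indicator (box e f) x * g x)"
          using ef by (auto simp: indicator_def fun_eq_iff)
        ultimately show ?thesis by (simp only:)
      qed
    qed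
    moreover have "AE x in lebesgue. x \<notin> cbox c d - box c d"
      by (intro AE_not_in) (use negligible_frontier_interval[of c d] in \<open>simp add: negligible_iff_null_sets\<close>)
    ultimately show ?thesis by eventually_elim (auto simp: indicator_def)
  qed
  obtain D where D: "countable D" "\<And>X. X \<in> D \<Longrightarrow> X \<subseteq> \<Omega>" "\<And>X. X \<in> D \<Longrightarrow> \<exists>a b. X = cbox a b" "\<Union>D = \<Omega>"
    using open_countable_Union_open_cbox[OF \<Omega>] by (metis Pow_iff subsetD)
  have "AE x in lebesgue. \<forall>X\<in>D. x \<in> X \<longrightarrow> g x = 0"
  proof (rule AE_ball_countable'[OF _ D(1)])
    fix X assume "X \<in> D"
    with D(2,3) obtain c d where "X = cbox c d" "cbox c d \<subseteq> \<Omega>" by metis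
    then show "AE x in lebesgue. x \<in> X \<longrightarrow> g x = 0" using * by simp
  qed
  then have "AE x in lebesgue. x \<in> \<Omega> \<longrightarrow> g x = 0"
    by eventually_elim (use D(4) in auto)
  then show ?thesis using \<Omega> by (subst AE_restrict_space_iff) auto
qed

section \<open>Weak derivatives\<close>

lemma L2_lincomb:
  assumes "f \<in> L2 \<Omega>" "g \<in> L2 \<Omega>"
  shows "(\<lambda>x. a * f x + b * g x) \<in> L2 \<Omega>"
proof -
  have [measurable]: "f \<in> borel_measurable (lebesgue_on \<Omega>)" "g \<in> borel_measurable (lebesgue_on \<Omega>)"
    using assms by (auto simp: L2_def)
  have "integrable (lebesgue_on \<Omega>) (\<lambda>x. (a * f x + b * g x)\<^sup>2)"
  proof (rule Bochner_Integration.integrable_bound)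
    show "integrable (lebesgue_on \<Omega>) (\<lambda>x. 2 * a\<^sup>2 * (f x)\<^sup>2 + 2 * b\<^sup>2 * (g x)\<^sup>2)"
      using assms by (intro Bochner_Integration.integrable_add integrable_mult_right) (auto simp: L2_def)
    have "(a * y + b * z)\<^sup>2 \<le> 2 * a\<^sup>2 * y\<^sup>2 + 2 * b\<^sup>2 * z\<^sup>2" for y z :: real
      using sum_squares_bound[of "a * y" "b * z"] by (simp add: power2_sum power_mult_distrib)
    then show "AE x in lebesgue_on \<Omega>. norm ((a * f x + b * g x)\<^sup>2) \<le> norm (2 * a\<^sup>2 * (f x)\<^sup>2 + 2 * b\<^sup>2 * (g x)\<^sup>2)"
      by (intro AE_I2) (auto simp: abs_of_nonneg)
  qed measurable
  then show ?thesis by (simp add: L2_def)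
qed

lemma L2_mult_integrable:
  assumes "f \<in> L2 \<Omega>" "g \<in> L2 \<Omega>"
  shows "integrable (lebesgue_on \<Omega>) (\<lambda>x. f x * g x)"
proof -
  have [measurable]: "f \<in> borel_measurable (lebesgue_on \<Omega>)" "g \<in> borel_measurable (lebesgue_on \<Omega>)"
    using assms by (auto simp: L2_def)
  show ?thesis
  proof (rule Bochner_Integration.integrable_bound)
    show "integrable (lebesgue_on \<Omega>) (\<lambda>x. (f x)\<^sup>2 + (g x)\<^sup>2)"
      using assms by (intro Bochner_Integration.integrable_add) (auto simp: L2_def)
    have "\<bar>y * z\<bar> \<le> y\<^sup>2 + z\<^sup>2" for y z :: real
    proof -
      have "2 * \<bar>y * z\<bar> \<le> y\<^sup>2 + z\<^sup>2"
        using sum_squares_bound[of "\<bar>y\<bar>" "\<bar>z\<bar>"] by (simp add: abs_mult)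
      moreover have "0 \<le> \<bar>y * z\<bar>" by simp
      ultimately show ?thesis by linarith
    qed
    then show "AE x in lebesgue_on \<Omega>. norm (f x * g x) \<le> norm ((f x)\<^sup>2 + (g x)\<^sup>2)"
      by (intro AE_I2) (auto simp: abs_of_nonneg)
  qed measurable
qed

lemma L2_AE_cong:
  assumes "f \<in> L2 \<Omega>" "AE x in lebesgue_on \<Omega>. f x = g x" "\<Omega> \<in> sets lebesgue"
  shows "g \<in> L2 \<Omega>"
proof -
  have "AE x in lebesgue_on \<Omega>. (f x)\<^sup>2 = (g x)\<^sup>2"
    using assms(2) by eventually_elim simp
  then show ?thesis
    using assms borel_measurable_lebesgue_on_AE[OF assms(3) _ assms(2)]
      integrable_lebesgue_on_AE_cong[OF assms(3), of "\<lambda>x. (f x)\<^sup>2" "\<lambda>x. (g x)\<^sup>2"]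
    by (auto simp: L2_def)
qed

lemma locally_integrable_lincomb:
  "locally_integrable \<Omega> f \<Longrightarrow> locally_integrable \<Omega> g \<Longrightarrow> locally_integrable \<Omega> (\<lambda>x. a * f x + b * g x)"
  by (simp add: locally_integrable_def)

lemma locally_integrable_AE_cong:
  assumes "locally_integrable \<Omega> f" "AE x in lebesgue_on \<Omega>. f x = g x" "\<Omega> \<in> sets lebesgue"
  shows "locally_integrable \<Omega> g"
  unfolding locally_integrable_def
proof safe
  fix K :: "(real^'a) set" assume K: "compact K" "K \<subseteq> \<Omega>"
  then have Kl: "K \<in> sets lebesgue" using compact_imp_closed lmeasurable_compact by blast
  show "integrable (lebesgue_on K) g"
    using assms(1) K integrable_lebesgue_on_AE_cong[OF Kl AE_lebesgue_on_mono[OF assms(2) K(2) assms(3) Kl]]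
    by (auto simp: locally_integrable_def)
qed

lemma has_weak_deriv_lincomb:
  assumes u: "has_weak_deriv \<Omega> is u g" and v: "has_weak_deriv \<Omega> is v h" and \<Omega>: "\<Omega> \<in> sets lebesgue"
  shows "has_weak_deriv \<Omega> is (\<lambda>x. a * u x + b * v x) (\<lambda>x. a * g x + b * h x)"
proof -
  have int: "integrable (lebesgue_on \<Omega>) (\<lambda>x. u x * iterated_deriv is \<phi> x)"
       "integrable (lebesgue_on \<Omega>) (\<lambda>x. v x * iterated_deriv is \<phi> x)"
       "integrable (lebesgue_on \<Omega>) (\<lambda>x. g x * \<phi> x)" "integrable (lebesgue_on \<Omega>) (\<lambda>x. h x * \<phi> x)"
    if "\<phi> \<in> test_functions \<Omega>" for \<phi>
    using u v \<Omega> that by (auto simp: has_weak_deriv_def intro!: integrable_mult_test_function iterated_deriv_test_functions)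
  have "(LINT x|lebesgue_on \<Omega>. (a * u x + b * v x) * iterated_deriv is \<phi> x) =
        (-1) ^ length is * (LINT x|lebesgue_on \<Omega>. (a * g x + b * h x) * \<phi> x)"
    if "\<phi> \<in> test_functions \<Omega>" for \<phi>
  proof -
    have "(LINT x|lebesgue_on \<Omega>. (a * u x + b * v x) * iterated_deriv is \<phi> x) =
      a * (LINT x|lebesgue_on \<Omega>. u x * iterated_deriv is \<phi> x) + b * (LINT x|lebesgue_on \<Omega>. v x * iterated_deriv is \<phi> x)"
      using int[OF that] by (simp add: distrib_right mult.assoc)
    also have "\<dots> = (-1) ^ length is * (a * (LINT x|lebesgue_on \<Omega>. g x * \<phi> x) + b * (LINT x|lebesgue_on \<Omega>. h x * \<phi> x))"
      using u v that by (simp add: has_weak_deriv_def algebra_simps)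
    also have "\<dots> = (-1) ^ length is * (LINT x|lebesgue_on \<Omega>. (a * g x + b * h x) * \<phi> x)"
      using int[OF that] by (simp add: distrib_right mult.assoc)
    finally show ?thesis .
  qed
  then show ?thesis
    using u v by (simp add: has_weak_deriv_def locally_integrable_lincomb)
qed

lemma has_weak_deriv_AE_cong:
  assumes "has_weak_deriv \<Omega> is u g" "AE x in lebesgue_on \<Omega>. u x = u' x" "\<Omega> \<in> sets lebesgue"
  shows "has_weak_deriv \<Omega> is u' g"
proof -
  have "(LINT x|lebesgue_on \<Omega>. u' x * f x) = (LINT x|lebesgue_on \<Omega>. u x * f x)" for f
    using assms(2) by (intro integral_lebesgue_on_AE_cong[OF assms(3)]) (auto elim: eventually_mono)
  then show ?thesis
    using assms locally_integrable_AE_cong[OF _ assms(2,3)] by (auto simp: has_weak_deriv_def)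
qed

lemma has_weak_deriv_unique:
  assumes "has_weak_deriv \<Omega> is u g" "has_weak_deriv \<Omega> is u h" "open \<Omega>"
  shows "AE x in lebesgue_on \<Omega>. g x = h x"
proof -
  have \<Omega>: "\<Omega> \<in> sets lebesgue" using assms(3) by auto
  have "has_weak_deriv \<Omega> is (\<lambda>x. 1 * u x + (-1) * u x) (\<lambda>x. 1 * g x + (-1) * h x)"
    by (rule has_weak_deriv_lincomb[OF assms(1,2) \<Omega>])
  then have "AE x in lebesgue_on \<Omega>. g x - h x = 0"
    by (intro fundamental_lemma_calculus_of_variations assms(3)) (auto simp: has_weak_deriv_def)
  then show ?thesis by eventually_elim simp
qed

text \<open>\<open>SOME\<close> sees only the predicate \<open>has_weak_deriv\<close>, which is the
  same for functions equal almost everywhere. The chosen derivatives are therefore literally the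
  same function, so that the Hessian of the curve at time \<open>0\<close> can be replaced by that
  of \<open>V\<close>.\<close>

lemma weak_deriv_AE_cong:
  assumes "AE x in lebesgue_on \<Omega>. u x = u' x" "\<Omega> \<in> sets lebesgue"
  shows "weak_deriv \<Omega> is u = weak_deriv \<Omega> is u'"
proof -
  have "has_weak_deriv \<Omega> is u = has_weak_deriv \<Omega> is u'"
    using has_weak_deriv_AE_cong[OF _ assms] has_weak_deriv_AE_cong[of \<Omega> _ u' _ u] assms
    by (auto simp: fun_eq_iff eq_commute)
  then show ?thesis by (simp add: weak_deriv_def)
qed

lemma sobolev_has_weak_deriv:
  assumes "u \<in> sobolev m \<Omega>" "length is \<le> m"
  shows "has_weak_deriv \<Omega> is u (weak_deriv \<Omega> is u)"
proof -
  have "\<exists>g. has_weak_deriv \<Omega> is u g" using assms by (auto simp: sobolev_def)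
  then show ?thesis unfolding weak_deriv_def by (rule someI_ex)
qed

lemma has_weak_deriv_weak_deriv_eq:
  assumes "u \<in> sobolev m \<Omega>" "length is \<le> m" "has_weak_deriv \<Omega> is u g" "open \<Omega>"
  shows "AE x in lebesgue_on \<Omega>. weak_deriv \<Omega> is u x = g x"
  using has_weak_deriv_unique[OF sobolev_has_weak_deriv[OF assms(1,2)] assms(3,4)] .

lemma weak_deriv_L2:
  assumes "u \<in> sobolev m \<Omega>" "length is \<le> m" "open \<Omega>"
  shows "weak_deriv \<Omega> is u \<in> L2 \<Omega>"
proof -
  obtain g where g: "g \<in> L2 \<Omega>" "has_weak_deriv \<Omega> is u g"
    using assms by (auto simp: sobolev_def)
  have "AE x in lebesgue_on \<Omega>. g x = weak_deriv \<Omega> is u x"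
    using has_weak_deriv_weak_deriv_eq[OF assms(1,2) g(2) assms(3)] by eventually_elim simp
  then show ?thesis using L2_AE_cong[OF g(1)] assms(3) by auto
qed

lemma sobolev_lincomb:
  assumes "u \<in> sobolev m \<Omega>" "v \<in> sobolev m \<Omega>" "open \<Omega>"
  shows "(\<lambda>x. a * u x + b * v x) \<in> sobolev m \<Omega>"
proof -
  have "\<exists>g\<in>L2 \<Omega>. has_weak_deriv \<Omega> is (\<lambda>x. a * u x + b * v x) g" if len: "length is \<le> m" for "is"
  proof
    show "has_weak_deriv \<Omega> is (\<lambda>x. a * u x + b * v x) (\<lambda>x. a * weak_deriv \<Omega> is u x + b * weak_deriv \<Omega> is v x)"
      using assms len by (intro has_weak_deriv_lincomb sobolev_has_weak_deriv) auto
    show "(\<lambda>x. a * weak_deriv \<Omega> is u x + b * weak_deriv \<Omega> is v x) \<in> L2 \<Omega>"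
      using assms len by (intro L2_lincomb weak_deriv_L2)
  qed
  then show ?thesis using assms L2_lincomb by (auto simp: sobolev_def)
qed

lemma weak_deriv_lincomb:
  assumes "u \<in> sobolev m \<Omega>" "v \<in> sobolev m \<Omega>" "open \<Omega>" "length is \<le> m"
  shows "AE x in lebesgue_on \<Omega>. weak_deriv \<Omega> is (\<lambda>x. a * u x + b * v x) x =
            a * weak_deriv \<Omega> is u x + b * weak_deriv \<Omega> is v x"
  using assms
  by (intro has_weak_deriv_weak_deriv_eq[OF sobolev_lincomb] has_weak_deriv_lincomb sobolev_has_weak_deriv) auto

section \<open>Orthogonal changes of variables\<close>

lemma orthogonal_transformation_vimage:
  fixes R :: "'a::euclidean_space \<Rightarrow> 'a"
  assumes "orthogonal_transformation R"
  shows "R -` S = inv R ` S"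
  using orthogonal_transformation_bij[OF assms] by (rule bij_vimage_eq_inv_image)

text \<open>A Borel measure giving every box its volume is Lebesgue measure. The preimage of a box
  is its image under the orthogonal map \<open>inv R\<close>, which preserves volume.\<close>

lemma lborel_distr_orthogonal_transformation:
  fixes R :: "real^'n::{finite,wellorder} \<Rightarrow> real^'n::_"
  assumes R: "orthogonal_transformation R"
  shows "distr lborel borel R = lborel"
proof (rule lborel_eqI[symmetric])
  have cont: "continuous_on UNIV R"
    using orthogonal_transformation_linear[OF R] by (simp add: linear_continuous_on linear_conv_bounded_linear)
  then have meas: "R \<in> borel_measurable borel" by (rule borel_measurable_continuous_onI)
  fix l u :: "real^'n::_" assume lu: "\<And>b. b \<in> Basis \<Longrightarrow> l \<bullet> b \<le> u \<bullet> b"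
  have "open (R -` box l u)" by (rule open_vimage[OF open_box cont])
  then have borel: "R -` box l u \<in> sets borel" by auto
  have lm: "R -` box l u \<in> lmeasurable" and eq: "measure lebesgue (R -` box l u) = measure lebesgue (box l u)"
    unfolding orthogonal_transformation_vimage[OF R]
    by (simp_all add: measurable_orthogonal_image measure_orthogonal_image orthogonal_transformation_inv R)
  have "emeasure (distr lborel borel R) (box l u) = emeasure lebesgue (R -` box l u)"
    using meas borel by (subst emeasure_distr) auto
  also have "\<dots> = ennreal (measure lebesgue (box l u))"
    using emeasure_eq_measure2[OF lm] eq by simp
  also have "\<dots> = emeasure lebesgue (box l u)"
    by (rule emeasure_eq_measure2[symmetric]) auto
  also have "\<dots> = (\<Prod>b\<in>Basis. (u - l) \<bullet> b)"
    using lu by (simp add: emeasure_lborel_box)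
  finally show "emeasure (distr lborel borel R) (box l u) = (\<Prod>b\<in>Basis. (u - l) \<bullet> b)" .
qed simp

lemma lebesgue_distr_orthogonal_transformation:
  fixes R :: "real^'n::{finite,wellorder} \<Rightarrow> real^'n::_"
  assumes R: "orthogonal_transformation R"
  shows "R \<in> lebesgue \<rightarrow>\<^sub>M lebesgue" "distr lebesgue lebesgue R = lebesgue"
proof -
  have cont: "continuous_on UNIV R"
    using orthogonal_transformation_linear[OF R] by (simp add: linear_continuous_on linear_conv_bounded_linear)
  then have meas: "R \<in> borel \<rightarrow>\<^sub>M borel" by (rule borel_measurable_continuous_onI)
  then have meas': "R \<in> lebesgue \<rightarrow>\<^sub>M lborel" by (simp add: measurable_completion)
  have eq: "distr lebesgue lborel R = lborel"
    using lborel_distr_orthogonal_transformation[OF R] meas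
    by (simp add: distr_completion cong: distr_cong)
  show "R \<in> lebesgue \<rightarrow>\<^sub>M lebesgue"
    by (rule completion.measurable_completion2[OF meas']) (simp add: eq)
  have "lebesgue = completion (distr lebesgue lborel R)" by (simp add: eq)
  also have "\<dots> = distr lebesgue lebesgue R"
    by (rule completion.completion_distr_eq[OF meas']) (simp add: eq)
  finally show "distr lebesgue lebesgue R = lebesgue" ..
qed

lemma lebesgue_on_distr_orthogonal_transformation:
  fixes R :: "real^'n::{finite,wellorder} \<Rightarrow> real^'n::_"
  assumes R: "orthogonal_transformation R" and S: "S \<in> sets lebesgue"
  shows "R \<in> lebesgue_on (R -` S) \<rightarrow>\<^sub>M lebesgue_on S"
    and "distr (lebesgue_on (R -` S)) (lebesgue_on S) R = lebesgue_on S"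
proof -
  note meas = lebesgue_distr_orthogonal_transformation[OF R]
  have S': "R -` S \<in> sets lebesgue"
    using measurable_sets[OF meas(1) S] by simp
  show meas': "R \<in> lebesgue_on (R -` S) \<rightarrow>\<^sub>M lebesgue_on S"
    by (intro measurable_restrict_space2 measurable_restrict_space1 meas(1)) auto
  show "distr (lebesgue_on (R -` S)) (lebesgue_on S) R = lebesgue_on S"
  proof (rule measure_eqI)
    fix A assume "A \<in> sets (distr (lebesgue_on (R -` S)) (lebesgue_on S) R)"
    then have A: "A \<in> sets lebesgue" "A \<subseteq> S" "A \<in> sets (lebesgue_on S)"
      using S by (auto simp: sets_restrict_space_iff)
    have "emeasure (distr (lebesgue_on (R -` S)) (lebesgue_on S) R) A = emeasure lebesgue (R -` A)"
      using A S' meas' by (subst emeasure_distr) (auto simp: emeasure_restrict_space vimage_mono Int_absorb2)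
    also have "\<dots> = emeasure (distr lebesgue lebesgue R) A"
      using A meas by (subst emeasure_distr) auto
    also have "\<dots> = emeasure (lebesgue_on S) A"
      using A S meas(2) by (simp add: emeasure_restrict_space)
    finally show "emeasure (distr (lebesgue_on (R -` S)) (lebesgue_on S) R) A = emeasure (lebesgue_on S) A" .
  qed simp
qed

lemma partial_deriv_sum_scaled:
  assumes "\<And>l. f l differentiable (at x)" "finite L"
  shows "partial_deriv i (\<lambda>x. \<Sum>l\<in>L. c l * f l x) x = (\<Sum>l\<in>L. c l * partial_deriv i (f l) x)"
proof -
  have "((\<lambda>x. \<Sum>l\<in>L. c l * f l x) has_derivative (\<lambda>v. \<Sum>l\<in>L. c l * frechet_derivative (f l) (at x) v)) (at x)"
    by (intro has_derivative_sum has_derivative_mult_right has_derivative_frechet_derivative assms)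
  from partial_deriv_eq[OF this] show ?thesis by (simp add: partial_deriv_def)
qed

lemma second_deriv_compose_linear:
  fixes R :: "real^'n::finite \<Rightarrow> real^'n"
  assumes R: "linear R" and \<phi>: "smooth \<phi>"
  shows "iterated_deriv [i, j] (\<lambda>x. \<phi> (R x)) x =
    (\<Sum>k\<in>UNIV. \<Sum>l\<in>UNIV. R (axis i 1) $ k * R (axis j 1) $ l * iterated_deriv [k, l] \<phi> (R x))"
proof -
  have sm: "smooth (\<lambda>x. f (R x))" if "smooth f" for f
    using that by (simp add: smooth_iff_times_differentiable times_differentiable_compose_linear[OF R])
  have "partial_deriv j (\<lambda>x. \<phi> (R x)) = (\<lambda>x. \<Sum>l\<in>UNIV. R (axis j 1) $ l * partial_deriv l \<phi> (R x))"
    by (intro ext partial_deriv_compose_linear[OF R] smooth_differentiable \<phi>)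
  then have "iterated_deriv [i, j] (\<lambda>x. \<phi> (R x)) x =
    (\<Sum>l\<in>UNIV. R (axis j 1) $ l * partial_deriv i (\<lambda>x. partial_deriv l \<phi> (R x)) x)"
    by (simp add: partial_deriv_sum_scaled smooth_differentiable sm smooth_partial_deriv \<phi>)
  also have "\<dots> = (\<Sum>l\<in>UNIV. R (axis j 1) $ l * (\<Sum>k\<in>UNIV. R (axis i 1) $ k * partial_deriv k (partial_deriv l \<phi>) (R x)))"
    by (simp add: partial_deriv_compose_linear[OF R] smooth_differentiable smooth_partial_deriv \<phi>)
  also have "\<dots> = (\<Sum>l\<in>UNIV. \<Sum>k\<in>UNIV. R (axis i 1) $ k * R (axis j 1) $ l * iterated_deriv [k, l] \<phi> (R x))"
    by (simp add: sum_distrib_left mult_ac)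
  finally show ?thesis by (subst sum.swap)
qed

lemma test_functions_compose_orthogonal:
  fixes R :: "real^'n::finite \<Rightarrow> real^'n"
  assumes R: "orthogonal_transformation R" and \<Omega>: "R -` \<Omega> = \<Omega>" and \<phi>: "\<phi> \<in> test_functions \<Omega>"
  shows "(\<lambda>x. \<phi> (R x)) \<in> test_functions \<Omega>"
proof (rule test_functionsI)
  let ?K = "closure {x. \<phi> x \<noteq> 0}"
  have inv: "orthogonal_transformation (inv R)" using R by (rule orthogonal_transformation_inv)
  have K: "compact ?K" "?K \<subseteq> \<Omega>" using \<phi> by (auto simp: test_functions_def)
  show "smooth (\<lambda>x. \<phi> (R x))"
    using test_functions_smooth[OF \<phi>] orthogonal_transformation_linear[OF R]
    by (simp add: smooth_iff_times_differentiable times_differentiable_compose_linear)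
  show "compact (R -` ?K)"
    unfolding orthogonal_transformation_vimage[OF R]
    by (intro compact_continuous_image K linear_continuous_on)
       (simp add: orthogonal_transformation_linear[OF inv] linear_conv_bounded_linear[symmetric])
  show "R -` ?K \<subseteq> \<Omega>" using K(2) \<Omega> by blast
  show "\<phi> (R x) = 0" if "x \<notin> R -` ?K" for x
    using that closure_subset[of "{x. \<phi> x \<noteq> 0}"] by auto
qed

lemma locally_integrable_compose_orthogonal:
  fixes R :: "real^'n::{finite,wellorder} \<Rightarrow> real^'n::_"
  assumes R: "orthogonal_transformation R" and \<Omega>: "R -` \<Omega> = \<Omega>" and u: "locally_integrable \<Omega> u"
  shows "locally_integrable \<Omega> (\<lambda>x. u (R x))"
  unfolding locally_integrable_def
proof safe
  fix K :: "(real^'n::_) set" assume K: "compact K" "K \<subseteq> \<Omega>"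
  have lin: "linear R" by (rule orthogonal_transformation_linear[OF R])
  have c: "compact (R ` K)"
    using K(1) lin by (intro compact_continuous_image linear_continuous_on) (auto simp: linear_conv_bounded_linear[symmetric])
  then have l: "R ` K \<in> sets lebesgue" using compact_imp_closed lmeasurable_compact by blast
  have "R ` K \<subseteq> \<Omega>" using K(2) \<Omega> by blast
  with u c have int: "integrable (lebesgue_on (R ` K)) u" by (simp add: locally_integrable_def)
  have v: "R -` (R ` K) = K" using orthogonal_transformation_inj[OF R] by (simp add: inj_vimage_image_eq)
  note d = lebesgue_on_distr_orthogonal_transformation[OF R l, unfolded v]
  have "integrable (distr (lebesgue_on K) (lebesgue_on (R ` K)) R) u"
    using int d(2) by simp
  then show "integrable (lebesgue_on K) (\<lambda>x. u (R x))"
    by (rule integrable_distr[OF d(1)])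
qed

lemma integral_compose_orthogonal:
  fixes R :: "real^'n::{finite,wellorder} \<Rightarrow> real^'n::_" and f :: "real^'n::_ \<Rightarrow> real"
  assumes R: "orthogonal_transformation R" and \<Omega>: "R -` \<Omega> = \<Omega>" "\<Omega> \<in> sets lebesgue"
    and f: "f \<in> borel_measurable (lebesgue_on \<Omega>)"
  shows "(LINT x|lebesgue_on \<Omega>. f (R x)) = (LINT x|lebesgue_on \<Omega>. f x)"
proof -
  note d = lebesgue_on_distr_orthogonal_transformation[OF R \<Omega>(2), unfolded \<Omega>(1)]
  have "(LINT x|lebesgue_on \<Omega>. f x) = (LINT x|distr (lebesgue_on \<Omega>) (lebesgue_on \<Omega>) R. f x)"
    by (simp only: d(2))
  also have "\<dots> = (LINT x|lebesgue_on \<Omega>. f (R x))"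
    by (rule integral_distr[OF d(1) f])
  finally show ?thesis by simp
qed

lemma AE_compose_orthogonal:
  fixes R :: "real^'n::{finite,wellorder} \<Rightarrow> real^'n::_"
  assumes R: "orthogonal_transformation R" and \<Omega>: "R -` \<Omega> = \<Omega>" "\<Omega> \<in> sets lebesgue"
    and P: "AE x in lebesgue_on \<Omega>. P x"
  shows "AE x in lebesgue_on \<Omega>. P (R x)"
proof -
  note d = lebesgue_on_distr_orthogonal_transformation[OF R \<Omega>(2), unfolded \<Omega>(1)]
  have "AE x in distr (lebesgue_on \<Omega>) (lebesgue_on \<Omega>) R. P x"
    using P by (simp only: d(2))
  then show ?thesis by (rule AE_distrD[OF d(1)])
qed

text \<open>With \<open>D\<close> the Hessian of \<open>u\<close>, the Hessian of
  \<open>u(R x)\<close> is \<open>R^T D(R x) R\<close>. Every entry mixes all entries of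
  \<open>D\<close>, so all second weak derivatives of \<open>u\<close> enter the hypothesis.\<close>

lemma has_weak_deriv_compose_orthogonal:
  fixes R :: "real^'n::{finite,wellorder} \<Rightarrow> real^'n::_"
  assumes R: "orthogonal_transformation R" and \<Omega>: "R -` \<Omega> = \<Omega>" "\<Omega> \<in> sets lebesgue"
    and u: "\<And>k l. has_weak_deriv \<Omega> [k, l] u (g k l)"
  shows "has_weak_deriv \<Omega> [i, j] (\<lambda>x. u (R x))
    (\<lambda>x. \<Sum>k\<in>UNIV. \<Sum>l\<in>UNIV. R (axis i 1) $ k * R (axis j 1) $ l * g k l (R x))"
proof -
  let ?c = "\<lambda>k l. R (axis i 1) $ k * R (axis j 1) $ l"
  have loc: "locally_integrable \<Omega> u" "locally_integrable \<Omega> (g k l)" for k l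
    using u by (auto simp: has_weak_deriv_def)
  have int: "integrable (lebesgue_on \<Omega>) (\<lambda>x. u x * iterated_deriv [k, l] \<psi> x)"
       "integrable (lebesgue_on \<Omega>) (\<lambda>x. g k l x * \<psi> x)" if "\<psi> \<in> test_functions \<Omega>" for \<psi> k l
    using loc that \<Omega>(2) by (auto intro!: integrable_mult_test_function partial_deriv_test_functions)
  have "(LINT x|lebesgue_on \<Omega>. u (R x) * iterated_deriv [i, j] \<phi> x) =
      (LINT x|lebesgue_on \<Omega>. (\<Sum>k\<in>UNIV. \<Sum>l\<in>UNIV. ?c k l * g k l (R x)) * \<phi> x)"
    if \<phi>: "\<phi> \<in> test_functions \<Omega>" for \<phi>
  proof -
    \<comment> \<open>Writing the test function as \<open>\<psi> (R x)\<close> lets the change of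
      variables act on the whole integrand; the chain rule for smooth functions then supplies the
      coefficients.\<close>
    define \<psi> where "\<psi> x = \<phi> (inv R x)" for x
    have surj: "surj R" "inj R"
      using orthogonal_transformation_bij[OF R] by (auto simp: bij_def)
    have "inv R x \<in> \<Omega> \<longleftrightarrow> R (inv R x) \<in> \<Omega>" for x
      using \<Omega>(1) by (metis vimage_eq)
    then have inv: "inv R -` \<Omega> = \<Omega>"
      by (auto simp: surj_f_inv_f[OF surj(1)])
    have \<psi>: "\<psi> \<in> test_functions \<Omega>"
      unfolding \<psi>_def by (rule test_functions_compose_orthogonal[OF orthogonal_transformation_inv[OF R] inv \<phi>])
    have \<phi>\<psi>: "\<phi> = (\<lambda>x. \<psi> (R x))" using surj by (simp add: \<psi>_def)
    have "(LINT x|lebesgue_on \<Omega>. u (R x) * iterated_deriv [i, j] \<phi> x) =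
       (LINT x|lebesgue_on \<Omega>. (\<Sum>k\<in>UNIV. \<Sum>l\<in>UNIV. ?c k l * (u (R x) * iterated_deriv [k, l] \<psi> (R x))))"
      unfolding \<phi>\<psi> second_deriv_compose_linear[OF orthogonal_transformation_linear[OF R] test_functions_smooth[OF \<psi>]]
      by (simp add: sum_distrib_left mult_ac)
    also have "\<dots> = (LINT x|lebesgue_on \<Omega>. (\<Sum>k\<in>UNIV. \<Sum>l\<in>UNIV. ?c k l * (u x * iterated_deriv [k, l] \<psi> x)))"
      by (rule integral_compose_orthogonal[OF R \<Omega>])
         (intro borel_measurable_sum borel_measurable_times borel_measurable_const borel_measurable_integrable[OF int(1)[OF \<psi>]])
    also have "\<dots> = (\<Sum>k\<in>UNIV. \<Sum>l\<in>UNIV. ?c k l * (LINT x|lebesgue_on \<Omega>. u x * iterated_deriv [k, l] \<psi> x))"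
      using int(1)[OF \<psi>] by (simp only: Bochner_Integration.integral_sum integrable_mult_right integral_mult_right_zero Bochner_Integration.integrable_sum)
    also have "\<dots> = (\<Sum>k\<in>UNIV. \<Sum>l\<in>UNIV. ?c k l * (LINT x|lebesgue_on \<Omega>. g k l x * \<psi> x))"
      using u \<psi> by (simp add: has_weak_deriv_def)
    also have "\<dots> = (LINT x|lebesgue_on \<Omega>. (\<Sum>k\<in>UNIV. \<Sum>l\<in>UNIV. ?c k l * (g k l x * \<psi> x)))"
      using int(2)[OF \<psi>] by (simp only: Bochner_Integration.integral_sum integrable_mult_right integral_mult_right_zero Bochner_Integration.integrable_sum)
    also have "\<dots> = (LINT x|lebesgue_on \<Omega>. (\<Sum>k\<in>UNIV. \<Sum>l\<in>UNIV. ?c k l * (g k l (R x) * \<psi> (R x))))"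
      by (rule integral_compose_orthogonal[OF R \<Omega>, symmetric])
         (intro borel_measurable_sum borel_measurable_times borel_measurable_const borel_measurable_integrable[OF int(2)[OF \<psi>]])
    also have "\<dots> = (LINT x|lebesgue_on \<Omega>. (\<Sum>k\<in>UNIV. \<Sum>l\<in>UNIV. ?c k l * g k l (R x)) * \<phi> x)"
      by (simp add: \<phi>\<psi> sum_distrib_right sum_distrib_left mult_ac)
    finally show ?thesis .
  qed
  moreover have "locally_integrable \<Omega> (\<lambda>x. \<Sum>k\<in>UNIV. \<Sum>l\<in>UNIV. ?c k l * g k l (R x))"
    using locally_integrable_compose_orthogonal[OF R \<Omega>(1) loc(2)]
    by (auto simp: locally_integrable_def intro!: Bochner_Integration.integrable_sum integrable_mult_right)
  ultimately show ?thesis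
    using locally_integrable_compose_orthogonal[OF R \<Omega>(1) loc(1)]
    by (simp add: has_weak_deriv_def del: iterated_deriv_simps)
qed

section \<open>Absolutely continuous functions on the unit interval\<close>

text \<open>The density is carried along as an argument, since everything below works with
  integrals; it is determined only almost everywhere.\<close>

definition abs_cont :: "(real \<Rightarrow> real) \<Rightarrow> (real \<Rightarrow> real) \<Rightarrow> bool" where
  "abs_cont F f \<longleftrightarrow> set_integrable lborel {0..1} f \<and>
     (\<forall>x\<in>{0..1}. F x = F 0 + (LBINT y:{0..x}. f y))"

lemma abs_cont_integrable: "abs_cont F f \<Longrightarrow> set_integrable lborel {0..1} f"
  by (simp add: abs_cont_def)

lemma abs_cont_integrable_on:
  "abs_cont F f \<Longrightarrow> x \<in> {0..1} \<Longrightarrow> set_integrable lborel {0..x} f"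
  by (rule set_integrable_subset[OF abs_cont_integrable]) auto

lemma abs_cont_eq: "abs_cont F f \<Longrightarrow> x \<in> {0..1} \<Longrightarrow> F x = F 0 + (LBINT y:{0..x}. f y)"
  unfolding abs_cont_def by blast

lemma abs_cont_continuous:
  assumes "abs_cont F f"
  shows "continuous_on {0..1} F"
proof -
  have "f integrable_on {0..1}"
    using set_borel_integral_eq_integral(1)[OF abs_cont_integrable[OF assms]] .
  then have "continuous_on {0..1} (\<lambda>x. F 0 + integral {0..x} f)"
    by (intro continuous_intros indefinite_integral_continuous_1)
  moreover have eq: "F 0 + integral {0..x} f = F x" if "x \<in> {0..1}" for x
    using abs_cont_eq[OF assms that] set_borel_integral_eq_integral(2)[OF abs_cont_integrable_on[OF assms that]]
    by simp
  ultimately show ?thesis by (rule continuous_on_eq)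
qed

lemma set_integrable_continuous_mult:
  assumes F: "continuous_on {0..1} F" and g: "set_integrable lborel {0..1::real} (g :: real \<Rightarrow> real)"
  shows "set_integrable lborel {0..1} (\<lambda>x. F x * g x)"
proof -
  have "bounded (F ` {0..1})"
    using F by (intro compact_imp_bounded compact_continuous_image) auto
  then obtain C where C: "\<And>x. x \<in> {0..1} \<Longrightarrow> norm (F x) \<le> C"
    unfolding bounded_iff by blast
  have "(\<lambda>x. indicator {0..1} x *\<^sub>R F x) \<in> borel_measurable borel"
    using F by (rule borel_measurable_continuous_on_indicator[rotated]) auto
  then have m: "(\<lambda>x. (indicator {0..1} x *\<^sub>R F x) * (indicator {0..1} x *\<^sub>R g x)) \<in> borel_measurable lborel"
    using g by (intro borel_measurable_times) (auto simp: set_integrable_def)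
  have "integrable lborel (\<lambda>x. (indicator {0..1} x *\<^sub>R F x) * (indicator {0..1} x *\<^sub>R g x))"
  proof (rule Bochner_Integration.integrable_bound[OF _ m])
    show "integrable lborel (\<lambda>x. C * (indicator {0..1} x *\<^sub>R g x))"
      using g by (simp add: set_integrable_def)
    show "AE x in lborel. norm (indicator {0..1} x *\<^sub>R F x * indicator {0..1} x *\<^sub>R g x) \<le> norm (C * indicator {0..1} x *\<^sub>R g x)"
    proof (intro AE_I2)
      fix x :: real
      show "norm (indicator {0..1} x *\<^sub>R F x * indicator {0..1} x *\<^sub>R g x) \<le> norm (C * indicator {0..1} x *\<^sub>R g x)"
        using C[of x] by (auto simp: indicator_def abs_mult intro!: mult_right_mono)
    qed
  qed
  also have "(\<lambda>x. (indicator {0..1} x *\<^sub>R F x) * (indicator {0..1} x *\<^sub>R g x)) = (\<lambda>x. indicator {0..1} x *\<^sub>R (F x * g x))"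
    by (auto simp: indicator_def)
  finally show ?thesis by (simp add: set_integrable_def)
qed

text \<open>Fubini on the plane cut along the diagonal into \<open>v \<le> u\<close> and
  \<open>u < v\<close>. This is integration by parts for primitives; the diagonal itself meets each
  line in a single point and does not contribute.\<close>

lemma product_of_integrals_triangle:
  fixes a b :: "real \<Rightarrow> real"
  assumes a: "integrable lborel a" and b: "integrable lborel b"
  shows "(LINT u|lborel. a u) * (LINT v|lborel. b v) =
     (LINT u|lborel. a u * (LINT v|lborel. indicator {..u} v * b v)) +
     (LINT v|lborel. (LINT u|lborel. indicator {..v} u * a u) * b v)"
    and "integrable lborel (\<lambda>u. a u * (LINT v|lborel. indicator {..u} v * b v))"
    and "integrable lborel (\<lambda>v. (LINT u|lborel. indicator {..v} u * a u) * b v)"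
proof -
  have [measurable]: "a \<in> borel_measurable borel" "b \<in> borel_measurable borel"
    using a b by auto
  have ab: "integrable (lborel \<Otimes>\<^sub>M lborel) (\<lambda>(u, v). a u * b v)"
    using a b by (intro lborel_pair.Fubini_integrable) (auto simp: abs_mult)
  have ab1: "integrable (lborel \<Otimes>\<^sub>M lborel) (\<lambda>(u, v). a u * (indicator {..u} v * b v))"
    by (rule Bochner_Integration.integrable_bound[OF ab]) (auto simp: indicator_def split_beta')
  have ab2: "integrable (lborel \<Otimes>\<^sub>M lborel) (\<lambda>(u, v). (indicator {..<v} u * a u) * b v)"
    by (rule Bochner_Integration.integrable_bound[OF ab]) (auto simp: indicator_def split_beta')
  have bu: "integrable lborel (\<lambda>v. indicator {..u} v * b v)" "integrable lborel (\<lambda>v. indicator {u<..} v * b v)" for u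
    by (rule Bochner_Integration.integrable_bound[OF b]; auto simp: indicator_def)+
  have lt: "(LINT u|lborel. indicator {..<v} u * a u) = (LINT u|lborel. indicator {..v} u * a u)" for v
  proof (rule integral_cong_AE)
    show "AE x in lborel. indicator {..<v} x * a x = indicator {..v} x * a x"
      using AE_lborel_singleton[of v] by eventually_elim (auto simp: indicator_def)
  qed auto
  have i1: "integrable lborel (\<lambda>u. a u * (LINT v|lborel. indicator {..u} v * b v))"
    using lborel_pair.integrable_fst'[OF ab1] by simp
  then show "integrable lborel (\<lambda>u. a u * (LINT v|lborel. indicator {..u} v * b v))" .
  have mv: "(LINT v|lborel. (indicator {..<v} u * a u) * b v) = a u * (LINT v|lborel. indicator {u<..} v * b v)" for u
    by (subst Bochner_Integration.integral_mult_right_zero[symmetric])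
       (intro Bochner_Integration.integral_cong refl, simp add: indicator_def)
  have i2: "integrable lborel (\<lambda>u. a u * (LINT v|lborel. indicator {u<..} v * b v))"
    using lborel_pair.integrable_fst'[OF ab2] by (simp add: mv)
  show "integrable lborel (\<lambda>v. (LINT u|lborel. indicator {..v} u * a u) * b v)"
    using lborel_pair.integrable_snd[OF ab2] by (simp add: lt)
  have swap: "(LINT u|lborel. a u * (LINT v|lborel. indicator {u<..} v * b v)) =
      (LINT v|lborel. (LINT u|lborel. indicator {..v} u * a u) * b v)"
  proof -
    have "(LINT u|lborel. a u * (LINT v|lborel. indicator {u<..} v * b v)) =
       (LINT u|lborel. LINT v|lborel. (indicator {..<v} u * a u) * b v)"
      by (simp only: mv)
    also have "\<dots> = (LINT v|lborel. LINT u|lborel. (indicator {..<v} u * a u) * b v)"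
      by (rule lborel_pair.Fubini_integral[OF ab2, symmetric])
    finally show ?thesis by (simp add: lt)
  qed
  have split: "(LINT v|lborel. b v) = (LINT v|lborel. indicator {..u} v * b v) + (LINT v|lborel. indicator {u<..} v * b v)" for u
    by (subst Bochner_Integration.integral_add[symmetric, OF bu])
       (auto intro!: Bochner_Integration.integral_cong simp: indicator_def)
  have "(LINT u|lborel. a u) * (LINT v|lborel. b v) = (LINT u|lborel. a u * (LINT v|lborel. b v))"
    by simp
  also have "\<dots> = (LINT u|lborel. a u * (LINT v|lborel. indicator {..u} v * b v) + a u * (LINT v|lborel. indicator {u<..} v * b v))"
    by (intro Bochner_Integration.integral_cong refl) (subst split, simp add: distrib_left)
  also have "\<dots> = (LINT u|lborel. a u * (LINT v|lborel. indicator {..u} v * b v)) + (LINT u|lborel. a u * (LINT v|lborel. indicator {u<..} v * b v))"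
    by (rule Bochner_Integration.integral_add[OF i1 i2])
  finally show "(LINT u|lborel. a u) * (LINT v|lborel. b v) =
     (LINT u|lborel. a u * (LINT v|lborel. indicator {..u} v * b v)) +
     (LINT v|lborel. (LINT u|lborel. indicator {..v} u * a u) * b v)"
    by (simp add: swap)
qed

text \<open>The product rule is the triangle identity for the two densities restricted to
  \<open>[0, x]\<close>. That identity concerns primitives vanishing at \<open>0\<close>, so the
  increments \<open>F x - F 0\<close> and \<open>G x - G 0\<close> are multiplied and the linear
  terms added back.\<close>

lemma abs_cont_mult:
  assumes F: "abs_cont F f" and G: "abs_cont G g"
  shows "abs_cont (\<lambda>x. F x * G x) (\<lambda>x. F x * g x + f x * G x)"
  unfolding abs_cont_def
proof (intro conjI ballI)
  have Fg: "set_integrable lborel {0..1} (\<lambda>x. F x * g x)"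
    by (intro set_integrable_continuous_mult abs_cont_continuous[OF F] abs_cont_integrable[OF G])
  have Gf: "set_integrable lborel {0..1} (\<lambda>x. G x * f x)"
    by (intro set_integrable_continuous_mult abs_cont_continuous[OF G] abs_cont_integrable[OF F])
  show "set_integrable lborel {0..1} (\<lambda>x. F x * g x + f x * G x)"
    using set_integral_add(1)[OF Fg Gf] by (simp add: mult.commute)
  fix x :: real assume x: "x \<in> {0..1}"
  let ?a = "\<lambda>u. indicator {0..x} u * f u" and ?b = "\<lambda>u. indicator {0..x} u * g u"
  have a: "integrable lborel ?a" and b: "integrable lborel ?b"
    using abs_cont_integrable_on[OF F x] abs_cont_integrable_on[OF G x] by (auto simp: set_integrable_def)
  have ia: "(LINT u|lborel. ?a u) = F x - F 0" and ib: "(LINT u|lborel. ?b u) = G x - G 0"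
    using abs_cont_eq[OF F x] abs_cont_eq[OF G x] by (auto simp: set_lebesgue_integral_def)
  have pa: "(LINT u|lborel. indicator {..v} u * ?a u) = F v - F 0"
   and pb: "(LINT u|lborel. indicator {..v} u * ?b u) = G v - G 0" if "v \<in> {0..x}" for v
  proof -
    have v: "v \<in> {0..1}" using that x by auto
    have "(LINT u|lborel. indicator {..v} u * ?a u) = (LBINT u:{0..v}. f u)"
      "(LINT u|lborel. indicator {..v} u * ?b u) = (LBINT u:{0..v}. g u)"
      unfolding set_lebesgue_integral_def using that
      by (auto intro!: Bochner_Integration.integral_cong simp: indicator_def)
    then show "(LINT u|lborel. indicator {..v} u * ?a u) = F v - F 0"
      "(LINT u|lborel. indicator {..v} u * ?b u) = G v - G 0"
      using abs_cont_eq[OF F v] abs_cont_eq[OF G v] by auto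
  qed
  have e1: "?a u * (LINT v|lborel. indicator {..u} v * ?b v) = indicator {0..x} u * (f u * (G u - G 0))" for u
    using pb[of u] by (auto simp: indicator_def)
  have e2: "(LINT u|lborel. indicator {..v} u * ?a u) * ?b v = indicator {0..x} v * ((F v - F 0) * g v)" for v
    using pa[of v] by (auto simp: indicator_def)
  note tri = product_of_integrals_triangle[OF a b, unfolded e1 e2 ia ib]
  have "F x * G x - F 0 * G 0 = (F x - F 0) * (G x - G 0) + (F x - F 0) * G 0 + F 0 * (G x - G 0)"
    by (simp add: algebra_simps)
  also have "\<dots> = (LINT u|lborel. indicator {0..x} u * (f u * (G u - G 0))) + (LINT v|lborel. indicator {0..x} v * ((F v - F 0) * g v))
      + (LINT u|lborel. ?a u * G 0) + (LINT u|lborel. F 0 * ?b u)"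
    unfolding tri(1) using ia ib by simp
  also have "\<dots> = (LINT u|lborel. indicator {0..x} u * (f u * (G u - G 0)) + indicator {0..x} u * ((F u - F 0) * g u) + ?a u * G 0 + F 0 * ?b u)"
    using tri(2,3) a b by simp
  also have "\<dots> = (LBINT u:{0..x}. F u * g u + f u * G u)"
    unfolding set_lebesgue_integral_def
    by (intro Bochner_Integration.integral_cong refl) (auto simp: algebra_simps indicator_def)
  finally show "F x * G x = F 0 * G 0 + (LBINT u:{0..x}. F u * g u + f u * G u)"
    by simp
qed

lemma abs_cont_const: "abs_cont (\<lambda>x. c) (\<lambda>x. 0)"
  by (simp add: abs_cont_def set_integrable_def set_lebesgue_integral_def)

lemma abs_cont_scale_add:
  assumes F: "abs_cont F f"
  shows "abs_cont (\<lambda>x. a + b * F x) (\<lambda>x. b * f x)"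
  unfolding abs_cont_def
proof (intro conjI ballI)
  show "set_integrable lborel {0..1} (\<lambda>x. b * f x)"
    using abs_cont_integrable[OF F] by simp
  show "a + b * F x = a + b * F 0 + (LBINT u:{0..x}. b * f u)" if "x \<in> {0..1}" for x
    using abs_cont_eq[OF F that] by (simp add: algebra_simps)
qed

lemma abs_cont_power:
  assumes F: "abs_cont F f"
  shows "abs_cont (\<lambda>x. F x ^ n) (\<lambda>x. real n * F x ^ (n - 1) * f x)"
proof (induction n)
  case 0
  show ?case using abs_cont_const[of 1] by simp
next
  case (Suc n)
  have "F x * (real n * F x ^ (n - 1) * f x) + f x * F x ^ n = real (Suc n) * F x ^ n * f x" for x
    by (cases n) (simp_all add: algebra_simps)
  with abs_cont_mult[OF F Suc] show ?case by simp
qed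

lemma abs_cont_density_cong_AE:
  assumes F: "abs_cont F f" and ae: "AE x in lborel. x \<in> {0..1} \<longrightarrow> f x = g x"
    and g: "set_integrable lborel {0..1} g"
  shows "abs_cont F g"
  unfolding abs_cont_def
proof (intro conjI ballI g)
  fix x :: real assume x: "x \<in> {0..1}"
  have gx: "set_integrable lborel {0..x} g" by (rule set_integrable_subset[OF g]) (use x in auto)
  have "(LBINT u:{0..x}. f u) = (LBINT u:{0..x}. g u)"
    unfolding set_lebesgue_integral_def
  proof (rule integral_cong_AE)
    show "AE u in lborel. indicator {0..x} u *\<^sub>R f u = indicator {0..x} u *\<^sub>R g u"
      using ae by eventually_elim (use x in \<open>auto simp: indicator_def\<close>)
  qed (use gx abs_cont_integrable_on[OF F x] in \<open>auto simp: set_integrable_def\<close>)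
  then show "F x = F 0 + (LBINT u:{0..x}. g u)"
    using abs_cont_eq[OF F x] by simp
qed

text \<open>The end point \<open>c\<close> is variable because test functions control only intervals
  that stay away from \<open>1\<close>; the full interval is exhausted later.\<close>

lemma AE_eq_0_if_set_integral_eq_0:
  fixes f :: "real \<Rightarrow> real"
  assumes f: "set_integrable lborel {0..1} f"
    and zero: "\<And>a b. 0 \<le> a \<Longrightarrow> a < b \<Longrightarrow> b \<le> c \<Longrightarrow> (LBINT x:{a<..<b}. f x) = 0" and c: "c \<le> 1"
  shows "AE x in lborel. x \<in> {0<..<c} \<longrightarrow> f x = 0"
proof -
  have "set_integrable lborel {0<..<c} f"
    by (rule set_integrable_subset[OF f]) (use c in auto)
  then have int: "integrable lborel (\<lambda>x. indicator {0<..<c} x * f x)"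
    by (simp add: set_integrable_def)
  have "AE x in lborel. indicator {0<..<c} x * f x = 0"
  proof (rule AE_eq_0_if_integral_box_eq_0_lborel[OF int])
    fix a b :: real
    have "(LINT x|lborel. indicator (box a b) x * (indicator {0<..<c} x * f x)) = (LBINT x:{max a 0<..<min b c}. f x)"
      unfolding set_lebesgue_integral_def
      by (intro Bochner_Integration.integral_cong refl) (auto simp: indicator_def box_real)
    also have "\<dots> = 0"
    proof (cases "max a 0 < min b c")
      case True then show ?thesis by (intro zero) auto
    next
      case False
      then have "{max a 0<..<min b c} = {}" by auto
      then show ?thesis by (simp add: set_lebesgue_integral_def)
    qed
    finally show "(LINT x|lborel. indicator (box a b) x * (indicator {0<..<c} x * f x)) = 0" .
  qed
  then show ?thesis by eventually_elim auto
qed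

lemma set_integral_greaterThanLessThan_diff:
  fixes f :: "real \<Rightarrow> real"
  assumes f: "set_integrable lborel {0..1} f" and ab: "0 \<le> a" "a < b" "b \<le> 1"
  shows "(LBINT x:{a<..<b}. f x) = (LBINT x:{0..b}. f x) - (LBINT x:{0..a}. f x)"
proof -
  have i: "set_integrable lborel {0..a} f" "set_integrable lborel {0..b} f" "set_integrable lborel {a<..<b} f"
    by (rule set_integrable_subset[OF f]; use ab in auto)+
  have "(LBINT x:{0..b}. f x) - (LBINT x:{0..a}. f x) = (LINT x|lborel. indicator {0..b} x *\<^sub>R f x - indicator {0..a} x *\<^sub>R f x)"
    using i by (simp add: set_lebesgue_integral_def set_integrable_def)
  also have "\<dots> = (LBINT x:{a<..<b}. f x)"
    unfolding set_lebesgue_integral_def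
  proof (rule integral_cong_AE)
    show "AE x in lborel. indicator {0..b} x *\<^sub>R f x - indicator {0..a} x *\<^sub>R f x = indicator {a<..<b} x *\<^sub>R f x"
      using AE_lborel_singleton[of b] by eventually_elim (use ab in \<open>auto simp: indicator_def\<close>)
  qed (use i in \<open>auto simp: set_integrable_def\<close>)
  finally show ?thesis by simp
qed

text \<open>This is the probability of exactly one success in \<open>n\<close> independent trials, a
  single term of the expansion of \<open>(x + (1 - x))^n = 1\<close>.\<close>

lemma binomial_one_success_bound:
  fixes x :: real
  assumes "0 \<le> x" "x \<le> 1"
  shows "real n * x * (1 - x) ^ (n - 1) \<le> 1"
proof (cases n)
  case (Suc m)
  have "(\<Sum>k\<le>n. real (n choose k) * x ^ k * (1 - x) ^ (n - k)) = 1"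
    using binomial_ring[of x "1 - x" n] by simp
  moreover have "(\<Sum>k\<in>{1}. real (n choose k) * x ^ k * (1 - x) ^ (n - k)) \<le> (\<Sum>k\<le>n. real (n choose k) * x ^ k * (1 - x) ^ (n - k))"
    by (rule sum_mono2) (use Suc assms in auto)
  ultimately show ?thesis by simp
qed simp

lemma abs_cont_zero_density:
  assumes F: "abs_cont F f" and zero: "\<And>x. x \<in> {0..1} \<Longrightarrow> F x = 0"
  shows "AE x in lborel. x \<in> {0<..<1} \<longrightarrow> f x = 0"
proof (rule AE_eq_0_if_set_integral_eq_0[OF abs_cont_integrable[OF F]])
  fix a b :: real assume ab: "0 \<le> a" "a < b" "b \<le> 1"
  have "(LBINT y:{0..x}. f y) = 0" if "x \<in> {0..1}" for x
    using abs_cont_eq[OF F that] zero[OF that] zero[of 0] by simp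
  then show "(LBINT x:{a<..<b}. f x) = 0"
    using ab by (subst set_integral_greaterThanLessThan_diff[OF abs_cont_integrable[OF F]]) auto
qed simp

text \<open>Testing with the approximations \<open>u (1 - u\<^sup>2)\<^sup>n\<close>, whose derivatives are bounded and tend to
  the indicator function of \<open>{0}\<close>, avoids differentiation almost everywhere.\<close>

lemma abs_cont_density_eq_0_on_zero_set:
  assumes F0: "abs_cont F0 f0"
  shows "AE x in lborel. x \<in> {0<..<1} \<longrightarrow> F0 x = 0 \<longrightarrow> f0 x = 0"
proof -
  have "bounded (F0 ` {0..1})"
    by (intro compact_imp_bounded compact_continuous_image abs_cont_continuous[OF F0]) auto
  then obtain C where C: "\<And>x. x \<in> {0..1} \<Longrightarrow> \<bar>F0 x\<bar> \<le> C"
    unfolding bounded_iff real_norm_def by blast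
  \<comment> \<open>Rescaling to absolute value below \<open>1\<close> does not change the zero set
    and makes the powers of \<open>1 - F^2\<close> tend to \<open>0\<close> off that set.\<close>
  define c where "c = 1 / (\<bar>C\<bar> + 1)"
  define F where "F x = 0 + c * F0 x" for x
  define f where "f x = c * f0 x" for x
  have c: "c > 0" by (simp add: c_def)
  have F: "abs_cont F f"
    unfolding F_def f_def by (rule abs_cont_scale_add[OF F0])
  have F1: "\<bar>F x\<bar> < 1" if "x \<in> {0..1}" for x
  proof -
    have "\<bar>F0 x\<bar> < \<bar>C\<bar> + 1" using C[OF that] by linarith
    then have "c * \<bar>F0 x\<bar> < 1" by (simp add: c_def divide_less_eq)
    then show ?thesis using c by (simp add: F_def abs_mult)
  qed
  have F2: "(F x)\<^sup>2 < 1" if "x \<in> {0..1}" for x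
    using F1[OF that] by (simp add: abs_square_less_1)
  let ?h = "\<lambda>n x. F x * (real n * (1 + (-1) * F x ^ 2) ^ (n - 1) * ((-1) * (real 2 * F x ^ (2 - 1) * f x))) + f x * (1 + (-1) * F x ^ 2) ^ n"
  have H: "abs_cont (\<lambda>x. F x * (1 + (-1) * F x ^ 2) ^ n) (?h n)" for n
    by (rule abs_cont_mult[OF F abs_cont_power[OF abs_cont_scale_add[OF abs_cont_power[OF F]]]])
  have heq: "?h n x = f x * ((1 - (F x)\<^sup>2) ^ n - 2 * (real n * (F x)\<^sup>2 * (1 - (F x)\<^sup>2) ^ (n - 1)))" for n x
    by (simp add: power2_eq_square algebra_simps)
  let ?k = "\<lambda>x. if F x = 0 then f x else 0"
  have hb: "norm (?h n x) \<le> 3 * \<bar>f x\<bar>" if "x \<in> {0..1}" for n x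
  proof -
    have 1: "0 \<le> (1 - (F x)\<^sup>2) ^ n" "(1 - (F x)\<^sup>2) ^ n \<le> 1"
      using F2[OF that] by (auto intro: power_le_one)
    have 2: "real n * (F x)\<^sup>2 * (1 - (F x)\<^sup>2) ^ (n - 1) \<le> 1" "0 \<le> real n * (F x)\<^sup>2 * (1 - (F x)\<^sup>2) ^ (n - 1)"
      using F2[OF that] binomial_one_success_bound[of "(F x)\<^sup>2" n] by auto
    \<comment> \<open>The bound \<open>3\<close> is \<open>1 + 2 * 1\<close>: at most
      \<open>1\<close> from the power, and at most \<open>1\<close> from the binomial term, which is
      doubled.\<close>
    have "\<bar>(1 - (F x)\<^sup>2) ^ n - 2 * (real n * (F x)\<^sup>2 * (1 - (F x)\<^sup>2) ^ (n - 1))\<bar> \<le> 3"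
      using 1 2 by linarith
    then show ?thesis
      unfolding heq real_norm_def abs_mult by (metis abs_ge_zero mult.commute mult_left_mono)
  qed
  have hl: "(\<lambda>n. ?h n x) \<longlonglongrightarrow> ?k x" if "x \<in> {0..1}" for x
  proof (cases "F x = 0")
    case True
    then show ?thesis by simp
  next
    case False
    define q where "q = 1 - (F x)\<^sup>2"
    have q: "0 \<le> q" "q < 1" using F2[OF that] False by (auto simp: q_def)
    have l1: "(\<lambda>n. q ^ n) \<longlonglongrightarrow> 0" using q by (intro LIMSEQ_power_zero) auto
    have l2: "(\<lambda>n. real n * q ^ n) \<longlonglongrightarrow> 0" using q by (intro powser_times_n_limit_0) auto
    have "(\<lambda>n. real (Suc n) * q ^ n) \<longlonglongrightarrow> 0"
      using tendsto_add[OF l2 l1] by (simp add: algebra_simps)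
    then have "(\<lambda>n. real (Suc n) * q ^ (Suc n - 1)) \<longlonglongrightarrow> 0" by simp
    then have l3: "(\<lambda>n. real n * q ^ (n - 1)) \<longlonglongrightarrow> 0" by (rule LIMSEQ_imp_Suc)
    have "(\<lambda>n. f x * (q ^ n - 2 * (F x)\<^sup>2 * (real n * q ^ (n - 1)))) \<longlonglongrightarrow> f x * (0 - 2 * (F x)\<^sup>2 * 0)"
      by (intro tendsto_intros l1 l3)
    with False show ?thesis unfolding heq by (simp add: q_def mult_ac)
  qed
  have Gl: "(\<lambda>n. F x * (1 + (-1) * F x ^ 2) ^ n) \<longlonglongrightarrow> 0" if "x \<in> {0..1}" for x
  proof (cases "F x = 0")
    case False
    then have "(\<lambda>n. (1 - (F x)\<^sup>2) ^ n) \<longlonglongrightarrow> 0"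
      using F2[OF that] by (intro LIMSEQ_power_zero) auto
    then show ?thesis using tendsto_mult_right_zero by fastforce
  qed simp
  have Fm: "(\<lambda>x. indicator {0..1} x *\<^sub>R F x) \<in> borel_measurable borel"
    using abs_cont_continuous[OF F] by (rule borel_measurable_continuous_on_indicator[rotated]) auto
  have fm: "(\<lambda>x. indicator {0..1} x *\<^sub>R f x) \<in> borel_measurable borel"
    using abs_cont_integrable[OF F] by (auto simp: set_integrable_def)
  have km: "(\<lambda>y. indicator {0..1} y *\<^sub>R ?k y) \<in> borel_measurable borel"
  proof -
    note [measurable] = Fm fm
    have "(\<lambda>y. if indicator {0..1} y *\<^sub>R F y = 0 then indicator {0..1} y *\<^sub>R f y else 0) \<in> borel_measurable borel"
      by measurable
    also have "(\<lambda>y. if indicator {0..1} y *\<^sub>R F y = 0 then indicator {0..1} y *\<^sub>R f y else 0) = (\<lambda>y. indicator {0..1} y *\<^sub>R ?k y)"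
      by (auto simp: fun_eq_iff indicator_def)
    finally show ?thesis .
  qed
  have fi: "integrable lborel (\<lambda>y. 3 * \<bar>indicator {0..1} y *\<^sub>R f y\<bar>)"
    using abs_cont_integrable[OF F] by (simp add: set_integrable_def)
  \<comment> \<open>The primitives \<open>F (1 - F^2)^n\<close> tend to \<open>0\<close>, on the
    zero set trivially and elsewhere by decay. Their densities tend to \<open>?k\<close> under the
    bound \<open>3 |f|\<close>, so \<open>?k\<close> is a density of the zero function.\<close>
  have K: "abs_cont (\<lambda>x. 0) ?k"
    unfolding abs_cont_def
  proof (intro conjI ballI)
    show ki: "set_integrable lborel {0..1} ?k"
      unfolding set_integrable_def
      by (rule Bochner_Integration.integrable_bound[OF fi]) (use km in \<open>auto simp: indicator_def\<close>)
    fix x :: real assume x: "x \<in> {0..1}"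
    have "(\<lambda>n. LBINT y:{0..x}. ?h n y) \<longlonglongrightarrow> (LBINT y:{0..x}. ?k y)"
      unfolding set_lebesgue_integral_def
    proof (rule integral_dominated_convergence[OF _ _ fi])
      show "(\<lambda>y. indicator {0..x} y *\<^sub>R ?k y) \<in> borel_measurable lborel"
        using set_integrable_subset[OF ki, of "{0..x}"] x by (auto simp: set_integrable_def)
      show "(\<lambda>y. indicator {0..x} y *\<^sub>R ?h n y) \<in> borel_measurable lborel" for n
        using abs_cont_integrable_on[OF H x] by (auto simp: set_integrable_def)
      show "AE y in lborel. (\<lambda>n. indicator {0..x} y *\<^sub>R ?h n y) \<longlonglongrightarrow> indicator {0..x} y *\<^sub>R ?k y"
      proof (intro AE_I2)
        fix y show "(\<lambda>n. indicator {0..x} y *\<^sub>R ?h n y) \<longlonglongrightarrow> indicator {0..x} y *\<^sub>R ?k y"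
          using hl[of y] x by (cases "y \<in> {0..x}") auto
      qed
      show "AE y in lborel. norm (indicator {0..x} y *\<^sub>R ?h n y) \<le> 3 * \<bar>indicator {0..1} y *\<^sub>R f y\<bar>" for n
      proof (intro AE_I2)
        fix y show "norm (indicator {0..x} y *\<^sub>R ?h n y) \<le> 3 * \<bar>indicator {0..1} y *\<^sub>R f y\<bar>"
          using hb[of y n] x by (cases "y \<in> {0..x}") auto
      qed
    qed
    moreover have "(LBINT y:{0..x}. ?h n y) = F x * (1 + (-1) * F x ^ 2) ^ n - F 0 * (1 + (-1) * F 0 ^ 2) ^ n" for n
      using abs_cont_eq[OF H x, of n] by simp
    moreover have "(\<lambda>n. F x * (1 + (-1) * F x ^ 2) ^ n - F 0 * (1 + (-1) * F 0 ^ 2) ^ n) \<longlonglongrightarrow> 0 - 0"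
      using x by (intro tendsto_diff Gl) auto
    ultimately show "0 = 0 + (LBINT y:{0..x}. ?k y)"
      using LIMSEQ_unique by fastforce
  qed
  have "AE x in lborel. x \<in> {0<..<1} \<longrightarrow> ?k x = 0"
    by (rule abs_cont_zero_density[OF K]) simp
  then show ?thesis
    by eventually_elim (use c in \<open>auto simp: F_def f_def split: if_splits\<close>)
qed

text \<open>The measure \<open>ds / s\<close> is invariant under scaling. Substituting
  \<open>s / 2\<close> equates the integrals of \<open>c / s\<close> over \<open>(0, 1)\<close> and
  \<open>(0, 2)\<close>; were both finite, \<open>c / s\<close> would integrate to \<open>0\<close>
  over \<open>[1, 2)\<close>, where \<open>1 / s\<close> is positive.\<close>

lemma inverse_not_set_integrable:
  assumes "set_integrable lborel {0<..<1} (\<lambda>s::real. c / s)"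
  shows "c = 0"
proof -
  let ?f = "\<lambda>s. indicator {0<..<1} s * (c / s)"
  have f: "integrable lborel ?f"
    using assms by (simp add: set_integrable_def)
  have scale: "(1/2) * ?f (0 + (1/2) * s) = indicator {0<..<2} s * (c / s)" for s
    by (auto simp: indicator_def)
  have g: "integrable lborel (\<lambda>s. indicator {0<..<2} s * (c / s))"
    using integrable_mult_right[OF lborel_integrable_real_affine[OF f, of "1/2" 0], of "1/2"] unfolding scale by simp
  have "(LINT s|lborel. ?f s) = \<bar>1/2\<bar> *\<^sub>R (LINT s|lborel. ?f (0 + (1/2) * s))"
    by (rule lborel_integral_real_affine) simp
  also have "\<dots> = (LINT s|lborel. (1/2) * ?f (0 + (1/2) * s))"
    by (subst integral_mult_right_zero) simp
  also have "\<dots> = (LINT s|lborel. indicator {0<..<2} s * (c / s))"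
    by (simp only: scale)
  finally have "(LINT s|lborel. indicator {0<..<2} s * (c / s) - ?f s) = 0"
    using f g by simp
  also have "(\<lambda>s. indicator {0<..<2} s * (c / s) - ?f s) = (\<lambda>s. c * (indicator {1..<2} s / s))"
    by (auto simp: fun_eq_iff indicator_def)
  finally have "c * (LINT s|lborel. indicator {1..<2} s / s) = 0"
    by (simp only: integral_mult_right_zero)
  moreover have "0 < (LINT s|lborel. indicator {1..<2::real} s / s)"
  proof -
    have j: "integrable lborel (indicator {1..<2::real} :: real \<Rightarrow> real)"
      by (rule integrable_real_indicator) auto
    then have i: "integrable lborel (\<lambda>s::real. indicator {1..<2} s / s)"
      by (rule Bochner_Integration.integrable_bound) (auto simp: indicator_def)
    have "(LINT s|lborel. indicator {1..<2::real} s / 2) \<le> (LINT s|lborel. indicator {1..<2::real} s / s)"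
      by (intro integral_mono integrable_divide j i) (auto simp: indicator_def field_simps)
    then show ?thesis by simp
  qed
  ultimately show ?thesis by simp
qed

text \<open>For \<open>h = F M\<close> the hypothesis reads \<open>h' = h / s\<close> almost
  everywhere. As \<open>h / s\<close> is continuous on \<open>(0, 1)\<close>, the equation holds in
  the classical sense, so \<open>h / s\<close> is a constant \<open>c\<close> and
  \<open>h / s^2 = c / s\<close> can be integrable only for \<open>c = 0\<close>.\<close>

lemma abs_cont_product_vanishes:
  assumes F: "abs_cont F f" and M: "abs_cont M m"
    and ode: "AE s in lborel. s \<in> {0<..<1} \<longrightarrow> F s * m s + f s * M s = F s * M s / s"
    and int: "set_integrable lborel {0<..<1} (\<lambda>s. F s * M s / s\<^sup>2)"
  shows "AE s in lborel. s \<in> {0<..<1} \<longrightarrow> f s * m s = 0"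
proof -
  define h where "h s = F s * M s" for s
  define k where "k s = (if s = 0 then 0 else h s / s)" for s
  have h0: "abs_cont h (\<lambda>s. F s * m s + f s * M s)"
    unfolding h_def by (rule abs_cont_mult[OF F M])
  have hc: "continuous_on {0..1} h" by (rule abs_cont_continuous[OF h0])
  have ae: "AE s in lborel. s \<in> {0..1} \<longrightarrow> F s * m s + f s * M s = k s"
    using ode AE_lborel_singleton[of 0] AE_lborel_singleton[of 1]
    by eventually_elim (auto simp: k_def h_def)
  have "set_integrable lborel {0..1} k"
    unfolding set_integrable_def
  proof (rule integrable_cong_AE_imp)
    show "integrable lborel (\<lambda>s. indicator {0..1} s *\<^sub>R (F s * m s + f s * M s))"
      using abs_cont_integrable[OF h0] by (simp add: set_integrable_def)
    have [measurable]: "(\<lambda>s. indicator {0..1} s *\<^sub>R h s) \<in> borel_measurable borel"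
      using hc by (rule borel_measurable_continuous_on_indicator[rotated]) auto
    have "(\<lambda>s. if s = 0 then 0 else indicator {0..1} s *\<^sub>R h s / s) \<in> borel_measurable borel"
      by measurable
    also have "(\<lambda>s. if s = 0 then 0 else indicator {0..1} s *\<^sub>R h s / s) = (\<lambda>s. indicator {0..1} s *\<^sub>R k s)"
      by (auto simp: fun_eq_iff k_def)
    finally show "(\<lambda>s. indicator {0..1} s *\<^sub>R k s) \<in> borel_measurable lborel" by simp
    show "AE s in lborel. indicator {0..1} s *\<^sub>R (F s * m s + f s * M s) = indicator {0..1} s *\<^sub>R k s"
      using ae by eventually_elim (auto simp: indicator_def)
  qed
  \<comment> \<open>Exchanging the density for the almost everywhere equal \<open>k\<close>,
    continuous inside the interval, opens the way to the fundamental theorem of calculus at every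
    interior point.\<close>
  then have hk: "abs_cont h k"
    by (rule abs_cont_density_cong_AE[OF h0 ae])
  have ki: "k integrable_on {0..1}"
    using set_borel_integral_eq_integral(1)[OF abs_cont_integrable[OF hk]] .
  have heq: "h x = h 0 + integral {0..x} k" if "x \<in> {0..1}" for x
    using abs_cont_eq[OF hk that] set_borel_integral_eq_integral(2)[OF abs_cont_integrable_on[OF hk that]]
    by simp
  have hd: "(h has_real_derivative h x / x) (at x)" if x: "x \<in> {0<..<1}" for x
  proof -
    have "isCont h x"
      using hc x by (metis continuous_on_interior interior_atLeastAtMost_real)
    then have "((\<lambda>s. h s / s) \<longlongrightarrow> h x / x) (at x)"
      using x by (intro tendsto_intros) (auto simp: isCont_def)
    then have "(k \<longlongrightarrow> h x / x) (at x)"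
      by (rule Lim_transform_within_open[where s = "{0<..}"]) (use x in \<open>auto simp: k_def\<close>)
    then have "isCont k x" using x by (auto simp: isCont_def k_def[of x])
    then have "continuous (at x within {0..1}) k" by (rule continuous_at_imp_continuous_at_within)
    then have "((\<lambda>x. integral {0..x} k) has_vector_derivative k x) (at x within {0..1})"
      using integral_has_vector_derivative_continuous_at[OF ki, of x "{}"] x by auto
    from has_vector_derivative_add[OF has_vector_derivative_const[of "h 0"] this]
    have "((\<lambda>x. h 0 + integral {0..x} k) has_vector_derivative k x) (at x within {0..1})" by simp
    from has_vector_derivative_transform[OF _ heq this] x
    have "(h has_vector_derivative k x) (at x within {0..1})" by simp
    then show ?thesis
      using x at_within_interior[of x "{0..1}"] by (simp add: has_real_derivative_iff_has_vector_derivative k_def)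
  qed
  then have "((\<lambda>x. h x / x) has_real_derivative 0) (at x)" if "x \<in> {0<..<1}" for x
    using that by (auto intro!: derivative_eq_intros)
  then have "\<exists>c. \<forall>x\<in>{0<..<1}. h x / x = c"
    by (intro has_field_derivative_zero_constant) (auto intro: has_field_derivative_at_within)
  then obtain c where c: "\<And>x. x \<in> {0<..<1} \<Longrightarrow> h x / x = c" by blast
  have "h s / s\<^sup>2 = c / s" if "s \<in> {0<..<1}" for s
    using c[OF that] that by (auto simp: power2_eq_square field_simps)
  then have "set_integrable lborel {0<..<1} (\<lambda>s. h s / s\<^sup>2) = set_integrable lborel {0<..<1} (\<lambda>s. c / s)"
    by (intro set_integrable_cong refl)
  with int have "set_integrable lborel {0<..<1} (\<lambda>s. c / s)"
    by (simp add: h_def)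
  then have "c = 0" by (rule inverse_not_set_integrable)
  then have FM: "F s * M s = 0" if "s \<in> {0<..<1}" for s
    using c[OF that] that by (simp add: h_def)
  show ?thesis
    using abs_cont_density_eq_0_on_zero_set[OF F] abs_cont_density_eq_0_on_zero_set[OF M]
    by eventually_elim (use FM in auto)
qed

text \<open>The primitive is normalised to vanish to the right of \<open>b\<close>. Left of
  \<open>a\<close> it is constant, in general not zero, so composed with \<open>|x|^2\<close> it has
  compact support in the disk for \<open>b < 1\<close> without vanishing at the centre.\<close>

lemma bump_antiderivative:
  obtains \<psi> where "\<And>s. (\<psi> has_real_derivative bump n a b s) (at s)" "\<And>s. b \<le> s \<Longrightarrow> \<psi> s = 0"
proof -
  have "\<exists>\<Psi>. \<forall>x::real. -\<infinity> < ereal x \<longrightarrow> ereal x < \<infinity> \<longrightarrow> (\<Psi> has_vector_derivative bump n a b x) (at x)"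
    using continuous_on_bump[of UNIV n a b]
    by (intro einterval_antiderivative) (auto simp: continuous_on_eq_continuous_at)
  then obtain \<Psi> where \<Psi>: "\<And>x. (\<Psi> has_real_derivative bump n a b x) (at x)"
    by (auto simp: has_real_derivative_iff_has_vector_derivative)
  show thesis
  proof (rule that[of "\<lambda>s. \<Psi> s - \<Psi> b"])
    show "((\<lambda>s. \<Psi> s - \<Psi> b) has_real_derivative bump n a b s) (at s)" for s
      using \<Psi> by (auto intro!: derivative_eq_intros)
    show "\<Psi> s - \<Psi> b = 0" if "b \<le> s" for s
    proof (cases "b = s")
      case False
      then obtain z where "b < z" "z < s" "\<Psi> s - \<Psi> b = (s - b) * bump n a b z"
        using MVT2[of b s \<Psi> "bump n a b"] \<Psi> \<open>b \<le> s\<close> by auto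
      then show ?thesis by (simp add: bump_eq_0)
    qed simp
  qed
qed

lemma bump_abs_cont:
  assumes "\<And>s. (\<psi> has_real_derivative bump n a b s) (at s)"
  shows "abs_cont \<psi> (bump n a b)"
  unfolding abs_cont_def
proof (intro conjI ballI)
  show bi: "set_integrable lborel {0..1} (bump n a b)"
    by (rule borel_integrable_compact[unfolded set_integrable_def[symmetric]] | rule borel_integrable_atLeastAtMost')+
       (auto intro: continuous_on_bump)
  fix x :: real assume x: "x \<in> {0..1}"
  have "(bump n a b has_integral \<psi> x - \<psi> 0) {0..x}"
    using x assms by (intro fundamental_theorem_of_calculus)
      (auto simp: has_real_derivative_iff_has_vector_derivative[symmetric] intro: DERIV_subset)
  moreover have "set_integrable lborel {0..x} (bump n a b)"
    by (rule set_integrable_subset[OF bi]) (use x in auto)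
  ultimately show "\<psi> x = \<psi> 0 + (LBINT y:{0..x}. bump n a b y)"
    using set_borel_integral_eq_integral(2)[of "{0..x}" "bump n a b"] by (simp add: integral_unique)
qed

lemma set_integral_singleton: "(LBINT y:{a::real}. t y :: real) = 0"
  unfolding set_lebesgue_integral_def
proof (rule integral_eq_zero_AE)
  show "AE y in lborel. indicator {a} y *\<^sub>R t y = 0"
    using AE_lborel_singleton[of a] by eventually_elim auto
qed

lemma abs_cont_indefinite_integral:
  "set_integrable lborel {0..1} t \<Longrightarrow> abs_cont (\<lambda>s. LBINT y:{0..s}. t y) t"
  by (simp add: abs_cont_def set_integral_singleton)

lemma weak_radial_equation:
  assumes t: "set_integrable lborel {0..1} t" and m: "set_integrable lborel {0..1} m"
    and test: "\<And>n a b \<psi>. 0 \<le> a \<Longrightarrow> a < b \<Longrightarrow> b < 1 \<Longrightarrow> (\<And>s. (\<psi> has_real_derivative bump n a b s) (at s)) \<Longrightarrow>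
      (\<And>s. b \<le> s \<Longrightarrow> \<psi> s = 0) \<Longrightarrow> (LBINT s:{0..1}. \<psi> s * t s + bump n a b s * m s) = 0"
  shows "AE s in lborel. s \<in> {0<..<1} \<longrightarrow> m s = (LBINT y:{0..s}. t y)"
proof -
  define M where "M s = (LBINT y:{0..s}. t y)" for s
  have "M 0 = 0" by (simp add: M_def set_integral_singleton)
  have M: "abs_cont M t"
    unfolding M_def by (rule abs_cont_indefinite_integral[OF t])
  define d where "d s = m s - M s" for s
  have Mi: "set_integrable lborel {0..1} M"
    by (rule borel_integrable_atLeastAtMost') (rule abs_cont_continuous[OF M])
  have di: "set_integrable lborel {0..1} d"
    unfolding d_def by (rule set_integral_diff(1)[OF m Mi])
  have dzero: "(LBINT s:{0..1}. bump n a b s * d s) = 0" if ab: "0 \<le> a" "a < b" "b < 1" for n a b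
  proof -
    obtain \<psi> where \<psi>: "\<And>s. (\<psi> has_real_derivative bump n a b s) (at s)" "\<And>s. b \<le> s \<Longrightarrow> \<psi> s = 0"
      using bump_antiderivative[of n a b] by blast
    note P = bump_abs_cont[OF \<psi>(1)]
    have i1: "set_integrable lborel {0..1} (\<lambda>s. \<psi> s * t s)"
      by (intro set_integrable_continuous_mult abs_cont_continuous[OF P] t)
    have i2: "set_integrable lborel {0..1} (\<lambda>s. bump n a b s * m s)" "set_integrable lborel {0..1} (\<lambda>s. bump n a b s * M s)"
      by (intro set_integrable_continuous_mult continuous_on_bump m Mi)+
    have "(LBINT s:{0..1}. \<psi> s * t s + bump n a b s * M s) = 0"
      using abs_cont_eq[OF abs_cont_mult[OF P M], of 1] \<psi>(2)[of 1] ab \<open>M 0 = 0\<close> by simp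
    moreover have "(LBINT s:{0..1}. \<psi> s * t s + bump n a b s * m s) = 0"
      by (rule test[OF ab \<psi>])
    ultimately have "(LBINT s:{0..1}. bump n a b s * m s) - (LBINT s:{0..1}. bump n a b s * M s) = 0"
      using i1 i2 by simp
    then show ?thesis using i2 by (simp add: d_def right_diff_distrib)
  qed
  have open_zero: "(LBINT s:{a<..<b}. d s) = 0" if ab: "0 \<le> a" "a < b" "b < 1" for a b
  proof -
    have "(\<lambda>n. LBINT s:{0..1}. bump n a b s * d s) \<longlonglongrightarrow> (LBINT s:{a<..<b}. d s)"
      unfolding set_lebesgue_integral_def
    proof (rule integral_dominated_convergence)
      show "integrable lborel (\<lambda>s. norm (indicator {0..1} s *\<^sub>R d s))"
        using di by (simp add: set_integrable_def)
      have "set_integrable lborel {a<..<b} d"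
        by (rule set_integrable_subset[OF di]) (use ab in auto)
      then show "(\<lambda>s. indicator {a<..<b} s *\<^sub>R d s) \<in> borel_measurable lborel"
        by (auto simp: set_integrable_def)
      show "(\<lambda>s. indicator {0..1} s *\<^sub>R (bump n a b s * d s)) \<in> borel_measurable lborel" for n
        using set_integrable_continuous_mult[OF continuous_on_bump di, of n a b]
        by (auto simp: set_integrable_def)
      show "AE s in lborel. (\<lambda>n. indicator {0..1} s *\<^sub>R (bump n a b s * d s)) \<longlonglongrightarrow> indicator {a<..<b} s *\<^sub>R d s"
      proof (intro AE_I2)
        fix s
        have "(\<lambda>n. indicator {0..1} s *\<^sub>R (bump n a b s * d s)) \<longlonglongrightarrow> indicator {0..1} s *\<^sub>R (indicator {a<..<b} s * d s)"
          by (intro tendsto_intros bump_tendsto)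
        also have "indicator {0..1} s *\<^sub>R (indicator {a<..<b} s * d s) = indicator {a<..<b} s *\<^sub>R d s"
          using ab by (auto simp: indicator_def)
        finally show "(\<lambda>n. indicator {0..1} s *\<^sub>R (bump n a b s * d s)) \<longlonglongrightarrow> indicator {a<..<b} s *\<^sub>R d s" .
      qed
      show "AE s in lborel. norm (indicator {0..1} s *\<^sub>R (bump n a b s * d s)) \<le> norm (indicator {0..1} s *\<^sub>R d s)" for n
        by (intro AE_I2) (auto simp: indicator_def abs_mult bump_nonneg bump_le_1 mult_left_le_one_le)
    qed
    then show ?thesis unfolding dzero[OF ab] by (simp add: LIMSEQ_const_iff)
  qed
  \<comment> \<open>Only intervals with \<open>b < 1\<close> were tested, so \<open>(0, 1)\<close>
    is exhausted by countably many shorter intervals.\<close>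
  have "AE s in lborel. s \<in> {0<..<1 - 1 / real (Suc n)} \<longrightarrow> d s = 0" for n
  proof (intro AE_eq_0_if_set_integral_eq_0[OF di])
    fix a b :: real assume ab: "0 \<le> a" "a < b" and b: "b \<le> 1 - 1 / real (Suc n)"
    have "0 < 1 / real (Suc n)" by simp
    with b have "b < 1" by linarith
    with ab show "(LBINT s:{a<..<b}. d s) = 0" by (rule open_zero)
  qed simp
  then have "AE s in lborel. \<forall>n. s \<in> {0<..<1 - 1 / real (Suc n)} \<longrightarrow> d s = 0"
    by (subst AE_all_countable) blast
  then show ?thesis
  proof eventually_elim
    case (elim s)
    show ?case
    proof
      assume s: "s \<in> {0<..<1}"
      then have "0 < 1 - s" by simp
      from reals_Archimedean[OF this] obtain n where "inverse (real (Suc n)) < 1 - s" by blast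
      then have "s < 1 - 1 / real (Suc n)"
        unfolding inverse_eq_divide by linarith
      with s have "s \<in> {0<..<1 - 1 / real (Suc n)}"
        by (simp only: greaterThanLessThan_iff)
      with elim have "d s = 0" by blast
      then show "m s = (LBINT y:{0..s}. t y)" by (simp add: d_def M_def)
    qed
  qed
qed

section \<open>The derivative of the energy\<close>

definition mat_L2 :: "(real^2 \<Rightarrow> real^2^2) set" where
  "mat_L2 = {F. \<forall>i j. (\<lambda>x. F x $ i $ j) \<in> L2 disk}"

definition mat_ip :: "(real^2 \<Rightarrow> real^2^2) \<Rightarrow> (real^2 \<Rightarrow> real^2^2) \<Rightarrow> real" where
  "mat_ip F G = (LINT x|lebesgue_on disk. F x \<bullet> G x)"

definition mat_norm :: "(real^2 \<Rightarrow> real^2^2) \<Rightarrow> real" where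
  "mat_norm F = sqrt (mat_ip F F)"

lemma inner_matrix: "A \<bullet> B = (\<Sum>i\<in>UNIV. \<Sum>j\<in>UNIV. A $ i $ j * B $ i $ j)" for A B :: "real^'n^'m"
  by (simp add: inner_vec_def)

lemma mat_L2_integrable:
  assumes "F \<in> mat_L2" "G \<in> mat_L2"
  shows "integrable (lebesgue_on disk) (\<lambda>x. F x \<bullet> G x)"
  unfolding inner_matrix using assms
  by (intro Bochner_Integration.integrable_sum L2_mult_integrable) (auto simp: mat_L2_def)

lemma mat_L2_lincomb:
  assumes "F \<in> mat_L2" "G \<in> mat_L2"
  shows "(\<lambda>x. a *\<^sub>R F x + b *\<^sub>R G x) \<in> mat_L2"
  using assms by (auto simp: mat_L2_def intro!: L2_lincomb)

lemma mat_L2_diff: "F \<in> mat_L2 \<Longrightarrow> G \<in> mat_L2 \<Longrightarrow> (\<lambda>x. F x - G x) \<in> mat_L2"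
  using mat_L2_lincomb[of F G 1 "-1"] by simp

lemma mat_ip_lincomb:
  assumes "F \<in> mat_L2" "G \<in> mat_L2" "\<Psi> \<in> mat_L2"
  shows "mat_ip (\<lambda>x. a *\<^sub>R F x + b *\<^sub>R G x) \<Psi> = a * mat_ip F \<Psi> + b * mat_ip G \<Psi>"
  unfolding mat_ip_def using mat_L2_integrable[OF assms(1,3)] mat_L2_integrable[OF assms(2,3)]
  by (simp add: inner_add_left)

lemma mat_ip_commute: "mat_ip F G = mat_ip G F"
  by (simp add: mat_ip_def inner_commute)

lemma mat_ip_nonneg: "0 \<le> mat_ip F F"
  by (simp add: mat_ip_def)

lemma mat_norm_nonneg: "0 \<le> mat_norm F"
  by (simp add: mat_norm_def mat_ip_nonneg)

lemma mat_norm_square: "(mat_norm F)\<^sup>2 = mat_ip F F"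
  by (simp add: mat_norm_def mat_ip_nonneg)

lemma mat_ip_cong_AE:
  assumes "AE x in lebesgue_on disk. F x = F' x" "AE x in lebesgue_on disk. G x = G' x"
  shows "mat_ip F G = mat_ip F' G'"
  unfolding mat_ip_def
  by (rule integral_lebesgue_on_AE_cong) (use assms in \<open>auto elim: eventually_elim2\<close>)

lemma mat_norm_cong_AE: "AE x in lebesgue_on disk. F x = G x \<Longrightarrow> mat_norm F = mat_norm G"
  by (simp add: mat_norm_def mat_ip_cong_AE)

lemma mat_ip_Cauchy_Schwarz:
  assumes F: "F \<in> mat_L2" and G: "G \<in> mat_L2"
  shows "\<bar>mat_ip F G\<bar> \<le> mat_norm F * mat_norm G"
proof -
  let ?a = "mat_ip F F" and ?b = "mat_ip F G" and ?c = "mat_ip G G"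
  have pos: "0 \<le> ?a + 2 * t * ?b + t\<^sup>2 * ?c" for t
  proof -
    have FG: "(\<lambda>x. 1 *\<^sub>R F x + t *\<^sub>R G x) \<in> mat_L2" by (rule mat_L2_lincomb[OF F G])
    have "mat_ip (\<lambda>x. 1 *\<^sub>R F x + t *\<^sub>R G x) (\<lambda>x. 1 *\<^sub>R F x + t *\<^sub>R G x) = ?a + 2 * t * ?b + t\<^sup>2 * ?c"
      unfolding mat_ip_lincomb[OF F G FG] mat_ip_commute[of F "\<lambda>x. 1 *\<^sub>R F x + t *\<^sub>R G x"]
        mat_ip_commute[of G "\<lambda>x. 1 *\<^sub>R F x + t *\<^sub>R G x"] mat_ip_lincomb[OF F G F] mat_ip_lincomb[OF F G G]
      by (simp add: mat_ip_commute[of G F] algebra_simps power2_eq_square)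
    then show ?thesis using mat_ip_nonneg[of "\<lambda>x. 1 *\<^sub>R F x + t *\<^sub>R G x"] by (simp only:)
  qed
  have "?b\<^sup>2 \<le> ?a * ?c"
  proof (cases "?c = 0")
    case True
    have "?b = 0"
    proof (rule ccontr)
      assume "?b \<noteq> 0"
      \<comment> \<open>With \<open>?c = 0\<close> the polynomial is affine in \<open>t\<close>; at
        this \<open>t\<close> it takes the value \<open>-1\<close>.\<close>
      then have "2 * (- (?a + 1) / (2 * ?b)) * ?b = - (?a + 1)" by simp
      with pos[of "- (?a + 1) / (2 * ?b)"] True show False by simp
    qed
    with True show ?thesis by simp
  next
    case False
    then have "?c > 0" using mat_ip_nonneg[of G] by simp
    \<comment> \<open>The minimum of the quadratic polynomial is at \<open>t = - ?b / ?c\<close>;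
      multiplying by \<open>?c\<close> clears the denominator.\<close>
    have "0 \<le> (?a + 2 * (- ?b / ?c) * ?b + (- ?b / ?c)\<^sup>2 * ?c) * ?c"
      by (rule mult_nonneg_nonneg[OF pos mat_ip_nonneg])
    also have "\<dots> = ?a * ?c - ?b\<^sup>2"
      using \<open>?c > 0\<close> by (simp add: field_simps power2_eq_square)
    finally show ?thesis by simp
  qed
  then have "\<bar>?b\<bar> \<le> sqrt (?a * ?c)" using real_le_rsqrt[of "\<bar>?b\<bar>"] by simp
  then show ?thesis by (simp add: mat_norm_def real_sqrt_mult)
qed

lemma hess_mat_L2: "u \<in> W22 \<Longrightarrow> hess u \<in> mat_L2"
  by (simp add: mat_L2_def weak_hessian_def weak_deriv_L2)

lemma hess_lincomb:
  assumes "u \<in> W22" "v \<in> W22"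
  shows "AE x in lebesgue_on disk. hess (\<lambda>x. a * u x + b * v x) x = a *\<^sub>R hess u x + b *\<^sub>R hess v x"
proof -
  have "AE x in lebesgue_on disk. \<forall>p. weak_deriv disk [fst p, snd p] (\<lambda>x. a * u x + b * v x) x =
      a * weak_deriv disk [fst p, snd p] u x + b * weak_deriv disk [fst p, snd p] v x"
    unfolding AE_all_countable using assms by (auto intro!: weak_deriv_lincomb)
  then show ?thesis
    by eventually_elim (simp add: weak_hessian_def vec_eq_iff)
qed

lemma hess_cong: "AE x in lebesgue_on disk. u x = v x \<Longrightarrow> hess u = hess v"
  unfolding weak_hessian_def using weak_deriv_AE_cong[where \<Omega> = disk and u = u and u' = v] by simp

text \<open>The entries of the Hessian are indexed by the lists of length exactly two, each ordering
  counted once on both sides; the remaining terms of the Sobolev norm are nonnegative.\<close>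

lemma mat_norm_hess_le:
  assumes u: "u \<in> W22"
  shows "mat_norm (hess u) \<le> sobolev_norm 2 disk u"
proof -
  let ?I = "\<lambda>is. LINT x|lebesgue_on disk. (weak_deriv disk is u x)\<^sup>2"
  have int: "integrable (lebesgue_on disk) (\<lambda>x. (weak_deriv disk [i, j] u x)\<^sup>2)" for i j
    using weak_deriv_L2[OF u, of "[i, j]"] by (simp add: L2_def)
  have "mat_ip (hess u) (hess u) = (\<Sum>i\<in>UNIV. \<Sum>j\<in>UNIV. ?I [i, j])"
    using int by (simp add: mat_ip_def inner_matrix weak_hessian_def power2_eq_square)
  also have "\<dots> = (\<Sum>p\<in>UNIV. ?I [fst p, snd p])"
    by (simp add: sum.cartesian_product split_beta' UNIV_Times_UNIV[symmetric] del: UNIV_Times_UNIV)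
  also have "\<dots> = (\<Sum>is\<in>range (\<lambda>p. [fst p, snd p]). ?I is)"
    by (subst sum.reindex) (auto simp: inj_def prod_eq_iff)
  also have "\<dots> \<le> (\<Sum>is | length is \<le> 2. ?I is)"
  proof (rule sum_mono2)
    show "finite {is :: 2 list. length is \<le> 2}"
      using finite_lists_length_le[of "UNIV :: 2 set" 2] by simp
  qed auto
  finally show ?thesis unfolding mat_norm_def sobolev_norm_def by (rule real_sqrt_le_mono)
qed

text \<open>A member of the dual must be exactly linear on functions, whereas the Hessian of a sum
  is the sum of the Hessians only almost everywhere. Boundedness makes \<open>\<Lambda>\<close>
  blind to null sets and closes the gap.\<close>

lemma sobolev_dual_hess:
  assumes lin: "\<And>F G a b. F \<in> mat_L2 \<Longrightarrow> G \<in> mat_L2 \<Longrightarrow> \<Lambda> (\<lambda>x. a *\<^sub>R F x + b *\<^sub>R G x) = a * \<Lambda> F + b * \<Lambda> G"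
    and bound: "\<And>F. F \<in> mat_L2 \<Longrightarrow> \<bar>\<Lambda> F\<bar> \<le> C * mat_norm F" and C: "0 \<le> C"
  shows "(\<lambda>u. \<Lambda> (hess u)) \<in> sobolev_dual 2 disk"
proof -
  have cong: "\<Lambda> F = \<Lambda> G" if F: "F \<in> mat_L2" and G: "G \<in> mat_L2" and ae: "AE x in lebesgue_on disk. F x = G x" for F G
  proof -
    have "mat_norm (\<lambda>x. 1 *\<^sub>R F x + (-1) *\<^sub>R G x) = mat_norm (\<lambda>x. 0)"
      by (rule mat_norm_cong_AE) (use ae in auto)
    then have "\<bar>\<Lambda> F - \<Lambda> G\<bar> \<le> 0"
      using bound[OF mat_L2_lincomb[OF F G, of 1 "-1"]] lin[OF F G, of 1 "-1"]
      by (simp add: mat_norm_def mat_ip_def)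
    then show ?thesis by simp
  qed
  have comb: "\<Lambda> (hess (\<lambda>x. a * u x + b * v x)) = a * \<Lambda> (hess u) + b * \<Lambda> (hess v)"
    if "u \<in> W22" "v \<in> W22" for a b u v
    unfolding lin[OF hess_mat_L2[OF that(1)] hess_mat_L2[OF that(2)], symmetric]
    by (rule cong[OF hess_mat_L2[OF sobolev_lincomb] mat_L2_lincomb hess_lincomb])
       (use that in \<open>auto intro: hess_mat_L2\<close>)
  have "\<bar>\<Lambda> (hess u)\<bar> \<le> C * sobolev_norm 2 disk u" if "u \<in> W22" for u
    using bound[OF hess_mat_L2[OF that]] mult_left_mono[OF mat_norm_hess_le[OF that] C] by linarith
  then show ?thesis
    unfolding sobolev_dual_def using comb[of _ _ 1 1] comb[of _ _ _ 0] by auto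
qed

lemma sobolev_dual_mat_ip:
  assumes "\<Psi> \<in> mat_L2"
  shows "(\<lambda>u. mat_ip (hess u) \<Psi>) \<in> sobolev_dual 2 disk"
proof (rule sobolev_dual_hess[where C = "mat_norm \<Psi>" and \<Lambda> = "\<lambda>F. mat_ip F \<Psi>"])
  show "\<bar>mat_ip F \<Psi>\<bar> \<le> mat_norm \<Psi> * mat_norm F" if "F \<in> mat_L2" for F
    using mat_ip_Cauchy_Schwarz[OF that assms] by (simp add: mult.commute)
qed (use assms in \<open>auto simp: mat_ip_lincomb mat_norm_nonneg\<close>)

section \<open>Boundedness of weakly convergent difference quotients\<close>

fun gliding_sign :: "(nat \<Rightarrow> nat \<Rightarrow> real) \<Rightarrow> nat \<Rightarrow> real" where
  "gliding_sign c k = (if 0 \<le> (\<Sum>j<k. gliding_sign c j * (1/3) ^ j * c j k) then 1 else -1)"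

declare gliding_sign.simps [simp del]

lemma abs_gliding_sign: "\<bar>gliding_sign c k\<bar> = 1"
  by (subst gliding_sign.simps) simp

text \<open>The sign of the \<open>k\<close>-th term is chosen so that it does not cancel the terms before it,
  and the terms after it are too small to do so.\<close>

lemma gliding_hump:
  fixes c :: "nat \<Rightarrow> nat \<Rightarrow> real"
  assumes c: "\<And>j k. \<bar>c j k\<bar> \<le> N k" and diag: "\<And>k. c k k = N k"
  shows "(1/3) ^ k * N k / 2 \<le> \<bar>\<Sum>j. gliding_sign c j * (1/3) ^ j * c j k\<bar>"
proof -
  let ?t = "\<lambda>j. gliding_sign c j * (1/3) ^ j * c j k"
  have N: "0 \<le> N k" using c[of k k] by linarith
  have bd: "\<bar>?t j\<bar> \<le> N k * (1/3) ^ j" for j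
    using c[of j k] by (simp add: abs_mult abs_gliding_sign mult.commute mult_left_mono)
  have geo: "summable (\<lambda>j. N k * (1/3) ^ j)"
    by (intro summable_mult summable_geometric) simp
  have sm: "summable ?t"
    by (rule summable_comparison_test'[OF geo, of 0]) (use bd in auto)
  have "\<bar>\<Sum>j. ?t (j + Suc k)\<bar> \<le> (\<Sum>j. N k * (1/3) ^ (j + Suc k))"
  proof -
    have geo': "summable (\<lambda>j. N k * (1/3) ^ (j + Suc k))"
      using geo by (rule summable_ignore_initial_segment)
    have abs': "summable (\<lambda>j. \<bar>?t (j + Suc k)\<bar>)"
      by (rule summable_comparison_test'[OF geo', of 0]) (simp only: real_norm_def abs_abs bd)
    show ?thesis
      using summable_rabs[OF abs'] suminf_le[OF bd abs' geo'] by linarith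
  qed
  \<comment> \<open>With ratio \<open>1/3\<close> the weights after the \<open>k\<close>-th add up
    to half of the \<open>k\<close>-th weight, so the tail cancels at most half of the hump.\<close>
  also have "\<dots> = (1/3) ^ k * N k / 2"
  proof -
    have "(\<lambda>j. N k * (1/3) ^ Suc k * (1/3) ^ j) sums (N k * (1/3) ^ Suc k * (1 / (1 - 1/3)))"
      by (intro sums_mult geometric_sums) simp
    then have "(\<lambda>j. N k * (1/3) ^ (j + Suc k)) sums ((1/3) ^ k * N k / 2)"
      by (simp add: power_add mult_ac)
    then show ?thesis by (rule sums_unique[symmetric])
  qed
  finally have tail: "\<bar>\<Sum>j. ?t (j + Suc k)\<bar> \<le> (1/3) ^ k * N k / 2" .
  have "suminf ?t = (\<Sum>j. ?t (j + Suc k)) + (\<Sum>j<Suc k. ?t j)"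
    by (rule suminf_split_initial_segment[OF sm])
  also have "(\<Sum>j<Suc k. ?t j) = (\<Sum>j<k. ?t j) + gliding_sign c k * ((1/3) ^ k * N k)"
    by (simp add: diag)
  finally have split: "suminf ?t = (\<Sum>j. ?t (j + Suc k)) + ((\<Sum>j<k. ?t j) + gliding_sign c k * ((1/3) ^ k * N k))" .
  have "0 \<le> (1/3) ^ k * N k" using N by simp
  moreover have "gliding_sign c k = (if 0 \<le> (\<Sum>j<k. ?t j) then 1 else -1)"
    by (rule gliding_sign.simps)
  ultimately have "(1/3) ^ k * N k \<le> \<bar>(\<Sum>j<k. ?t j) + gliding_sign c k * ((1/3) ^ k * N k)\<bar>"
    by (cases "0 \<le> (\<Sum>j<k. ?t j)") auto
  with tail split show ?thesis by linarith
qed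

text \<open>An explicit instance of the uniform boundedness principle. \<open>\<Lambda>\<close> is a
  signed series of the inner products with the normalised \<open>D j\<close>, weighted by
  \<open>(1/3)^j\<close>; its bound \<open>3/2\<close> is the sum of the weights. The
  \<open>n\<close>-th hump has size at least \<open>(4/3)^n / 2\<close>, which is why growth like
  \<open>4^n\<close> is demanded.\<close>

lemma unbounded_functional:
  assumes D: "\<And>n. D n \<in> mat_L2" and large: "\<And>n. 4 ^ n \<le> mat_norm (D n)"
  obtains \<Lambda> C where
    "\<And>F G a b. F \<in> mat_L2 \<Longrightarrow> G \<in> mat_L2 \<Longrightarrow> \<Lambda> (\<lambda>x. a *\<^sub>R F x + b *\<^sub>R G x) = a * \<Lambda> F + b * \<Lambda> G"
    "\<And>F. F \<in> mat_L2 \<Longrightarrow> \<bar>\<Lambda> F\<bar> \<le> C * mat_norm F" "0 \<le> C"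
    "\<not> Bseq (\<lambda>n. \<Lambda> (D n) :: real)"
proof -
  define c where "c j k = mat_ip (D k) (D j) / mat_norm (D j)" for j k
  define \<Lambda> where "\<Lambda> F = (\<Sum>j. gliding_sign c j * (1/3) ^ j * (mat_ip F (D j) / mat_norm (D j)))" for F
  have pos: "0 < mat_norm (D n)" for n
    using large[of n] by (rule less_le_trans[rotated]) simp
  have ipb: "\<bar>mat_ip F (D j) / mat_norm (D j)\<bar> \<le> mat_norm F" if "F \<in> mat_L2" for F j
    using mat_ip_Cauchy_Schwarz[OF that D[of j]] pos[of j] by (simp add: abs_divide divide_le_eq)
  have bd: "\<bar>gliding_sign c j * (1/3) ^ j * (mat_ip F (D j) / mat_norm (D j))\<bar> \<le> mat_norm F * (1/3) ^ j" if "F \<in> mat_L2" for F j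
    using mult_right_mono[OF ipb[OF that, of j], of "(1/3) ^ j"]
    by (simp add: abs_mult abs_gliding_sign mult_ac)
  have geo: "summable (\<lambda>j. x * (1/3) ^ j)" for x :: real
    by (intro summable_mult summable_geometric) simp
  have sm: "summable (\<lambda>j. gliding_sign c j * (1/3) ^ j * (mat_ip F (D j) / mat_norm (D j)))" if "F \<in> mat_L2" for F
    by (rule summable_comparison_test'[OF geo[of "mat_norm F"], of 0]) (use bd[OF that] in auto)
  show thesis
  proof (rule that[of \<Lambda> "3/2"])
    fix F G :: "real^2 \<Rightarrow> real^2^2" and a b assume F: "F \<in> mat_L2" and G: "G \<in> mat_L2"
    have "\<Lambda> (\<lambda>x. a *\<^sub>R F x + b *\<^sub>R G x) = (\<Sum>j. a * (gliding_sign c j * (1/3) ^ j * (mat_ip F (D j) / mat_norm (D j))) +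
        b * (gliding_sign c j * (1/3) ^ j * (mat_ip G (D j) / mat_norm (D j))))"
      unfolding \<Lambda>_def mat_ip_lincomb[OF F G D] by (simp add: algebra_simps add_divide_distrib)
    also have "\<dots> = a * \<Lambda> F + b * \<Lambda> G"
      unfolding \<Lambda>_def
      by (simp only: suminf_add[OF summable_mult[OF sm[OF F]] summable_mult[OF sm[OF G]], symmetric]
          suminf_mult[OF sm[OF F]] suminf_mult[OF sm[OF G]])
    finally show "\<Lambda> (\<lambda>x. a *\<^sub>R F x + b *\<^sub>R G x) = a * \<Lambda> F + b * \<Lambda> G" .
  next
    fix F :: "real^2 \<Rightarrow> real^2^2" assume F: "F \<in> mat_L2"
    have abs: "summable (\<lambda>j. \<bar>gliding_sign c j * (1/3) ^ j * (mat_ip F (D j) / mat_norm (D j))\<bar>)"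
      by (rule summable_comparison_test'[OF geo[of "mat_norm F"], of 0]) (use bd[OF F] in auto)
    have "(\<lambda>j. mat_norm F * (1/3) ^ j) sums (mat_norm F * (1 / (1 - 1/3)))"
      by (intro sums_mult geometric_sums) simp
    then have "(\<Sum>j. mat_norm F * (1/3) ^ j) = 3/2 * mat_norm F"
      by (simp add: sums_iff)
    then show "\<bar>\<Lambda> F\<bar> \<le> 3/2 * mat_norm F"
      unfolding \<Lambda>_def using summable_rabs[OF abs] suminf_le[OF bd[OF F] abs geo] by linarith
  next
    show "\<not> Bseq (\<lambda>n. \<Lambda> (D n))"
    proof
      assume "Bseq (\<lambda>n. \<Lambda> (D n))"
      then obtain K where K: "\<And>n. \<bar>\<Lambda> (D n)\<bar> \<le> K"
        unfolding Bseq_def by auto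
      obtain n where n: "2 * K < (4/3 :: real) ^ n"
        using real_arch_pow[of "4/3" "2 * K"] by auto
      have "(1/3) ^ n * mat_norm (D n) / 2 \<le> \<bar>\<Sum>j. gliding_sign c j * (1/3) ^ j * c j n\<bar>"
      proof (rule gliding_hump)
        show "\<bar>c j k\<bar> \<le> mat_norm (D k)" for j k
          unfolding c_def by (rule ipb[OF D])
        show "c k k = mat_norm (D k)" for k
          using pos[of k] mat_norm_square[of "D k"] by (simp add: c_def power2_eq_square field_simps)
      qed
      also have "\<dots> = \<bar>\<Lambda> (D n)\<bar>" by (simp add: \<Lambda>_def c_def)
      finally have "(1/3) ^ n * mat_norm (D n) \<le> 2 * K" using K[of n] by linarith
      moreover have "(1/3) ^ n * 4 ^ n \<le> (1/3) ^ n * mat_norm (D n)"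
        by (intro mult_left_mono large) simp
      ultimately have "(1/3) ^ n * 4 ^ n \<le> 2 * K" by linarith
      with n show False by (simp add: power_divide)
    qed
  qed simp
qed

text \<open>Otherwise there are times tending to \<open>0\<close> along which the norms exceed
  \<open>4^n\<close>. The functional built from them is continuous on the Sobolev space, so weak
  convergence keeps its values bounded along these times, a contradiction.\<close>

lemma difference_quotients_bounded:
  assumes T: "open T" "0 \<in> T" and u: "\<And>t. t \<in> T \<Longrightarrow> u t \<in> W22" and w: "has_weak_velocity_at_0 u w"
  obtains C \<delta> where "0 < \<delta>" "\<And>t. \<bar>t\<bar> < \<delta> \<Longrightarrow> t \<in> T"
    "\<And>t. t \<noteq> 0 \<Longrightarrow> \<bar>t\<bar> < \<delta> \<Longrightarrow> mat_norm (hess (\<lambda>x. (u t x - u 0 x) / t)) \<le> C"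
proof -
  let ?D = "\<lambda>t. hess (\<lambda>x. (u t x - u 0 x) / t)"
  obtain d where d: "0 < d" "\<And>t. \<bar>t\<bar> < d \<Longrightarrow> t \<in> T"
    using T unfolding open_dist by (metis dist_0_norm dist_commute real_norm_def)
  have D: "?D t \<in> mat_L2" if "t \<in> T" for t
  proof -
    have "(\<lambda>x. (u t x - u 0 x) / t) = (\<lambda>x. (1 / t) * u t x + (- 1 / t) * u 0 x)"
      by (simp add: fun_eq_iff diff_divide_distrib)
    then show ?thesis
      using sobolev_lincomb[OF u[OF that] u[OF T(2)], of "1 / t" "- 1 / t"] hess_mat_L2 by simp
  qed
  have "\<exists>C \<delta>. 0 < \<delta> \<and> \<delta> \<le> d \<and> (\<forall>t. t \<noteq> 0 \<longrightarrow> \<bar>t\<bar> < \<delta> \<longrightarrow> mat_norm (?D t) \<le> C)"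
  proof (rule ccontr)
    assume neg: "\<not> ?thesis"
    have "\<exists>t. t \<noteq> 0 \<and> \<bar>t\<bar> < min d (1 / real (Suc n)) \<and> 4 ^ n < mat_norm (?D t)" for n
    proof -
      have "0 < min d (1 / real (Suc n))" "min d (1 / real (Suc n)) \<le> d" using d by auto
      with neg show ?thesis by (meson not_le)
    qed
    then have "\<forall>n. \<exists>t. t \<noteq> 0 \<and> \<bar>t\<bar> < min d (1 / real (Suc n)) \<and> 4 ^ n < mat_norm (?D t)"
      by blast
    from choice[OF this] obtain t where "\<forall>n. t n \<noteq> 0 \<and> \<bar>t n\<bar> < min d (1 / real (Suc n)) \<and> 4 ^ n < mat_norm (?D (t n))" ..
    then have t: "t n \<noteq> 0" "\<bar>t n\<bar> < min d (1 / real (Suc n))" "4 ^ n < mat_norm (?D (t n))" for n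
      by blast+
    have Dt: "?D (t n) \<in> mat_L2" for n using t(2)[of n] d D by simp
    obtain \<Lambda> C where \<Lambda>:
      "\<And>F G a b. F \<in> mat_L2 \<Longrightarrow> G \<in> mat_L2 \<Longrightarrow> \<Lambda> (\<lambda>x. a *\<^sub>R F x + b *\<^sub>R G x) = a * \<Lambda> F + b * \<Lambda> G"
      "\<And>F. F \<in> mat_L2 \<Longrightarrow> \<bar>\<Lambda> F\<bar> \<le> C * mat_norm F" "0 \<le> C"
      "\<not> Bseq (\<lambda>n. \<Lambda> (?D (t n)) :: real)"
      by (rule unbounded_functional[of "\<lambda>n. ?D (t n)"]) (use Dt t(3) in \<open>auto intro: less_imp_le\<close>)
    have "(\<lambda>u. \<Lambda> (hess u)) \<in> sobolev_dual 2 disk"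
      by (rule sobolev_dual_hess[OF \<Lambda>(1-3)])
    from bspec[OF conjunct2[OF w[unfolded has_weak_velocity_at_0_def]] this]
    have "((\<lambda>s. \<Lambda> (?D s)) \<longlongrightarrow> \<Lambda> (hess w)) (at 0)" .
    moreover have "filterlim t (at 0) sequentially"
    proof (subst filterlim_at, intro conjI)
      have "\<bar>t n\<bar> \<le> 1 / real (Suc n)" for n using t(2)[of n] by simp
      then show "t \<longlonglongrightarrow> 0"
        by (intro Lim_null_comparison[OF _ LIMSEQ_Suc[OF lim_1_over_n]]) auto
    qed (use t(1) in auto)
    ultimately have "(\<lambda>n. \<Lambda> (?D (t n))) \<longlonglongrightarrow> \<Lambda> (hess w)"
      by (rule filterlim_compose)
    then show False using \<Lambda>(4) convergent_imp_Bseq[OF convergentI] by blast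
  qed
  then obtain C \<delta> where \<delta>: "0 < \<delta>" "\<delta> \<le> d" and C: "\<And>t. t \<noteq> 0 \<Longrightarrow> \<bar>t\<bar> < \<delta> \<Longrightarrow> mat_norm (?D t) \<le> C"
    by blast
  show thesis
  proof (rule that[OF \<delta>(1) _ C])
    show "t \<in> T" if "\<bar>t\<bar> < \<delta>" for t using that \<delta>(2) d(2) by simp
  qed
qed

text \<open>In dimension two the cofactor matrix \<open>(tr A) I - A^T\<close> is linear in
  \<open>A\<close>, and the determinant is half of the quadratic form \<open>A : cof A\<close>. The
  constraint can thus be differentiated in the same way as the energy.\<close>

definition cofactor :: "real^2^2 \<Rightarrow> real^2^2" where
  "cofactor A = (\<chi> i j. if i = j then A $ (if i = 1 then 2 else 1) $ (if i = 1 then 2 else 1) else - (A $ j $ i))"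

lemma cofactor_simps:
  "cofactor A $ 1 $ 1 = A $ 2 $ 2" "cofactor A $ 2 $ 2 = A $ 1 $ 1"
  "cofactor A $ 1 $ 2 = - (A $ 2 $ 1)" "cofactor A $ 2 $ 1 = - (A $ 1 $ 2)"
  by (auto simp: cofactor_def)

lemma inner_matrix_2:
  "A \<bullet> B = A $ 1 $ 1 * B $ 1 $ 1 + A $ 1 $ 2 * B $ 1 $ 2 + A $ 2 $ 1 * B $ 2 $ 1 + A $ 2 $ 2 * B $ 2 $ 2"
  for A B :: "real^2^2"
  by (simp add: inner_matrix sum_2)

lemma inner_cofactor_self: "A \<bullet> cofactor A = 2 * det A"
  by (simp add: inner_matrix_2 cofactor_simps det_2)

lemma norm_cofactor: "norm (cofactor A) = norm A"
  by (simp add: norm_eq_sqrt_inner inner_matrix_2 cofactor_simps)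

lemma cofactor_mat_L2: "F \<in> mat_L2 \<Longrightarrow> (\<lambda>x. cofactor (F x)) \<in> mat_L2"
  using L2_lincomb[of "\<lambda>x. F x $ i $ j" disk "\<lambda>x. F x $ i $ j" "-1" 0 for i j]
  by (auto simp: mat_L2_def forall_2 cofactor_simps)

lemma sgn_scaleR_mat_L2:
  assumes "g \<in> borel_measurable (lebesgue_on disk)" "F \<in> mat_L2"
  shows "(\<lambda>x. sgn (g x) *\<^sub>R F x) \<in> mat_L2"
proof -
  have "(\<lambda>x. sgn (g x) * f x) \<in> L2 disk" if "f \<in> L2 disk" for f
  proof -
    have [measurable]: "f \<in> borel_measurable (lebesgue_on disk)" "g \<in> borel_measurable (lebesgue_on disk)"
      using that assms by (auto simp: L2_def)
    have "integrable (lebesgue_on disk) (\<lambda>x. (sgn (g x) * f x)\<^sup>2)"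
      by (rule Bochner_Integration.integrable_bound[of _ "\<lambda>x. (f x)\<^sup>2"])
         (use that in \<open>auto simp: L2_def sgn_if\<close>)
    then show ?thesis by (simp add: L2_def)
  qed
  then show ?thesis using assms by (auto simp: mat_L2_def)
qed

text \<open>Serves both the energy, with \<open>L\<close> the identity, and the weighted
  determinant, with \<open>L\<close> a multiple of the cofactor map. Symmetry of \<open>L\<close>
  splits the quotient of the form into \<open>2 D : L H + D : L (H_t - H)\<close>, where
  \<open>D\<close> is the difference quotient of the Hessians. The first term converges by weak
  differentiability; the second is at most the bound on \<open>D\<close> times the norm of
  \<open>H_t - H\<close>, which tends to \<open>0\<close> by strong continuity.\<close>

theorem quadratic_form_derivative:
  assumes T: "open T" "0 \<in> T" and u: "\<And>t. t \<in> T \<Longrightarrow> u t \<in> W22"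
    and sc: "strongly_continuous_on T u" and w: "has_weak_velocity_at_0 u w"
    and L: "\<And>x. linear (L x)" "\<And>x A B. L x A \<bullet> B = A \<bullet> L x B" "\<And>x A. norm (L x A) \<le> norm A"
      "\<And>F. F \<in> mat_L2 \<Longrightarrow> (\<lambda>x. L x (F x)) \<in> mat_L2"
  shows "((\<lambda>t. mat_ip (hess (u t)) (\<lambda>x. L x (hess (u t) x))) has_real_derivative
    2 * mat_ip (hess w) (\<lambda>x. L x (hess (u 0) x))) (at 0)"
proof -
  define H where "H = hess (u 0)"
  let ?D = "\<lambda>t. hess (\<lambda>x. (u t x - u 0 x) / t)"
  let ?N = "\<lambda>t. mat_norm (\<lambda>x. hess (u t) x - H x)"
  obtain C \<delta> where \<delta>: "0 < \<delta>" "\<And>t. \<bar>t\<bar> < \<delta> \<Longrightarrow> t \<in> T"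
    and C: "\<And>t. t \<noteq> 0 \<Longrightarrow> \<bar>t\<bar> < \<delta> \<Longrightarrow> mat_norm (?D t) \<le> C"
    using difference_quotients_bounded[OF T u w] by metis
  have q: "(\<lambda>x. (u t x - u 0 x) / t) = (\<lambda>x. (1 / t) * u t x + (- 1 / t) * u 0 x)" for t
    by (simp add: fun_eq_iff diff_divide_distrib)
  have Ht: "hess (u t) \<in> mat_L2" if "t \<in> T" for t by (rule hess_mat_L2[OF u[OF that]])
  have H: "H \<in> mat_L2" unfolding H_def by (rule Ht[OF T(2)])
  have D: "?D t \<in> mat_L2" if "t \<in> T" for t
    unfolding q by (intro hess_mat_L2 sobolev_lincomb u that T) auto
  have Dq: "AE x in lebesgue_on disk. t *\<^sub>R ?D t x = hess (u t) x - H x" if "t \<in> T" "t \<noteq> 0" for t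
  proof -
    have "AE x in lebesgue_on disk. ?D t x = (1 / t) *\<^sub>R hess (u t) x + (- 1 / t) *\<^sub>R hess (u 0) x"
      unfolding q by (rule hess_lincomb[OF u[OF that(1)] u[OF T(2)]])
    then show ?thesis
      by eventually_elim (simp add: H_def that(2) scaleR_diff_right)
  qed
  have R: "(\<lambda>x. L x (hess (u t) x - H x)) \<in> mat_L2" if "t \<in> T" for t
    by (intro L(4) mat_L2_diff Ht H that)
  have R_le: "mat_norm (\<lambda>x. L x (hess (u t) x - H x)) \<le> ?N t" if "t \<in> T" for t
    unfolding mat_norm_def mat_ip_def using L(3) mat_L2_diff[OF Ht[OF that] H] R[OF that]
    by (intro real_sqrt_le_mono integral_mono mat_L2_integrable) (auto simp: norm_le[symmetric])
  have near: "\<forall>\<^sub>F t in at 0. t \<noteq> 0 \<and> \<bar>t\<bar> < \<delta>"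
    unfolding eventually_at using \<delta>(1) by (auto intro!: exI[of _ \<delta>])
  have strong: "((\<lambda>t. C * ?N t) \<longlongrightarrow> 0) (at 0)"
  proof (rule tendsto_mult_right_zero[OF Lim_null_comparison])
    show "((\<lambda>t. sobolev_norm 2 disk (\<lambda>x. u t x - u 0 x)) \<longlongrightarrow> 0) (at 0)"
      using bspec[OF sc[unfolded strongly_continuous_on_def] T(2)] by (simp only: at_within_open[OF T(2,1)])
    have "norm (?N t) \<le> sobolev_norm 2 disk (\<lambda>x. u t x - u 0 x)" if "t \<in> T" for t
    proof -
      have "AE x in lebesgue_on disk. hess (\<lambda>x. u t x - u 0 x) x = hess (u t) x - H x"
        using hess_lincomb[OF u[OF that] u[OF T(2)], of 1 "-1"] by (simp add: H_def)
      then have "?N t = mat_norm (hess (\<lambda>x. u t x - u 0 x))"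
        by (intro mat_norm_cong_AE) (auto simp: eq_commute)
      then show ?thesis
        using mat_norm_hess_le[OF sobolev_lincomb[OF u[OF that] u[OF T(2)], of 1 "-1"]]
        by (simp add: mat_norm_nonneg)
    qed
    then show "\<forall>\<^sub>F t in at 0. norm (?N t) \<le> sobolev_norm 2 disk (\<lambda>x. u t x - u 0 x)"
      using near \<delta>(2) by (auto elim: eventually_mono)
  qed
  have cross: "((\<lambda>t. mat_ip (?D t) (\<lambda>x. L x (hess (u t) x - H x))) \<longlongrightarrow> 0) (at 0)"
  proof (rule Lim_null_comparison[OF _ strong])
    show "\<forall>\<^sub>F t in at 0. norm (mat_ip (?D t) (\<lambda>x. L x (hess (u t) x - H x))) \<le> C * ?N t"
      using near
    proof eventually_elim
      case (elim t)
      then have t: "t \<in> T" using \<delta> by auto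
      have "\<bar>mat_ip (?D t) (\<lambda>x. L x (hess (u t) x - H x))\<bar> \<le>
          mat_norm (?D t) * mat_norm (\<lambda>x. L x (hess (u t) x - H x))"
        by (rule mat_ip_Cauchy_Schwarz[OF D[OF t] R[OF t]])
      also have "\<dots> \<le> C * ?N t"
        using C[of t] elim R_le[OF t] mat_norm_nonneg order_trans[OF mat_norm_nonneg]
        by (intro mult_mono) blast+
      finally show ?case by simp
    qed
  qed
  have "((\<lambda>t. mat_ip (?D t) (\<lambda>x. L x (H x))) \<longlongrightarrow> mat_ip (hess w) (\<lambda>x. L x (H x))) (at 0)"
    by (rule bspec[OF conjunct2[OF w[unfolded has_weak_velocity_at_0_def]] sobolev_dual_mat_ip[OF L(4)[OF H]]])
  from tendsto_add[OF tendsto_mult_left[OF this, of 2] cross]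
  have lim: "((\<lambda>t. 2 * mat_ip (?D t) (\<lambda>x. L x (H x)) + mat_ip (?D t) (\<lambda>x. L x (hess (u t) x - H x)))
      \<longlongrightarrow> 2 * mat_ip (hess w) (\<lambda>x. L x (H x))) (at 0)"
    by simp
  show ?thesis
    unfolding DERIV_def H_def[symmetric]
  proof (rule Lim_transform_eventually[OF lim])
    show "\<forall>\<^sub>F t in at 0. 2 * mat_ip (?D t) (\<lambda>x. L x (H x)) + mat_ip (?D t) (\<lambda>x. L x (hess (u t) x - H x)) =
        (mat_ip (hess (u (0 + t))) (\<lambda>x. L x (hess (u (0 + t)) x)) - mat_ip H (\<lambda>x. L x (H x))) / t"
      using near
    proof eventually_elim
      case (elim t)
      then have t: "t \<in> T" "t \<noteq> 0" using \<delta> by auto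
      have i: "integrable (lebesgue_on disk) (\<lambda>x. ?D t x \<bullet> L x (H x))"
        "integrable (lebesgue_on disk) (\<lambda>x. ?D t x \<bullet> L x (hess (u t) x - H x))"
        "integrable (lebesgue_on disk) (\<lambda>x. hess (u t) x \<bullet> L x (hess (u t) x))"
        "integrable (lebesgue_on disk) (\<lambda>x. H x \<bullet> L x (H x))"
        by (intro mat_L2_integrable D Ht H R L(4) t)+
      have "t * (2 * mat_ip (?D t) (\<lambda>x. L x (H x)) + mat_ip (?D t) (\<lambda>x. L x (hess (u t) x - H x))) =
         (LINT x|lebesgue_on disk. t * (2 * (?D t x \<bullet> L x (H x)) + ?D t x \<bullet> L x (hess (u t) x - H x)))"
        using i by (simp add: mat_ip_def)
      also have "\<dots> = (LINT x|lebesgue_on disk. hess (u t) x \<bullet> L x (hess (u t) x) - H x \<bullet> L x (H x))"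
      proof (rule integral_lebesgue_on_AE_cong)
        show "AE x in lebesgue_on disk. t * (2 * (?D t x \<bullet> L x (H x)) + ?D t x \<bullet> L x (hess (u t) x - H x)) =
           hess (u t) x \<bullet> L x (hess (u t) x) - H x \<bullet> L x (H x)"
          using Dq[OF t]
        proof eventually_elim
          case (elim x)
          \<comment> \<open>The sum is \<open>(H_t - H) : L (H_t + H)\<close>, and the mixed terms
            cancel by symmetry of \<open>L\<close>.\<close>
          have "t * (2 * (?D t x \<bullet> L x (H x)) + ?D t x \<bullet> L x (hess (u t) x - H x)) =
              (t *\<^sub>R ?D t x) \<bullet> (L x (hess (u t) x) + L x (H x))"
            by (simp add: linear_diff[OF L(1)] inner_diff_right inner_add_right algebra_simps)
          also have "\<dots> = hess (u t) x \<bullet> L x (hess (u t) x) - H x \<bullet> L x (H x)"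
            unfolding elim using L(2)[of x "H x" "hess (u t) x"]
            by (simp add: inner_diff_left inner_add_right inner_commute[of "L x (H x)"])
          finally show ?case .
        qed
      qed simp
      also have "\<dots> = mat_ip (hess (u t)) (\<lambda>x. L x (hess (u t) x)) - mat_ip H (\<lambda>x. L x (H x))"
        using i by (simp add: mat_ip_def)
      finally show ?case using t(2) by (simp add: field_simps)
    qed
  qed
qed

text \<open>With a weight \<open>\<phi>\<close>, the derivative of \<open>2 \<integral> \<phi> det \<nabla>\<^sup>2 u(t)\<close> at \<open>0\<close> is \<open>2 \<integral> \<phi> (\<nabla>\<^sup>2 w : cof \<nabla>\<^sup>2 u(0))\<close>;
  the weight is taken to be the sign of the second factor.\<close>

theorem linearized_constraint:
  assumes T: "open T" "0 \<in> T" and fin: "\<And>t. t \<in> T \<Longrightarrow> u t \<in> W_finite k"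
    and sc: "strongly_continuous_on T u" and w: "has_weak_velocity_at_0 u w"
  shows "AE x in lebesgue_on disk. hess w x \<bullet> cofactor (hess (u 0) x) = 0"
proof -
  have u: "u t \<in> W22" if "t \<in> T" for t using fin[OF that] by (simp add: W_finite_def)
  have det: "AE x in lebesgue_on disk. det (hess (u t) x) = k x" if "t \<in> T" for t
    using fin[OF that] by (auto simp: W_finite_def W_functional_def split: if_splits)
  have wW: "w \<in> W22" using w by (simp add: has_weak_velocity_at_0_def)
  let ?g = "\<lambda>x. hess w x \<bullet> cofactor (hess (u 0) x)"
  let ?L = "\<lambda>x A. sgn (?g x) *\<^sub>R cofactor A"
  let ?E = "\<lambda>t. mat_ip (hess (u t)) (\<lambda>x. ?L x (hess (u t) x))"
  have gi: "integrable (lebesgue_on disk) ?g"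
    by (intro mat_L2_integrable hess_mat_L2 cofactor_mat_L2 u T wW)
  have "(?E has_real_derivative 2 * mat_ip (hess w) (\<lambda>x. ?L x (hess (u 0) x))) (at 0)"
  proof (rule quadratic_form_derivative[OF T u sc w])
    show "linear (?L x)" for x
      by (rule linearI) (simp_all add: vec_eq_iff forall_2 cofactor_simps algebra_simps)
    show "?L x A \<bullet> B = A \<bullet> ?L x B" for x A B
      by (simp add: inner_matrix_2 cofactor_simps algebra_simps)
    show "norm (?L x A) \<le> norm A" for x A
      by (simp add: norm_cofactor sgn_if)
    show "(\<lambda>x. ?L x (F x)) \<in> mat_L2" if "F \<in> mat_L2" for F
      by (intro sgn_scaleR_mat_L2 borel_measurable_integrable[OF gi] cofactor_mat_L2 that)
  qed
  moreover have "(?E has_real_derivative 0) (at 0)"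
  proof (rule has_field_derivative_transform_within_open[OF DERIV_const T])
    fix t assume t: "t \<in> T"
    \<comment> \<open>\<open>A : cof A = 2 det A\<close>, and the determinant is \<open>k\<close> at
      every time, so the form is constant along the curve.\<close>
    have "?E s = (LINT x|lebesgue_on disk. sgn (?g x) * (2 * k x))" if "s \<in> T" for s
      unfolding mat_ip_def
      by (rule integral_lebesgue_on_AE_cong)
         (use det[OF that] in \<open>auto simp: inner_cofactor_self elim: eventually_mono\<close>)
    from this[OF t] this[OF T(2)] show "?E 0 = ?E t" by simp
  qed
  ultimately have "2 * mat_ip (hess w) (\<lambda>x. ?L x (hess (u 0) x)) = 0"
    by (rule DERIV_unique)
  \<comment> \<open>The sign weight turns \<open>?g\<close> into its absolute value, so one scalar
    derivative yields the pointwise constraint.\<close>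
  then have "(LINT x|lebesgue_on disk. \<bar>?g x\<bar>) = 0"
    by (simp add: mat_ip_def abs_sgn mult.commute)
  then show "AE x in lebesgue_on disk. ?g x = 0"
    using integral_nonneg_eq_0_iff_AE[OF integrable_abs[OF gi]] by simp
qed

section \<open>Circle means\<close>

text \<open>Identifying the plane with the complex numbers, \<open>rot y x\<close> is the product \<open>(y / \<bar>y\<bar>) x\<close>.
  Averaging \<open>f (rot y x)\<close> over \<open>y\<close> in the disk gives the mean of \<open>f\<close> over the circle through \<open>x\<close>.\<close>

definition rot :: "real^2 \<Rightarrow> real^2 \<Rightarrow> real^2" where
  "rot y x = ((y $ 1 * x $ 1 - y $ 2 * x $ 2) / norm y) *\<^sub>R axis 1 1 +
             ((y $ 1 * x $ 2 + y $ 2 * x $ 1) / norm y) *\<^sub>R axis 2 1"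

text \<open>The point of the positive first axis with squared norm \<open>s\<close>. Radii are
  recorded through their squares because area then becomes a multiple of \<open>ds\<close>.\<close>

definition ray_point :: "real \<Rightarrow> real^2" where
  "ray_point s = sqrt s *\<^sub>R axis 1 1"

lemma rot_nth [simp]:
  "rot y x $ 1 = (y $ 1 * x $ 1 - y $ 2 * x $ 2) / norm y"
  "rot y x $ 2 = (y $ 1 * x $ 2 + y $ 2 * x $ 1) / norm y"
  by (simp_all add: rot_def axis_def)

lemma ray_point_nth [simp]: "ray_point s $ 1 = sqrt s" "ray_point s $ 2 = 0"
  by (simp_all add: ray_point_def axis_def)

lemma norm_square_2: "(norm x)\<^sup>2 = (x $ 1)\<^sup>2 + (x $ 2)\<^sup>2" for x :: "real^2"
  unfolding power2_norm_eq_inner by (simp add: inner_vec_def sum_2 power2_eq_square)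

lemma norm_rot: "y \<noteq> 0 \<Longrightarrow> norm (rot y x) = norm x"
proof -
  assume "y \<noteq> 0"
  then have "norm y \<noteq> 0" by simp
  have "(norm (rot y x))\<^sup>2 = ((y $ 1)\<^sup>2 + (y $ 2)\<^sup>2) * (norm x)\<^sup>2 / (norm y)\<^sup>2"
    by (simp add: norm_square_2[of "rot y x"] norm_square_2[of x] power_divide add_divide_distrib[symmetric])
       (simp add: power2_eq_square algebra_simps)
  also have "\<dots> = (norm x)\<^sup>2"
    using \<open>norm y \<noteq> 0\<close> by (simp add: norm_square_2[of y, symmetric])
  finally show ?thesis by simp
qed

lemma linear_rot: "linear (rot y)"
  by (rule linearI) (simp_all add: vec_eq_iff forall_2 algebra_simps add_divide_distrib diff_divide_distrib)

lemma orthogonal_transformation_rot: "y \<noteq> 0 \<Longrightarrow> orthogonal_transformation (rot y)"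
  by (simp add: orthogonal_transformation linear_rot norm_rot)

text \<open>Complex multiplication is commutative and associative: both sides are the product of
  \<open>x\<close> with the directions of \<open>y\<close> and \<open>z\<close>. The roles are
  exchanged so that \<open>x\<close> can later become the centre of a change of variables in
  \<open>y\<close>.\<close>

lemma rot_rot: "z \<noteq> 0 \<Longrightarrow> rot y (rot z x) = rot (rot z y) x"
  by (simp add: vec_eq_iff forall_2 norm_rot diff_divide_distrib add_divide_distrib algebra_simps)

text \<open>A number is its direction times its modulus. At \<open>x = 0\<close> the default value
  of division by zero makes \<open>rot 0\<close> the zero map.\<close>

lemma rot_ray_point: "rot x (ray_point ((norm x)\<^sup>2)) = x"
  by (cases "x = 0") (simp_all add: vec_eq_iff forall_2)

lemma norm_ray_point: "0 \<le> s \<Longrightarrow> norm (ray_point s) = sqrt s"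
  by (simp add: ray_point_def)

lemma orthogonal_transformation_vimage_disk:
  fixes R :: "real^'n::finite \<Rightarrow> real^'n"
  shows "orthogonal_transformation R \<Longrightarrow> R -` ball 0 r = ball 0 r"
  by (auto simp: orthogonal_transformation_norm)

lemma borel_measurable_vec_nth [measurable]: "(\<lambda>x::real^'n::finite. x $ i) \<in> borel_measurable borel"
  by (intro borel_measurable_continuous_onI continuous_intros)

lemma rot_measurable [measurable]:
  assumes [measurable]: "f \<in> borel_measurable M" "g \<in> borel_measurable M"
  shows "(\<lambda>z. rot (f z) (g z)) \<in> borel_measurable M"
  unfolding rot_def by measurable

lemma ray_point_measurable [measurable]: "ray_point \<in> borel_measurable borel"
  unfolding ray_point_def[abs_def] by measurable

section \<open>Polar coordinates on the disk\<close>

abbreviation borel_disk :: "(real^2) measure" where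
  "borel_disk \<equiv> restrict_space lborel disk"

abbreviation borel_unit :: "real measure" where
  "borel_unit \<equiv> restrict_space lborel {0<..<1}"

lemma emeasure_disk: "emeasure lborel (ball (0::real^2) r) = ennreal (pi * r\<^sup>2)" if "0 \<le> r"
  using emeasure_ball[OF that, of "0::real^2"] unit_ball_vol_even[of 1] by simp

lemma content_disk: "measure lborel (ball (0::real^2) 1) = pi"
  by (simp add: measure_def emeasure_disk)

lemma emeasure_cdisk: "emeasure lborel (cball (0::real^2) r) = ennreal (pi * r\<^sup>2)" if "0 \<le> r"
  using emeasure_cball[OF that, of "0::real^2"] unit_ball_vol_even[of 1] by simp

lemma finite_measure_borel_disk: "finite_measure borel_disk"
  by (intro finite_measureI) (simp add: emeasure_restrict_space space_restrict_space emeasure_disk)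

lemma finite_measure_borel_unit: "finite_measure borel_unit"
  by (intro finite_measureI) (simp add: emeasure_restrict_space space_restrict_space)

interpretation disk: finite_measure borel_disk by (rule finite_measure_borel_disk)

interpretation unit: finite_measure borel_unit by (rule finite_measure_borel_unit)

interpretation unit_disk: pair_sigma_finite borel_unit borel_disk ..

interpretation disk_disk: pair_sigma_finite borel_disk borel_disk ..

text \<open>The part of the disk with \<open>|x|^2 > c\<close> has area \<open>pi (1 - c)\<close>,
  which is affine in \<open>c\<close>: the squared norm is uniformly distributed.\<close>

lemma distr_norm_square_disk:
  "distr borel_disk borel (\<lambda>x. (norm x)\<^sup>2) = density lborel (\<lambda>s. ennreal pi * indicator {0<..<1} s)" (is "?M = ?N")
proof (rule measure_eqI_lessThan)
  have m: "(\<lambda>x. (norm x)\<^sup>2) \<in> borel_measurable borel_disk" by (rule measurable_restrict_space1) simp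
  have M: "emeasure ?M {c<..} = emeasure lborel (disk - {x. (norm x)\<^sup>2 \<le> c})" for c
  proof -
    have "(\<lambda>x. (norm x)\<^sup>2) -` {c<..} \<inter> space borel_disk = disk - {x. (norm x)\<^sup>2 \<le> c}"
      by (auto simp: space_restrict_space)
    then show ?thesis
      using m by (simp add: emeasure_distr emeasure_restrict_space)
  qed
  have N: "emeasure ?N {c<..} = ennreal (pi * (1 - min 1 (max 0 c)))" for c
  proof -
    have "emeasure ?N {c<..} = ennreal pi * emeasure lborel ({0<..<1} \<inter> {c<..})"
      by (simp add: emeasure_density mult.assoc indicator_inter_arith[symmetric] nn_integral_cmult)
    also have "{0<..<1} \<inter> {c<..} = {max 0 c<..<1}" by auto
    finally show ?thesis
      by (cases "c < 1") (auto simp: ennreal_mult'[symmetric] min_def max_def)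
  qed
  show eq: "emeasure ?M {c<..} = emeasure ?N {c<..}" for c
  proof -
    consider "c < 0" | "0 \<le> c" "c < 1" | "1 \<le> c" by linarith
    then show ?thesis
    proof cases
      case 1
      then have "{x::real^2. (norm x)\<^sup>2 \<le> c} = {}"
        by (auto simp: not_le intro: less_le_trans[OF _ zero_le_power2])
      with 1 show ?thesis unfolding M N by (simp add: emeasure_disk)
    next
      case 2
      have "{x::real^2. (norm x)\<^sup>2 \<le> c} = cball 0 (sqrt c)"
        using 2 by (auto simp: real_le_rsqrt sqrt_le_D intro: real_le_lsqrt) (metis norm_ge_zero real_sqrt_le_iff real_sqrt_pow2 power_mono)
      moreover have "cball 0 (sqrt c) \<subseteq> (disk :: (real^2) set)"
      proof
        fix x :: "real^2" assume "x \<in> cball 0 (sqrt c)"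
        then have "norm x \<le> sqrt c" by simp
        also have "sqrt c < 1" using 2 by simp
        finally show "x \<in> disk" by simp
      qed
      ultimately have "emeasure ?M {c<..} = ennreal pi - ennreal (pi * c)"
        unfolding M using 2 by (simp add: emeasure_Diff emeasure_disk emeasure_cdisk)
      then show ?thesis unfolding N using 2 by (simp add: ennreal_minus algebra_simps)
    next
      case 3
      have "(norm x)\<^sup>2 \<le> c" if "x \<in> (disk :: (real^2) set)" for x
        using that 3 power_le_one[of "norm x" 2] by simp
      then have "disk - {x :: real^2. (norm x)\<^sup>2 \<le> c} = {}" by blast
      with 3 show ?thesis unfolding M N by (simp only:) simp
    qed
  qed
  show "emeasure ?M {c<..} < \<infinity>" for c
    unfolding eq N by simp
qed simp_all

lemma nn_integral_radial:
  assumes [measurable]: "g \<in> borel_measurable borel"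
  shows "(\<integral>\<^sup>+x. g ((norm x)\<^sup>2) \<partial>borel_disk) = ennreal pi * (\<integral>\<^sup>+s. g s \<partial>borel_unit)"
proof -
  have "(\<integral>\<^sup>+x. g ((norm x)\<^sup>2) \<partial>borel_disk) = (\<integral>\<^sup>+s. g s \<partial>distr borel_disk borel (\<lambda>x. (norm x)\<^sup>2))"
    by (subst nn_integral_distr) (auto intro: measurable_restrict_space1)
  also have "\<dots> = (\<integral>\<^sup>+s. ennreal pi * (g s * indicator {0<..<1} s) \<partial>lborel)"
    unfolding distr_norm_square_disk by (subst nn_integral_density) (auto simp: mult_ac)
  also have "\<dots> = ennreal pi * (\<integral>\<^sup>+s. g s \<partial>borel_unit)"
    by (simp add: nn_integral_cmult nn_integral_restrict_space)
  finally show ?thesis .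
qed

lemma nn_integral_disk_rot:
  assumes [measurable]: "f \<in> borel_measurable borel" and y: "y \<noteq> 0"
  shows "(\<integral>\<^sup>+x. f (rot y x) \<partial>borel_disk) = (\<integral>\<^sup>+x. f x \<partial>borel_disk)"
proof -
  have R: "orthogonal_transformation (rot y)" by (rule orthogonal_transformation_rot[OF y])
  have "(\<integral>\<^sup>+x. f x \<partial>borel_disk) = (\<integral>\<^sup>+x. f x * indicator disk x \<partial>distr lborel borel (rot y))"
    by (simp add: lborel_distr_orthogonal_transformation[OF R] nn_integral_restrict_space)
  also have "\<dots> = (\<integral>\<^sup>+x. f (rot y x) * indicator disk (rot y x) \<partial>lborel)"
  proof (rule nn_integral_distr)
    show "rot y \<in> lborel \<rightarrow>\<^sub>M borel" by measurable
    have [measurable]: "(disk :: (real^2) set) \<in> sets borel" by simp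
    show "(\<lambda>x. f x * indicator disk x) \<in> borel_measurable (distr lborel borel (rot y))" by measurable
  qed
  also have "\<dots> = (\<integral>\<^sup>+x. f (rot y x) * indicator disk x \<partial>lborel)"
    by (intro nn_integral_cong) (simp add: indicator_def norm_rot[OF y])
  also have "\<dots> = (\<integral>\<^sup>+x. f (rot y x) \<partial>borel_disk)"
    by (simp add: nn_integral_restrict_space)
  finally show ?thesis by simp
qed

lemma AE_disk_nonzero: "AE y in borel_disk. y \<noteq> 0"
  using AE_lborel_singleton[of 0] by (auto simp: AE_restrict_space_iff elim!: eventually_mono)

lemma borel_measurable_disk: "f \<in> borel_measurable borel \<Longrightarrow> f \<in> borel_measurable borel_disk"
  by (rule measurable_restrict_space1) simp

lemma measurable_fst_snd_disk [measurable]: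
  "fst \<in> borel_disk \<Otimes>\<^sub>M borel_disk \<rightarrow>\<^sub>M borel" "snd \<in> borel_disk \<Otimes>\<^sub>M borel_disk \<rightarrow>\<^sub>M borel"
  "fst \<in> borel_unit \<Otimes>\<^sub>M borel_disk \<rightarrow>\<^sub>M borel" "snd \<in> borel_unit \<Otimes>\<^sub>M borel_disk \<rightarrow>\<^sub>M borel"
  by (rule measurable_compose[OF measurable_fst] measurable_compose[OF measurable_snd];
      rule measurable_restrict_space1, simp)+

text \<open>Angles are represented by points \<open>y\<close> of the disk. Averaging over all
  rotations leaves the integral of \<open>f\<close> unchanged; after exchanging the integrals, the
  inner one depends on \<open>x\<close> only through \<open>|x|^2\<close>, and the law of
  \<open>|x|^2\<close> applies. The area \<open>pi\<close> enters on both sides and cancels.\<close>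

lemma nn_integral_polar:
  assumes [measurable]: "f \<in> borel_measurable borel"
  shows "(\<integral>\<^sup>+x. f x \<partial>borel_disk) = (\<integral>\<^sup>+s. (\<integral>\<^sup>+y. f (rot y (ray_point s)) \<partial>borel_disk) \<partial>borel_unit)"
proof -
  define h where "h x = (\<integral>\<^sup>+y. f (rot y x) \<partial>borel_disk)" for x
  have fr: "(\<lambda>z. f (rot (snd z) (fst z))) \<in> borel_measurable (borel \<Otimes>\<^sub>M borel_disk)"
  proof -
    have [measurable]: "snd \<in> borel \<Otimes>\<^sub>M borel_disk \<rightarrow>\<^sub>M borel"
      by (rule measurable_compose[OF measurable_snd]) (rule measurable_restrict_space1, simp)
    show ?thesis by measurable
  qed
  have hm [measurable]: "h \<in> borel_measurable borel"
    unfolding h_def using disk.borel_measurable_nn_integral_fst[OF fr] by simp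
  have inv: "h x = h (ray_point ((norm x)\<^sup>2))" for x
  proof (cases "x = 0")
    case True
    then have "ray_point ((norm x)\<^sup>2) = x" by (simp add: vec_eq_iff forall_2)
    then show ?thesis by simp
  next
    case False
    let ?p = "ray_point ((norm x)\<^sup>2)"
    have "h x = (\<integral>\<^sup>+y. f (rot y (rot x ?p)) \<partial>borel_disk)"
      unfolding h_def by (simp only: rot_ray_point)
    also have "\<dots> = (\<integral>\<^sup>+y. f (rot (rot x y) ?p) \<partial>borel_disk)"
      by (simp only: rot_rot[OF False])
    also have "\<dots> = h ?p"
      unfolding h_def by (rule nn_integral_disk_rot[OF _ False, of "\<lambda>y. f (rot y ?p)"]) measurable
    finally show ?thesis .
  qed
  have "ennreal pi * (\<integral>\<^sup>+x. f x \<partial>borel_disk) = (\<integral>\<^sup>+y. (\<integral>\<^sup>+x. f x \<partial>borel_disk) \<partial>borel_disk)"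
    by (simp add: emeasure_restrict_space space_restrict_space emeasure_disk mult.commute)
  also have "\<dots> = (\<integral>\<^sup>+y. (\<integral>\<^sup>+x. f (rot y x) \<partial>borel_disk) \<partial>borel_disk)"
    by (rule nn_integral_cong_AE) (use AE_disk_nonzero nn_integral_disk_rot[OF assms] in \<open>auto elim!: eventually_mono\<close>)
  also have "\<dots> = (\<integral>\<^sup>+x. h x \<partial>borel_disk)"
    unfolding h_def by (rule disk_disk.Fubini') measurable
  also have "\<dots> = (\<integral>\<^sup>+x. h (ray_point ((norm x)\<^sup>2)) \<partial>borel_disk)"
    by (subst inv) simp
  also have "\<dots> = ennreal pi * (\<integral>\<^sup>+s. h (ray_point s) \<partial>borel_unit)"
    by (rule nn_integral_radial) measurable
  finally have "ennreal pi * (\<integral>\<^sup>+x. f x \<partial>borel_disk) = ennreal pi * (\<integral>\<^sup>+s. h (ray_point s) \<partial>borel_unit)" .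
  then show ?thesis
    by (simp add: ennreal_mult_cancel_left h_def)
qed

text \<open>As an equality of image measures the polar formula transfers signed integrals,
  integrability and null sets alike.\<close>

lemma distr_polar:
  "distr (borel_unit \<Otimes>\<^sub>M borel_disk) borel (\<lambda>(s, y). rot y (ray_point s)) = distr borel_disk borel (\<lambda>x. x)"
proof (rule measure_eqI)
  fix A assume "A \<in> sets (distr (borel_unit \<Otimes>\<^sub>M borel_disk) borel (\<lambda>(s, y). rot y (ray_point s)))"
  then have A [measurable]: "A \<in> sets borel" by simp
  have m: "(\<lambda>(s, y). rot y (ray_point s)) \<in> borel_measurable (borel_unit \<Otimes>\<^sub>M borel_disk)"
    unfolding split_beta' by measurable
  have "emeasure (distr (borel_unit \<Otimes>\<^sub>M borel_disk) borel (\<lambda>(s, y). rot y (ray_point s))) A =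
    (\<integral>\<^sup>+z. indicator A z \<partial>distr (borel_unit \<Otimes>\<^sub>M borel_disk) borel (\<lambda>(s, y). rot y (ray_point s)))"
    by (subst nn_integral_indicator) auto
  also have "\<dots> = (\<integral>\<^sup>+z. indicator A (rot (snd z) (ray_point (fst z))) \<partial>(borel_unit \<Otimes>\<^sub>M borel_disk))"
    using m by (subst nn_integral_distr) (auto simp: split_beta')
  also have "\<dots> = (\<integral>\<^sup>+s. (\<integral>\<^sup>+y. indicator A (rot y (ray_point s)) \<partial>borel_disk) \<partial>borel_unit)"
    by (subst disk.nn_integral_fst[symmetric]) auto
  also have "\<dots> = (\<integral>\<^sup>+x. indicator A x \<partial>borel_disk)"
    by (rule nn_integral_polar[symmetric]) measurable
  also have "\<dots> = (\<integral>\<^sup>+x. indicator A x \<partial>distr borel_disk borel (\<lambda>x. x))"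
    by (subst nn_integral_distr) (auto intro: measurable_restrict_space1)
  also have "\<dots> = emeasure (distr borel_disk borel (\<lambda>x. x)) A"
    by (subst nn_integral_indicator) auto
  finally show "emeasure (distr (borel_unit \<Otimes>\<^sub>M borel_disk) borel (\<lambda>(s, y). rot y (ray_point s))) A =
    emeasure (distr borel_disk borel (\<lambda>x. x)) A" .
qed simp

definition circle_mean :: "(real^2 \<Rightarrow> real) \<Rightarrow> real \<Rightarrow> real" where
  "circle_mean f s = (LINT y|borel_disk. f (rot y (ray_point s))) / pi"

lemma polar_measurable:
  "(\<lambda>(s, y). rot y (ray_point s)) \<in> borel_measurable (borel_unit \<Otimes>\<^sub>M borel_disk)"
  unfolding split_beta' by measurable

lemma integrable_polar:
  assumes f [measurable]: "f \<in> borel_measurable borel" and i: "integrable borel_disk f"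
  shows "integrable (borel_unit \<Otimes>\<^sub>M borel_disk) (\<lambda>(s, y). f (rot y (ray_point s)) :: real)"
proof -
  have "integrable (distr borel_disk borel (\<lambda>x. x)) f"
    using i by (subst integrable_distr_eq) (auto intro: measurable_restrict_space1)
  then show ?thesis
    unfolding distr_polar[symmetric] using polar_measurable f
    by (subst (asm) integrable_distr_eq) (auto simp: split_beta')
qed

lemma circle_mean_integrable:
  assumes f [measurable]: "f \<in> borel_measurable borel" and i: "integrable borel_disk f"
  shows "integrable borel_unit (circle_mean f)"
    and "AE s in borel_unit. integrable borel_disk (\<lambda>y. f (rot y (ray_point s)))"
    and "(LINT x|borel_disk. f x) = pi * (LINT s|borel_unit. circle_mean f s)"
proof -
  note p = integrable_polar[OF assms]
  have i1: "integrable borel_unit (\<lambda>s. LINT y|borel_disk. f (rot y (ray_point s)))"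
    using unit_disk.integrable_fst'[OF p] by simp
  then show "integrable borel_unit (circle_mean f)"
    by (simp add: circle_mean_def[abs_def])
  show "AE s in borel_unit. integrable borel_disk (\<lambda>y. f (rot y (ray_point s)))"
    using unit_disk.AE_integrable_fst'[OF p] by simp
  have "(LINT x|borel_disk. f x) = (LINT x|distr borel_disk borel (\<lambda>x. x). f x)"
    by (subst integral_distr) (auto intro: measurable_restrict_space1)
  also have "\<dots> = (LINT z|(borel_unit \<Otimes>\<^sub>M borel_disk). (\<lambda>(s, y). f (rot y (ray_point s))) z)"
    unfolding distr_polar[symmetric] using polar_measurable f
    by (subst integral_distr) (auto simp: split_beta')
  also have "\<dots> = (LINT s|borel_unit. LINT y|borel_disk. f (rot y (ray_point s)))"
    using unit_disk.integral_fst'[OF p] by simp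
  finally show "(LINT x|borel_disk. f x) = pi * (LINT s|borel_unit. circle_mean f s)"
    by (simp add: circle_mean_def)
qed

lemma AE_polar:
  assumes "AE x in borel_disk. P x" and [measurable]: "Measurable.pred borel P"
  shows "AE s in borel_unit. AE y in borel_disk. P (rot y (ray_point s))"
proof -
  have "AE x in distr borel_disk borel (\<lambda>x. x). P x"
    using assms by (subst AE_distr_iff) (auto intro: measurable_restrict_space1)
  then have "AE x in distr (borel_unit \<Otimes>\<^sub>M borel_disk) borel (\<lambda>(s, y). rot y (ray_point s)). P x"
    by (simp only: distr_polar)
  then have "AE z in borel_unit \<Otimes>\<^sub>M borel_disk. P (rot (snd z) (ray_point (fst z)))"
    using AE_distrD[OF polar_measurable] by (auto simp: split_beta')
  from unit_disk.AE_pair[OF this] show ?thesis by simp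
qed

lemma norm_rot_ray_point: "y \<noteq> 0 \<Longrightarrow> 0 \<le> s \<Longrightarrow> (norm (rot y (ray_point s)))\<^sup>2 = s"
  by (simp add: norm_rot norm_ray_point)

lemma circle_mean_radial_mult:
  assumes [measurable]: "f \<in> borel_measurable borel" "g \<in> borel_measurable borel" and s: "0 \<le> s"
  shows "circle_mean (\<lambda>x. g ((norm x)\<^sup>2) * f x) s = g s * circle_mean f s"
proof -
  have "(LINT y|borel_disk. g ((norm (rot y (ray_point s)))\<^sup>2) * f (rot y (ray_point s))) =
     (LINT y|borel_disk. g s * f (rot y (ray_point s)))"
  proof (rule integral_cong_AE)
    show "AE y in borel_disk. g ((norm (rot y (ray_point s)))\<^sup>2) * f (rot y (ray_point s)) = g s * f (rot y (ray_point s))"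
      using AE_disk_nonzero by eventually_elim (simp add: norm_rot_ray_point s)
  qed (rule borel_measurable_disk; measurable)+
  then show ?thesis by (simp add: circle_mean_def)
qed

lemma integral_disk_rot:
  fixes f :: "real^2 \<Rightarrow> real"
  assumes [measurable]: "f \<in> borel_measurable borel" and z: "z \<noteq> 0"
  shows "(LINT x|borel_disk. f (rot z x)) = (LINT x|borel_disk. f x)"
proof -
  have m: "rot z \<in> borel_disk \<rightarrow>\<^sub>M borel" "(\<lambda>x. x) \<in> borel_disk \<rightarrow>\<^sub>M borel"
    by (rule borel_measurable_disk; measurable)+
  have "distr borel_disk borel (rot z) = distr borel_disk borel (\<lambda>x. x)"
  proof (rule measure_eqI)
    fix A assume "A \<in> sets (distr borel_disk borel (rot z))"
    then have [measurable]: "A \<in> sets borel" by simp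
    have "emeasure (distr borel_disk borel (rot z)) A = (\<integral>\<^sup>+x. indicator A (rot z x) \<partial>borel_disk)"
      using nn_integral_distr[OF m(1), of "indicator A"] by simp
    also have "\<dots> = (\<integral>\<^sup>+x. indicator A x \<partial>borel_disk)"
      by (rule nn_integral_disk_rot[OF _ z]) measurable
    also have "\<dots> = emeasure (distr borel_disk borel (\<lambda>x. x)) A"
      using nn_integral_distr[OF m(2), of "indicator A"] by simp
    finally show "emeasure (distr borel_disk borel (rot z)) A = emeasure (distr borel_disk borel (\<lambda>x. x)) A" .
  qed simp
  then have "(LINT x|distr borel_disk borel (rot z). f x) = (LINT x|distr borel_disk borel (\<lambda>x. x). f x)"
    by simp
  with m show ?thesis by (simp add: integral_distr)
qed

text \<open>The exceptional set in the hypothesis depends on \<open>y\<close>. Fubini exchanges the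
  quantifiers: for almost every \<open>x\<close> invariance holds for almost every \<open>y\<close>,
  which is enough to average over \<open>y\<close>.\<close>

lemma rotation_invariant_eq_circle_mean:
  assumes [measurable]: "f \<in> borel_measurable borel"
    and inv: "\<And>y. y \<noteq> 0 \<Longrightarrow> AE x in borel_disk. f (rot y x) = f x"
  shows "AE x in borel_disk. f x = circle_mean f ((norm x)\<^sup>2)"
proof -
  have "AE y in borel_disk. AE x in borel_disk. f (rot y x) = f x"
    using AE_disk_nonzero by eventually_elim (rule inv)
  then have "AE x in borel_disk. AE y in borel_disk. f (rot y x) = f x"
    by (subst (asm) disk_disk.AE_commute) (simp_all, measurable)
  then show ?thesis
    using AE_disk_nonzero
  proof eventually_elim
    case (elim x)
    let ?p = "ray_point ((norm x)\<^sup>2)"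
    have "pi * f x = (LINT y|borel_disk. f x)"
      by (simp add: measure_restrict_space space_restrict_space content_disk)
    also have "\<dots> = (LINT y|borel_disk. f (rot y x))"
      by (rule integral_cong_AE)
         (use elim(1) in \<open>auto intro!: borel_measurable_disk elim!: eventually_mono\<close>)
    also have "\<dots> = (LINT y|borel_disk. f (rot y (rot x ?p)))"
      by (simp only: rot_ray_point)
    also have "\<dots> = (LINT y|borel_disk. f (rot (rot x y) ?p))"
      by (simp only: rot_rot[OF elim(2)])
    also have "\<dots> = (LINT y|borel_disk. f (rot y ?p))"
      by (rule integral_disk_rot[OF _ elim(2), of "\<lambda>y. f (rot y ?p)"]) measurable
    finally show ?case by (simp add: circle_mean_def field_simps)
  qed
qed

section \<open>From Lebesgue to Borel measure on the disk\<close>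

lemma AE_lebesgue_on_disk_iff: "(AE x in lebesgue_on disk. P x) \<longleftrightarrow> (AE x in borel_disk. P x)"
  by (simp add: AE_restrict_space_iff AE_completion_iff)

lemma lebesgue_on_disk_borel_disk:
  fixes f :: "real^2 \<Rightarrow> real"
  assumes [measurable]: "f \<in> borel_measurable borel"
  shows "integrable (lebesgue_on disk) f \<longleftrightarrow> integrable borel_disk f"
    and "(LINT x|lebesgue_on disk. f x) = (LINT x|borel_disk. f x)"
proof -
  have [measurable]: "(disk :: (real^2) set) \<in> sets borel" by simp
  have m: "(\<lambda>x. indicator disk x * f x) \<in> borel_measurable lborel" by measurable
  show "integrable (lebesgue_on disk) f \<longleftrightarrow> integrable borel_disk f"
    by (simp add: integrable_restrict_space integrable_completion[OF m])
  show "(LINT x|lebesgue_on disk. f x) = (LINT x|borel_disk. f x)"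
    by (simp add: integral_restrict_space integral_completion[OF m])
qed

lemma lebesgue_on_disk_borel_representative:
  fixes f :: "real^2 \<Rightarrow> real"
  assumes "f \<in> borel_measurable (lebesgue_on disk)"
  obtains g where "g \<in> borel_measurable borel" "AE x in borel_disk. f x = g x"
proof -
  have "(\<lambda>x. if x \<in> disk then f x else 0) \<in> borel_measurable lebesgue"
    using assms by (subst borel_measurable_if) auto
  then obtain g where g: "g \<in> borel_measurable lborel" "AE x in lborel. (if x \<in> disk then f x else 0) = g x"
    using completion_ex_borel_measurable_real by blast
  show thesis
  proof (rule that[of g])
    show "AE x in borel_disk. f x = g x"
      using g(2) by (auto simp: AE_restrict_space_iff elim!: eventually_mono)
  qed (use g in simp)
qed

definition trace_fun :: "(real^2 \<Rightarrow> real^2^2) \<Rightarrow> real^2 \<Rightarrow> real" where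
  "trace_fun G x = G x $ 1 $ 1 + G x $ 2 $ 2"

text \<open>The quadratic form of \<open>G x\<close> in the tangential direction \<open>(- x\<^sub>2, x\<^sub>1)\<close>.\<close>

definition tangential :: "(real^2 \<Rightarrow> real^2^2) \<Rightarrow> real^2 \<Rightarrow> real" where
  "tangential G x = (x $ 2)\<^sup>2 * G x $ 1 $ 1 - x $ 1 * x $ 2 * (G x $ 1 $ 2 + G x $ 2 $ 1) + (x $ 1)\<^sup>2 * G x $ 2 $ 2"

lemma has_derivative_norm_square_compose:
  fixes x :: "real^2"
  assumes "(g has_real_derivative d) (at ((norm x)\<^sup>2))"
  shows "((\<lambda>x. g ((norm x)\<^sup>2)) has_derivative (\<lambda>h. d * (2 * x $ 1 * h $ 1 + 2 * x $ 2 * h $ 2))) (at x)"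
proof -
  have "((\<lambda>x::real^2. (norm x)\<^sup>2) has_derivative (\<lambda>h. 2 * x $ 1 * h $ 1 + 2 * x $ 2 * h $ 2)) (at x)"
    unfolding norm_square_2
    by (rule has_derivative_eq_rhs, (rule derivative_intros bounded_linear_imp_has_derivative bounded_linear_vec_nth)+)
       (auto simp: fun_eq_iff)
  from has_derivative_compose[OF this, of g "\<lambda>v. d * v"] assms show ?thesis
    by (simp add: has_field_derivative_def mult_commute_abs)
qed

lemma has_derivative_component [derivative_intros]:
  "((\<lambda>x. x $ i) has_derivative (\<lambda>h. h $ i)) F"
  by (rule bounded_linear_imp_has_derivative[OF bounded_linear_vec_nth])

lemma times_differentiable_norm_square: "times_differentiable k (\<lambda>x::real^2. (norm x)\<^sup>2)"
  unfolding norm_square_2 unfolding power2_eq_square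
  by (intro times_differentiable_add times_differentiable_mult times_differentiable_component)

text \<open>The cofactor matrix of a Hessian is divergence free, so it is orthogonal to the Hessian
  of \<open>u\<close> when it has compact support. Here it comes from the radial function
  \<open>\<Psi>(|x|^2)\<close> with \<open>\<Psi>' = \<psi>\<close>, and pairing it with a matrix
  field leaves exactly the trace and the tangential part.\<close>

lemma radial_weak_identity:
  fixes u :: "real^2 \<Rightarrow> real"
  assumes u: "u \<in> W22" and b: "b < 1"
    and \<psi>: "\<And>s. (\<psi> has_real_derivative bump n a b s) (at s)" "\<And>s. b \<le> s \<Longrightarrow> \<psi> s = 0"
  shows "(LINT x|lebesgue_on disk. \<psi> ((norm x)\<^sup>2) * trace_fun (hess u) x + 2 * bump n a b ((norm x)\<^sup>2) * tangential (hess u) x) = 0"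
proof -
  define \<eta> where "\<eta> = bump n a b"
  define g where "g i j = weak_deriv disk [i, j] u" for i j :: 2
  have wd: "has_weak_deriv disk [i, j] u (g i j)" for i j
    unfolding g_def by (rule sobolev_has_weak_deriv[OF u]) simp
  \<comment> \<open>These are the entries \<open>11\<close>, \<open>22\<close> and \<open>12\<close>
    of the Hessian of \<open>\<Psi>(|x|^2)\<close>. Unlike \<open>\<Psi>\<close> itself they involve
    only \<open>\<psi>\<close> and \<open>\<eta>\<close>, which vanish near the boundary of the
    disk.\<close>
  define \<phi>1 where "\<phi>1 x = 2 * \<psi> ((norm x)\<^sup>2) + 4 * (x $ 1 * x $ 1 * \<eta> ((norm x)\<^sup>2))" for x :: "real^2"
  define \<phi>2 where "\<phi>2 x = 2 * \<psi> ((norm x)\<^sup>2) + 4 * (x $ 2 * x $ 2 * \<eta> ((norm x)\<^sup>2))" for x :: "real^2"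
  define \<phi>3 where "\<phi>3 x = 4 * (x $ 1 * x $ 2 * \<eta> ((norm x)\<^sup>2))" for x :: "real^2"
  have td: "times_differentiable_real k \<eta>" for k
    unfolding \<eta>_def by (rule times_differentiable_real_bump)
  then have td': "times_differentiable_real k \<psi>" for k
    using \<psi>(1) by (cases k) (auto simp: \<eta>_def)
  have "times_differentiable k (\<lambda>x::real^2. \<eta> ((norm x)\<^sup>2))" "times_differentiable k (\<lambda>x::real^2. \<psi> ((norm x)\<^sup>2))" for k
    by (rule times_differentiable_compose_real[OF td times_differentiable_norm_square]
        times_differentiable_compose_real[OF td' times_differentiable_norm_square])+
  then have sm: "smooth \<phi>1" "smooth \<phi>2" "smooth \<phi>3"
    unfolding smooth_iff_times_differentiable \<phi>1_def[abs_def] \<phi>2_def[abs_def] \<phi>3_def[abs_def]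
    by (auto intro!: times_differentiable_add times_differentiable_mult times_differentiable_const times_differentiable_component)
  let ?K = "cball 0 (sqrt (max 0 b)) :: (real^2) set"
  have K: "compact ?K" "?K \<subseteq> disk"
  proof -
    have "sqrt (max 0 b) < 1" using b by simp
    then have "norm x < 1" if "norm x \<le> sqrt (max 0 b)" for x :: "real^2"
      using that by linarith
    then show "?K \<subseteq> disk" by auto
  qed simp
  have zero: "\<psi> ((norm x)\<^sup>2) = 0" "\<eta> ((norm x)\<^sup>2) = 0" if "x \<notin> ?K" for x
  proof -
    have "sqrt (max 0 b) < norm x" using that by simp
    then have "(sqrt (max 0 b))\<^sup>2 < (norm x)\<^sup>2" by (intro power_strict_mono) auto
    then have "b < (norm x)\<^sup>2" by simp
    then show "\<psi> ((norm x)\<^sup>2) = 0" "\<eta> ((norm x)\<^sup>2) = 0"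
      by (auto simp: \<psi>(2) \<eta>_def bump_eq_0)
  qed
  have test: "\<phi>1 \<in> test_functions disk" "\<phi>2 \<in> test_functions disk" "\<phi>3 \<in> test_functions disk"
    by (rule test_functionsI[OF _ K]; simp add: sm zero \<phi>1_def \<phi>2_def \<phi>3_def)+
  obtain \<eta>' where \<eta>': "\<And>s. (\<eta> has_real_derivative \<eta>' s) (at s)"
    using td[of 1] by auto
  note d = has_derivative_norm_square_compose[OF \<eta>'] has_derivative_norm_square_compose[OF \<psi>(1)[folded \<eta>_def]]
  \<comment> \<open>This and the next identity say that the rows of the cofactor matrix have zero
    divergence. After moving the derivatives from \<open>u\<close> to the test functions, the four
    terms cancel in pairs.\<close>
  have p1: "partial_deriv 1 \<phi>2 = partial_deriv 2 \<phi>3"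
  proof
    fix x :: "real^2"
    have "(\<phi>2 has_derivative (\<lambda>h. 2 * (\<eta> ((norm x)\<^sup>2) * (2 * x $ 1 * h $ 1 + 2 * x $ 2 * h $ 2)) +
       4 * ((x $ 2 * x $ 2) * (\<eta>' ((norm x)\<^sup>2) * (2 * x $ 1 * h $ 1 + 2 * x $ 2 * h $ 2)) + (x $ 2 * h $ 2 + h $ 2 * x $ 2) * \<eta> ((norm x)\<^sup>2)))) (at x)"
      unfolding \<phi>2_def[abs_def]
      by (intro has_derivative_add has_derivative_mult_right has_derivative_mult has_derivative_component d)
    moreover have "(\<phi>3 has_derivative (\<lambda>h.
       4 * ((x $ 1 * x $ 2) * (\<eta>' ((norm x)\<^sup>2) * (2 * x $ 1 * h $ 1 + 2 * x $ 2 * h $ 2)) + (x $ 1 * h $ 2 + h $ 1 * x $ 2) * \<eta> ((norm x)\<^sup>2)))) (at x)"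
      unfolding \<phi>3_def[abs_def]
      by (intro has_derivative_add has_derivative_mult_right has_derivative_mult has_derivative_component d)
    ultimately show "partial_deriv 1 \<phi>2 x = partial_deriv 2 \<phi>3 x"
      by (simp add: partial_deriv_eq axis_def algebra_simps)
  qed
  have p2: "partial_deriv 2 \<phi>1 = partial_deriv 1 \<phi>3"
  proof
    fix x :: "real^2"
    have "(\<phi>1 has_derivative (\<lambda>h. 2 * (\<eta> ((norm x)\<^sup>2) * (2 * x $ 1 * h $ 1 + 2 * x $ 2 * h $ 2)) +
       4 * ((x $ 1 * x $ 1) * (\<eta>' ((norm x)\<^sup>2) * (2 * x $ 1 * h $ 1 + 2 * x $ 2 * h $ 2)) + (x $ 1 * h $ 1 + h $ 1 * x $ 1) * \<eta> ((norm x)\<^sup>2)))) (at x)"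
      unfolding \<phi>1_def[abs_def]
      by (intro has_derivative_add has_derivative_mult_right has_derivative_mult has_derivative_component d)
    moreover have "(\<phi>3 has_derivative (\<lambda>h.
       4 * ((x $ 1 * x $ 2) * (\<eta>' ((norm x)\<^sup>2) * (2 * x $ 1 * h $ 1 + 2 * x $ 2 * h $ 2)) + (x $ 1 * h $ 2 + h $ 1 * x $ 2) * \<eta> ((norm x)\<^sup>2)))) (at x)"
      unfolding \<phi>3_def[abs_def]
      by (intro has_derivative_add has_derivative_mult_right has_derivative_mult has_derivative_component d)
    ultimately show "partial_deriv 2 \<phi>1 x = partial_deriv 1 \<phi>3 x"
      by (simp add: partial_deriv_eq axis_def algebra_simps)
  qed
  have int: "integrable (lebesgue_on disk) (\<lambda>x. g i j x * \<phi> x)" if "\<phi> \<in> test_functions disk" for i j \<phi>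
    using wd[of i j] that by (intro integrable_mult_test_function) (auto simp: has_weak_deriv_def)
  have weak: "(LINT x|lebesgue_on disk. g i j x * \<phi> x) = (LINT x|lebesgue_on disk. u x * partial_deriv i (partial_deriv j \<phi>) x)"
    if "\<phi> \<in> test_functions disk" for i j \<phi>
    using wd[of i j] that by (simp add: has_weak_deriv_def)
  have "(LINT x|lebesgue_on disk. 2 * (\<psi> ((norm x)\<^sup>2) * trace_fun (hess u) x + 2 * bump n a b ((norm x)\<^sup>2) * tangential (hess u) x)) =
     (LINT x|lebesgue_on disk. g 1 1 x * \<phi>2 x + g 2 2 x * \<phi>1 x - g 1 2 x * \<phi>3 x - g 2 1 x * \<phi>3 x)"
    by (intro Bochner_Integration.integral_cong refl)
       (simp add: trace_fun_def tangential_def weak_hessian_def g_def \<phi>1_def \<phi>2_def \<phi>3_def \<eta>_def power2_eq_square algebra_simps)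
  also have "\<dots> = 0"
    using test int by (simp add: weak p1 p2)
  finally have "2 * (LINT x|lebesgue_on disk. \<psi> ((norm x)\<^sup>2) * trace_fun (hess u) x + 2 * bump n a b ((norm x)\<^sup>2) * tangential (hess u) x) = 0"
    by (simp only: integral_mult_right_zero)
  then show ?thesis by simp
qed

section \<open>Radially symmetric functions\<close>

text \<open>\<open>V(R x)\<close> equals \<open>V(x)\<close> almost everywhere because
  \<open>R\<close> preserves norms, so the transformed Hessian is another weak Hessian of
  \<open>V\<close>, and weak derivatives are unique. The exceptional set depends on
  \<open>R\<close>.\<close>

lemma hess_orthogonal_invariance:
  assumes V: "V \<in> W22" and rad: "radially_symmetric V" and R: "orthogonal_transformation R"
  shows "AE x in borel_disk. \<forall>i j. hess V x $ i $ j =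
    (\<Sum>k\<in>UNIV. \<Sum>l\<in>UNIV. R (axis i 1) $ k * R (axis j 1) $ l * hess V (R x) $ k $ l)"
proof -
  let ?g = "\<lambda>k l. weak_deriv disk [k, l] V"
  have \<Omega>: "R -` disk = disk" by (rule orthogonal_transformation_vimage_disk[OF R])
  obtain v where v: "AE x in lebesgue_on disk. V x = v (norm x)"
    using rad by (auto simp: radially_symmetric_def)
  have "AE x in lebesgue_on disk. V (R x) = v (norm (R x))"
    by (rule AE_compose_orthogonal[OF R \<Omega> _ v]) simp
  with v have inv: "AE x in lebesgue_on disk. V (R x) = V x"
    by eventually_elim (simp add: orthogonal_transformation_norm[OF R])
  have wd: "has_weak_deriv disk [k, l] V (?g k l)" for k l
    by (rule sobolev_has_weak_deriv[OF V]) simp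
  have "AE x in lebesgue_on disk. ?g i j x =
      (\<Sum>k\<in>UNIV. \<Sum>l\<in>UNIV. R (axis i 1) $ k * R (axis j 1) $ l * ?g k l (R x))" for i j
    by (rule has_weak_deriv_unique[OF wd has_weak_deriv_AE_cong[OF has_weak_deriv_compose_orthogonal[OF R \<Omega> _ wd] inv]]) auto
  then have "AE x in borel_disk. ?g i j x =
      (\<Sum>k\<in>UNIV. \<Sum>l\<in>UNIV. R (axis i 1) $ k * R (axis j 1) $ l * ?g k l (R x))" for i j
    by (simp only: AE_lebesgue_on_disk_iff)
  then show ?thesis
    by (simp add: weak_hessian_def AE_all_countable)
qed

lemma AE_borel_disk_orthogonal:
  assumes R: "orthogonal_transformation R" and P: "AE x in borel_disk. P x"
  shows "AE x in borel_disk. P (R x)"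
  using AE_compose_orthogonal[where P = P, OF R orthogonal_transformation_vimage_disk[OF R, of 1]] P
  by (simp add: AE_lebesgue_on_disk_iff)

text \<open>The mixed entries of the Hessian stem from two separate choices of weak derivatives.
  Their difference is treated as one more scalar field, which radial symmetry forces to
  vanish.\<close>

definition asymmetry :: "(real^2 \<Rightarrow> real^2^2) \<Rightarrow> real^2 \<Rightarrow> real" where
  "asymmetry G x = G x $ 1 $ 2 - G x $ 2 $ 1"

text \<open>The entry of \<open>G x\<close> in the directions \<open>x\<close> and \<open>(- x\<^sub>2, x\<^sub>1)\<close>.\<close>

definition mixed :: "(real^2 \<Rightarrow> real^2^2) \<Rightarrow> real^2 \<Rightarrow> real" where
  "mixed G x = x $ 1 * x $ 1 * G x $ 1 $ 2 - x $ 1 * x $ 2 * G x $ 1 $ 1 +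
     x $ 2 * x $ 1 * G x $ 2 $ 2 - x $ 2 * x $ 2 * G x $ 2 $ 1"

lemma rot_axis:
  "rot y (axis 1 1) $ 1 = y $ 1 / norm y" "rot y (axis 1 1) $ 2 = y $ 2 / norm y"
  "rot y (axis 2 1) $ 1 = - (y $ 2 / norm y)" "rot y (axis 2 1) $ 2 = y $ 1 / norm y"
  by (simp_all add: axis_def)

text \<open>Trace and antisymmetric part are invariant under conjugation by rotations. The other two
  fields are entries in the frame of \<open>x\<close> and its perpendicular, which rotates along
  with \<open>x\<close>.\<close>

lemma rotation_invariance_fields:
  assumes V: "V \<in> W22" and rad: "radially_symmetric V" and y: "y \<noteq> 0"
  shows "AE x in borel_disk. trace_fun (hess V) (rot y x) = trace_fun (hess V) x \<and>
    tangential (hess V) (rot y x) = tangential (hess V) x \<and>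
    mixed (hess V) (rot y x) = mixed (hess V) x \<and> asymmetry (hess V) (rot y x) = asymmetry (hess V) x"
  using hess_orthogonal_invariance[OF V rad orthogonal_transformation_rot[OF y]]
proof eventually_elim
  case (elim x)
  define c where "c = y $ 1 / norm y"
  define d where "d = y $ 2 / norm y"
  have "c\<^sup>2 + d\<^sup>2 = 1"
    using y by (simp add: c_def d_def power_divide add_divide_distrib[symmetric] norm_square_2[symmetric])
  then have cd: "c * c + d * d = 1" by (simp add: power2_eq_square)
  note R = rot_axis[of y, folded c_def d_def]
  have r: "rot y x $ 1 = c * x $ 1 - d * x $ 2" "rot y x $ 2 = c * x $ 2 + d * x $ 1"
    by (simp_all add: c_def d_def diff_divide_distrib add_divide_distrib)
  define A where "A = hess V (rot y x) $ 1 $ 1"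
  define B where "B = hess V (rot y x) $ 1 $ 2"
  define C where "C = hess V (rot y x) $ 2 $ 1"
  define D where "D = hess V (rot y x) $ 2 $ 2"
  note abcd = A_def[symmetric] B_def[symmetric] C_def[symmetric] D_def[symmetric]
  have h: "hess V x $ 1 $ 1 = c * c * A + c * d * B + d * c * C + d * d * D"
    "hess V x $ 1 $ 2 = - (c * d * A) + c * c * B - d * d * C + d * c * D"
    "hess V x $ 2 $ 1 = - (d * c * A) - d * d * B + c * c * C + c * d * D"
    "hess V x $ 2 $ 2 = d * d * A - d * c * B - c * d * C + c * c * D"
    using elim[rule_format, of 1 1] elim[rule_format, of 1 2] elim[rule_format, of 2 1] elim[rule_format, of 2 2]
    by (simp_all only: sum_2 R abcd)
  have "trace_fun (hess V) x = (c * c + d * d) * (A + D)"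
    unfolding trace_fun_def h by (simp add: algebra_simps)
  moreover have "trace_fun (hess V) (rot y x) = A + D"
    by (simp add: trace_fun_def abcd)
  moreover have "tangential (hess V) (rot y x) = tangential (hess V) x"
    unfolding tangential_def h r abcd power2_eq_square by (simp add: algebra_simps)
  moreover have "mixed (hess V) (rot y x) = mixed (hess V) x"
    unfolding mixed_def h r abcd by (simp add: algebra_simps)
  moreover have "asymmetry (hess V) x = (c * c + d * d) * (B - C)"
    unfolding asymmetry_def h by (simp add: algebra_simps)
  moreover have "asymmetry (hess V) (rot y x) = B - C"
    by (simp add: asymmetry_def abcd)
  ultimately show ?case by (simp add: cd)
qed

definition reflect :: "real^2 \<Rightarrow> real^2" where
  "reflect x = x $ 1 *\<^sub>R axis 1 1 - x $ 2 *\<^sub>R axis 2 1"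

lemma reflect_nth [simp]: "reflect x $ 1 = x $ 1" "reflect x $ 2 = - x $ 2"
  by (simp_all add: reflect_def axis_def)

lemma orthogonal_transformation_reflect: "orthogonal_transformation reflect"
  unfolding orthogonal_transformation
proof
  show "linear reflect" by (rule linearI) (simp_all add: vec_eq_iff forall_2)
  have "(norm (reflect x))\<^sup>2 = (norm x)\<^sup>2" for x
    by (simp add: norm_square_2)
  then show "\<forall>v. norm (reflect v) = norm v" by simp
qed

text \<open>A reflection reverses orientation: the perpendicular of \<open>reflect x\<close> is
  minus the reflected perpendicular of \<open>x\<close>. The mixed entry contains the perpendicular
  once, and the antisymmetric part is proportional to the orientation.\<close>

lemma reflection_odd_fields:
  assumes V: "V \<in> W22" and rad: "radially_symmetric V"
  shows "AE x in borel_disk. mixed (hess V) (reflect x) = - mixed (hess V) x \<and>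
    asymmetry (hess V) (reflect x) = - asymmetry (hess V) x"
  using hess_orthogonal_invariance[OF V rad orthogonal_transformation_reflect]
proof eventually_elim
  case (elim x)
  have "reflect (axis 1 1) $ 1 = 1" "reflect (axis 1 1) $ 2 = 0"
    "reflect (axis 2 1) $ 1 = 0" "reflect (axis 2 1) $ 2 = - 1"
    by (simp_all add: axis_def)
  then have "hess V x $ 1 $ 1 = hess V (reflect x) $ 1 $ 1" "hess V x $ 1 $ 2 = - hess V (reflect x) $ 1 $ 2"
    "hess V x $ 2 $ 1 = - hess V (reflect x) $ 2 $ 1" "hess V x $ 2 $ 2 = hess V (reflect x) $ 2 $ 2"
    using elim by (simp_all add: sum_2)
  then show ?case by (simp add: mixed_def asymmetry_def)
qed

lemma L2_bounded_mult:
  assumes f: "f \<in> L2 disk" and c [measurable]: "c \<in> borel_measurable borel" and b: "\<And>x. x \<in> disk \<Longrightarrow> \<bar>c x\<bar> \<le> 1"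
  shows "(\<lambda>x. c x * f x) \<in> L2 disk"
proof -
  have [measurable]: "f \<in> borel_measurable (lebesgue_on disk)"
    using f by (simp add: L2_def)
  have [measurable]: "c \<in> borel_measurable (lebesgue_on disk)"
    by (rule measurable_restrict_space1) (simp add: measurable_completion)
  have "integrable (lebesgue_on disk) (\<lambda>x. (c x * f x)\<^sup>2)"
  proof (rule Bochner_Integration.integrable_bound[of _ "\<lambda>x. (f x)\<^sup>2"])
    show "AE x in lebesgue_on disk. norm ((c x * f x)\<^sup>2) \<le> norm ((f x)\<^sup>2)"
    proof (rule AE_I2)
      fix x assume "x \<in> space (lebesgue_on disk)"
      then have "(c x)\<^sup>2 \<le> 1" using b[of x] by (simp add: abs_square_le_1)
      then show "norm ((c x * f x)\<^sup>2) \<le> norm ((f x)\<^sup>2)"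
        by (simp add: power_mult_distrib mult_left_le_one_le)
    qed
  qed (use f in \<open>auto simp: L2_def\<close>)
  then show ?thesis by (simp add: L2_def)
qed

lemma circle_mean_measurable [measurable]:
  assumes [measurable]: "f \<in> borel_measurable borel"
  shows "circle_mean f \<in> borel_measurable borel"
proof -
  have [measurable]: "snd \<in> borel \<Otimes>\<^sub>M borel_disk \<rightarrow>\<^sub>M borel"
    by (rule measurable_compose[OF measurable_snd]) (rule measurable_restrict_space1, simp)
  have "(\<lambda>z. f (rot (snd z) (ray_point (fst z)))) \<in> borel_measurable (borel \<Otimes>\<^sub>M borel_disk)"
    by measurable
  then have [measurable]: "(\<lambda>s. LINT y|borel_disk. f (rot y (ray_point s))) \<in> borel_measurable borel"
    using disk.borel_measurable_lebesgue_integral[of "\<lambda>s y. f (rot y (ray_point s))" borel]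
    by (simp add: split_beta')
  show ?thesis unfolding circle_mean_def[abs_def] by measurable
qed

lemma borel_unit_set_integral:
  fixes f :: "real \<Rightarrow> real"
  assumes [measurable]: "f \<in> borel_measurable borel"
  shows "integrable borel_unit f \<longleftrightarrow> set_integrable lborel {0..1} f"
    and "(LINT s|borel_unit. f s) = (LBINT s:{0..1}. f s)"
proof -
  have ae: "AE s in lborel. indicator {0<..<1} s *\<^sub>R f s = indicator {0..1} s *\<^sub>R f s"
    using AE_lborel_singleton[of 0] AE_lborel_singleton[of 1]
    by eventually_elim (auto simp: indicator_def)
  have "integrable lborel (\<lambda>s. indicator {0<..<1} s *\<^sub>R f s) \<longleftrightarrow> integrable lborel (\<lambda>s. indicator {0..1} s *\<^sub>R f s)"
    by (rule integrable_cong_AE[OF _ _ ae]) measurable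
  then show "integrable borel_unit f \<longleftrightarrow> set_integrable lborel {0..1} f"
    unfolding set_integrable_def by (subst integrable_restrict_space) auto
  have "(LINT s|lborel. indicator {0<..<1} s *\<^sub>R f s) = (LINT s|lborel. indicator {0..1} s *\<^sub>R f s)"
    by (rule integral_cong_AE[OF _ _ ae]) measurable
  then show "(LINT s|borel_unit. f s) = (LBINT s:{0..1}. f s)"
    unfolding set_lebesgue_integral_def by (subst integral_restrict_space) auto
qed

lemma AE_borel_unit_iff: "(AE s in borel_unit. P s) \<longleftrightarrow> (AE s in lborel. s \<in> {0<..<1} \<longrightarrow> P s)"
  by (simp add: AE_restrict_space_iff)

text \<open>On a circle the coefficients are constants and leave the mean. This carries the
  constraint from the nonradial field \<open>G\<close> to its circle means.\<close>

lemma circle_mean_linear_relation: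
  assumes [measurable]: "f \<in> borel_measurable borel" "g \<in> borel_measurable borel"
      "a \<in> borel_measurable borel" "b \<in> borel_measurable borel"
    and i: "integrable borel_disk f" "integrable borel_disk g"
    and rel: "AE x in borel_disk. a ((norm x)\<^sup>2) * f x + b ((norm x)\<^sup>2) * g x = 0"
  shows "AE s in borel_unit. a s * circle_mean f s + b s * circle_mean g s = 0"
proof -
  have "AE s in borel_unit. AE y in borel_disk. a ((norm (rot y (ray_point s)))\<^sup>2) * f (rot y (ray_point s)) +
      b ((norm (rot y (ray_point s)))\<^sup>2) * g (rot y (ray_point s)) = 0"
    by (rule AE_polar[OF rel]) measurable
  moreover have "AE s in borel_unit. s \<in> {0<..<1}"
    by (simp add: AE_borel_unit_iff)
  ultimately show ?thesis
    using circle_mean_integrable(2)[OF assms(1) i(1)] circle_mean_integrable(2)[OF assms(2) i(2)]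
  proof eventually_elim
    case (elim s)
    have "AE y in borel_disk. a s * f (rot y (ray_point s)) + b s * g (rot y (ray_point s)) = 0"
      using elim(1) AE_disk_nonzero
    proof eventually_elim
      case (elim y)
      then show ?case using \<open>s \<in> {0<..<1}\<close> norm_rot_ray_point[of y s] by simp
    qed
    then have "(LINT y|borel_disk. a s * f (rot y (ray_point s)) + b s * g (rot y (ray_point s))) = 0"
      by (rule integral_eq_zero_AE)
    then have "a s * (LINT y|borel_disk. f (rot y (ray_point s))) + b s * (LINT y|borel_disk. g (rot y (ray_point s))) = 0"
      using elim by simp
    then show ?case by (simp add: circle_mean_def add_divide_distrib[symmetric])
  qed
qed

text \<open>Rotation invariance makes \<open>f\<close> a function of \<open>|x|^2\<close> almost
  everywhere, hence even under reflection; a function both even and odd vanishes.\<close>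

lemma rotation_invariant_odd_eq_0:
  fixes f :: "real^2 \<Rightarrow> real"
  assumes f: "f \<in> borel_measurable borel"
    and inv: "\<And>y. y \<noteq> 0 \<Longrightarrow> AE x in borel_disk. f (rot y x) = f x"
    and odd: "AE x in borel_disk. f (reflect x) = - f x"
  shows "AE x in borel_disk. f x = 0"
proof -
  have m: "AE x in borel_disk. f x = circle_mean f ((norm x)\<^sup>2)"
    by (rule rotation_invariant_eq_circle_mean[OF f inv])
  show ?thesis
    using m AE_borel_disk_orthogonal[OF orthogonal_transformation_reflect m] odd
    by eventually_elim (simp add: orthogonal_transformation_norm[OF orthogonal_transformation_reflect])
qed

text \<open>Polar coordinates compose fields with \<open>rot\<close> on product measures, where
  Borel measurability is the right notion; for the weak Hessian only Lebesgue measurability is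
  known.\<close>

lemma hess_borel_representative:
  assumes u: "u \<in> W22"
  obtains G :: "real^2 \<Rightarrow> real^2^2" where "\<And>i j. (\<lambda>x. G x $ i $ j) \<in> borel_measurable borel"
    "AE x in borel_disk. hess u x = G x" "\<And>i j. (\<lambda>x. G x $ i $ j) \<in> L2 disk"
proof -
  have L: "(\<lambda>x. hess u x $ i $ j) \<in> L2 disk" for i j
    using hess_mat_L2[OF u] by (simp add: mat_L2_def)
  then have "(\<lambda>x. hess u x $ i $ j) \<in> borel_measurable (lebesgue_on disk)" for i j
    by (simp add: L2_def)
  then have "\<exists>g. g \<in> borel_measurable borel \<and> (AE x in borel_disk. hess u x $ i $ j = g x)" for i j
    by (rule lebesgue_on_disk_borel_representative) blast
  note ex = this
  define g where "g i j = (SOME g. g \<in> borel_measurable borel \<and> (AE x in borel_disk. hess u x $ i $ j = g x))" for i j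
  have g: "g i j \<in> borel_measurable borel" "AE x in borel_disk. hess u x $ i $ j = g i j x" for i j
    using someI_ex[OF ex[of i j]] by (simp_all add: g_def)
  show thesis
  proof (rule that[of "\<lambda>x. \<chi> i j. g i j x"])
    show "(\<lambda>x. (\<chi> i j. g i j x) $ i $ j) \<in> borel_measurable borel" for i j
      using g(1) by simp
    have "AE x in borel_disk. \<forall>i j. hess u x $ i $ j = g i j x"
      using g(2) by (simp add: AE_all_countable)
    then show "AE x in borel_disk. hess u x = (\<chi> i j. g i j x)"
      by eventually_elim (simp add: vec_eq_iff)
    have "AE x in lebesgue_on disk. hess u x $ i $ j = g i j x" for i j
      using g(2) by (simp add: AE_lebesgue_on_disk_iff)
    from L2_AE_cong[OF L this] show "(\<lambda>x. (\<chi> i j. g i j x) $ i $ j) \<in> L2 disk" for i j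
      by simp
  qed
qed

lemma L2_mult_integrable_borel_disk:
  assumes [measurable]: "f \<in> borel_measurable borel" "g \<in> borel_measurable borel" and "f \<in> L2 disk" "g \<in> L2 disk"
  shows "integrable borel_disk (\<lambda>x. f x * g x)"
  using L2_mult_integrable[OF assms(3,4)] by (subst lebesgue_on_disk_borel_disk[symmetric]) auto

lemma L2_integrable_borel_disk:
  assumes [measurable]: "f \<in> borel_measurable borel" and "f \<in> L2 disk"
  shows "integrable borel_disk f"
proof -
  have "(\<lambda>x. (f x)\<^sup>2) \<in> borel_measurable borel" by measurable
  then have "integrable borel_disk (\<lambda>x. (f x)\<^sup>2)"
    using assms(2) by (simp add: L2_def flip: lebesgue_on_disk_borel_disk(1))
  then show ?thesis
    by (rule disk.square_integrable_imp_integrable[OF borel_measurable_disk[OF assms(1)]])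
qed

section \<open>Scalar fields of a square integrable matrix field\<close>

context
  fixes G :: "real^2 \<Rightarrow> real^2^2"
  assumes G [measurable]: "\<And>i j. (\<lambda>x. G x $ i $ j) \<in> borel_measurable borel"
    and GL: "\<And>i j. (\<lambda>x. G x $ i $ j) \<in> L2 disk"
begin

lemma field_measurable [measurable]:
  "trace_fun G \<in> borel_measurable borel" "tangential G \<in> borel_measurable borel"
  "mixed G \<in> borel_measurable borel" "asymmetry G \<in> borel_measurable borel"
  unfolding trace_fun_def[abs_def] tangential_def[abs_def] mixed_def[abs_def] asymmetry_def[abs_def]
  by measurable

lemma trace_fun_L2: "trace_fun G \<in> L2 disk"
  using L2_lincomb[OF GL GL, of 1 1 1 1 2 2] by (simp add: trace_fun_def[abs_def])

text \<open>\<open>tangential\<close> uses a vector of length \<open>|x|\<close>, so dividing by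
  \<open>|x|^2\<close> gives the genuine tangential entry, a combination of entries of
  \<open>G\<close> with coefficients at most \<open>1\<close> in modulus. Applied to both Hessians,
  this gives the integrability that excludes \<open>c / s\<close>.\<close>

lemma tangential_L2: "(\<lambda>x. tangential G x / (norm x)\<^sup>2) \<in> L2 disk"
proof -
  have s: "\<bar>(x $ i * x $ j) / (norm x)\<^sup>2\<bar> \<le> 1" for x :: "real^2" and i j
  proof -
    have "\<bar>x $ i\<bar> * \<bar>x $ j\<bar> \<le> norm x * norm x"
      by (intro mult_mono component_le_norm_cart) auto
    then show ?thesis by (cases "x = 0") (simp_all add: abs_mult power2_eq_square divide_le_eq)
  qed
  have b: "(\<lambda>x. (x $ i * x $ j) / (norm x)\<^sup>2 * G x $ k $ l) \<in> L2 disk" for i j k l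
    by (rule L2_bounded_mult[OF GL _ s]) measurable
  let ?f = "\<lambda>x. 1 * (1 * ((x $ 2 * x $ 2) / (norm x)\<^sup>2 * G x $ 1 $ 1) + 1 * ((x $ 1 * x $ 1) / (norm x)\<^sup>2 * G x $ 2 $ 2)) +
      (- 1) * (1 * ((x $ 1 * x $ 2) / (norm x)\<^sup>2 * G x $ 1 $ 2) + 1 * ((x $ 1 * x $ 2) / (norm x)\<^sup>2 * G x $ 2 $ 1))"
  have "?f \<in> L2 disk"
    by (intro L2_lincomb b)
  also have "?f = (\<lambda>x. tangential G x / (norm x)\<^sup>2)"
    by (simp add: fun_eq_iff tangential_def power2_eq_square[of "_ $ _"] add_divide_distrib diff_divide_distrib algebra_simps)
  finally show ?thesis .
qed

lemma tangential_integrable: "integrable borel_disk (tangential G)"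
proof -
  have "(\<lambda>x. (norm x)\<^sup>2 * (tangential G x / (norm x)\<^sup>2)) \<in> L2 disk"
    by (rule L2_bounded_mult[OF tangential_L2]) (auto simp: power_le_one)
  also have "(\<lambda>x. (norm x)\<^sup>2 * (tangential G x / (norm x)\<^sup>2)) = tangential G"
    by (auto simp: fun_eq_iff tangential_def)
  finally show ?thesis by (intro L2_integrable_borel_disk) auto
qed

lemma trace_fun_integrable: "integrable borel_disk (trace_fun G)"
  by (intro L2_integrable_borel_disk trace_fun_L2) auto

lemma circle_mean_trace_integrable: "set_integrable lborel {0..1} (circle_mean (trace_fun G))"
  using circle_mean_integrable(1)[OF _ trace_fun_integrable] by (simp add: borel_unit_set_integral)

text \<open>In polar coordinates \<open>radial_weak_identity\<close> becomes the weak form of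
  \<open>(2 D)' = t\<close>, with \<open>D\<close> and \<open>t\<close> the circle means of
  tangential part and trace.\<close>

lemma circle_mean_tangential:
  assumes u: "u \<in> W22" and rep: "AE x in borel_disk. hess u x = G x"
  shows "AE s in lborel. s \<in> {0<..<1} \<longrightarrow>
    2 * circle_mean (tangential G) s = (LBINT y:{0..s}. circle_mean (trace_fun G) y)"
proof (rule weak_radial_equation[OF circle_mean_trace_integrable])
  let ?t = "circle_mean (trace_fun G)" and ?D = "circle_mean (tangential G)"
  have Di: "set_integrable lborel {0..1} ?D"
    using circle_mean_integrable(1)[OF _ tangential_integrable] by (simp add: borel_unit_set_integral)
  then show "set_integrable lborel {0..1} (\<lambda>s. 2 * ?D s)" by simp
  fix n a b \<psi>
  assume ab: "0 \<le> a" "a < b" "b < 1"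
    and \<psi>: "\<And>s. (\<psi> has_real_derivative bump n a b s) (at s)" "\<And>s. b \<le> s \<Longrightarrow> \<psi> s = 0"
  have "continuous_on UNIV \<psi>"
    using \<psi>(1) by (auto intro!: continuous_at_imp_continuous_on intro: DERIV_isCont)
  then have [measurable]: "\<psi> \<in> borel_measurable borel" by (rule borel_measurable_continuous_onI)
  have [measurable]: "bump n a b \<in> borel_measurable borel"
    by (rule borel_measurable_continuous_onI[OF continuous_on_bump])
  have bounded: "integrable borel_disk (\<lambda>x. h ((norm x)\<^sup>2) * f x)"
    if "integrable borel_disk f" "continuous_on UNIV h" for f and h :: "real \<Rightarrow> real"
  proof -
    have [measurable]: "h \<in> borel_measurable borel" using that(2) by (rule borel_measurable_continuous_onI)
    have "bounded (h ` {0..1})"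
      using that(2) by (intro compact_imp_bounded compact_continuous_image) (auto intro: continuous_on_subset)
    then obtain C where C: "\<And>s. s \<in> {0..1} \<Longrightarrow> \<bar>h s\<bar> \<le> C"
      unfolding bounded_iff real_norm_def by blast
    show ?thesis
    proof (rule Bochner_Integration.integrable_bound)
      show "integrable borel_disk (\<lambda>x. C * f x)" using that by simp
      have "(\<lambda>x. h ((norm x)\<^sup>2)) \<in> borel_measurable borel_disk"
        by (rule borel_measurable_disk) measurable
      then show "(\<lambda>x. h ((norm x)\<^sup>2) * f x) \<in> borel_measurable borel_disk"
        using borel_measurable_integrable[OF that(1)] by (rule borel_measurable_times)
      show "AE x in borel_disk. norm (h ((norm x)\<^sup>2) * f x) \<le> norm (C * f x)"
      proof (rule AE_I2)
        fix x assume "x \<in> space borel_disk"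
        then have "(norm x)\<^sup>2 \<in> {0..1}" by (auto simp: space_restrict_space power_le_one)
        from C[OF this] have "\<bar>h ((norm x)\<^sup>2)\<bar> \<le> \<bar>C\<bar>" by simp
        then show "norm (h ((norm x)\<^sup>2) * f x) \<le> norm (C * f x)"
          by (simp add: abs_mult mult_right_mono)
      qed
    qed
  qed
  let ?f = "\<lambda>x. \<psi> ((norm x)\<^sup>2) * trace_fun G x" and ?g = "\<lambda>x. (2 * bump n a b ((norm x)\<^sup>2)) * tangential G x"
  have fi: "integrable borel_disk ?f"
    by (rule bounded[OF trace_fun_integrable \<open>continuous_on UNIV \<psi>\<close>])
  have gi: "integrable borel_disk ?g"
    by (rule bounded[OF tangential_integrable, of "\<lambda>s. 2 * bump n a b s"]) (intro continuous_intros continuous_on_bump)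
  have "0 = (LINT x|lebesgue_on disk. \<psi> ((norm x)\<^sup>2) * trace_fun (hess u) x + 2 * bump n a b ((norm x)\<^sup>2) * tangential (hess u) x)"
    by (rule radial_weak_identity[OF u ab(3) \<psi>, symmetric])
  also have "\<dots> = (LINT x|lebesgue_on disk. ?f x + ?g x)"
  proof (rule integral_lebesgue_on_AE_cong)
    show "AE x in lebesgue_on disk. \<psi> ((norm x)\<^sup>2) * trace_fun (hess u) x + 2 * bump n a b ((norm x)\<^sup>2) * tangential (hess u) x = ?f x + ?g x"
      unfolding AE_lebesgue_on_disk_iff using rep
      by eventually_elim (simp add: trace_fun_def tangential_def)
  qed simp
  also have "\<dots> = (LINT x|borel_disk. ?f x + ?g x)"
    by (rule lebesgue_on_disk_borel_disk(2)) measurable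
  also have "\<dots> = (LINT x|borel_disk. ?f x) + (LINT x|borel_disk. ?g x)"
    by (rule Bochner_Integration.integral_add[OF fi gi])
  also have "(LINT x|borel_disk. ?f x) = pi * (LINT s|borel_unit. circle_mean ?f s)"
    by (rule circle_mean_integrable(3)[OF _ fi]) measurable
  also have "(LINT x|borel_disk. ?g x) = pi * (LINT s|borel_unit. circle_mean ?g s)"
    by (rule circle_mean_integrable(3)[OF _ gi]) measurable
  also have "(LINT s|borel_unit. circle_mean ?f s) = (LBINT s:{0..1}. \<psi> s * ?t s)"
  proof -
    have "?f \<in> borel_measurable borel" by measurable
    then show ?thesis
      unfolding borel_unit_set_integral(2)[OF circle_mean_measurable[OF \<open>?f \<in> borel_measurable borel\<close>]]
      by (intro set_lebesgue_integral_cong) (auto simp: circle_mean_radial_mult)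
  qed
  also have "(LINT s|borel_unit. circle_mean ?g s) = (LBINT s:{0..1}. bump n a b s * (2 * ?D s))"
  proof -
    have "circle_mean ?g s = bump n a b s * (2 * ?D s)" if "0 \<le> s" for s
      using circle_mean_radial_mult[of "tangential G" "\<lambda>s. 2 * bump n a b s" s] that by simp
    moreover have "?g \<in> borel_measurable borel" by measurable
    ultimately show ?thesis
      unfolding borel_unit_set_integral(2)[OF circle_mean_measurable[OF \<open>?g \<in> borel_measurable borel\<close>]]
      by (intro set_lebesgue_integral_cong) auto
  qed
  finally have "(LBINT s:{0..1}. \<psi> s * ?t s) + (LBINT s:{0..1}. bump n a b s * (2 * ?D s)) = 0"
    by (simp add: distrib_left[symmetric] del: set_integral_mult_right)
  moreover have "set_integrable lborel {0..1} (\<lambda>s. \<psi> s * ?t s)" "set_integrable lborel {0..1} (\<lambda>s. bump n a b s * (2 * ?D s))"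
    using circle_mean_trace_integrable Di \<open>continuous_on UNIV \<psi>\<close>
    by (auto intro!: set_integrable_continuous_mult continuous_on_bump intro: continuous_on_subset)
  ultimately show "(LBINT s:{0..1}. \<psi> s * ?t s + bump n a b s * (2 * ?D s)) = 0"
    by (simp add: set_integral_add)
qed

end

text \<open>In the frame of \<open>x\<close> and its perpendicular \<open>H\<close> is diagonal and
  the pairing is \<open>H_tt G_rr + H_rr G_tt\<close>. The radial entries are eliminated by
  \<open>H_rr = |x|^2 tr H - H_tt\<close>, and likewise for \<open>G\<close>; the frame vectors have
  length \<open>|x|\<close>, whence the fourth power.\<close>

lemma rotated_frame_cofactor_identity:
  assumes "mixed H x = 0" "asymmetry H x = 0"
  shows "((norm x)\<^sup>2)\<^sup>2 * (G x \<bullet> cofactor (H x)) =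
    (norm x)\<^sup>2 * tangential H x * trace_fun G x + ((norm x)\<^sup>2 * trace_fun H x - 2 * tangential H x) * tangential G x"
proof -
  define a where "a = x $ 1"
  define b where "b = x $ 2"
  define p where "p = H x $ 1 $ 1"
  define h where "h = H x $ 1 $ 2"
  define q where "q = H x $ 2 $ 2"
  define m where "m = a * a * h - a * b * p + b * a * q - b * b * h"
  have sym: "H x $ 2 $ 1 = h" using assms(2) by (simp add: asymmetry_def h_def)
  have m: "m = 0"
    using assms(1) sym by (simp add: mixed_def m_def a_def b_def p_def h_def q_def)
  \<comment> \<open>The identity for symmetric \<open>H\<close> without the condition on the mixed
    entry: the extra term pairs the off-diagonal entry \<open>m\<close> of \<open>H\<close> with the
    two off-diagonal entries of \<open>G\<close> in the frame.\<close>
  have "((norm x)\<^sup>2)\<^sup>2 * (G x \<bullet> cofactor (H x)) =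
    (norm x)\<^sup>2 * tangential H x * trace_fun G x + ((norm x)\<^sup>2 * trace_fun H x - 2 * tangential H x) * tangential G x
     - m * (a * a * G x $ 1 $ 2 - a * b * G x $ 1 $ 1 + b * a * G x $ 2 $ 2 - b * b * G x $ 2 $ 1 +
           (a * a * G x $ 2 $ 1 - a * b * G x $ 1 $ 1 + b * a * G x $ 2 $ 2 - b * b * G x $ 1 $ 2))"
    unfolding inner_matrix_2 cofactor_simps tangential_def trace_fun_def norm_square_2 sym m_def
      a_def[symmetric] b_def[symmetric] p_def[symmetric] h_def[symmetric] q_def[symmetric]
    by (simp add: power2_eq_square algebra_simps)
  with m show ?thesis by simp
qed

text \<open>For symmetric \<open>H\<close> one has \<open>H + cof H = (tr H) I\<close>.\<close>

lemma inner_add_inner_cofactor: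
  assumes "asymmetry H x = 0"
  shows "G x \<bullet> H x + G x \<bullet> cofactor (H x) = trace_fun H x * trace_fun G x"
  using assms by (simp add: inner_matrix_2 cofactor_simps trace_fun_def asymmetry_def algebra_simps)

theorem radial_hessian_orthogonal:
  assumes V: "V \<in> W22" and rad: "radially_symmetric V" and w: "w \<in> W22"
    and cof: "AE x in lebesgue_on disk. hess w x \<bullet> cofactor (hess V x) = 0"
  shows "mat_ip (hess w) (hess V) = 0"
proof -
  obtain H where H [measurable]: "\<And>i j. (\<lambda>x. H x $ i $ j) \<in> borel_measurable borel"
    and rH: "AE x in borel_disk. hess V x = H x" and HL: "\<And>i j. (\<lambda>x. H x $ i $ j) \<in> L2 disk"
    using hess_borel_representative[OF V] by blast
  obtain G where G [measurable]: "\<And>i j. (\<lambda>x. G x $ i $ j) \<in> borel_measurable borel"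
    and rG: "AE x in borel_disk. hess w x = G x" and GL: "\<And>i j. (\<lambda>x. G x $ i $ j) \<in> L2 disk"
    using hess_borel_representative[OF w] by blast
  note [measurable] = field_measurable[OF H HL] field_measurable[OF G GL]
  let ?T = "circle_mean (trace_fun H)" and ?F = "circle_mean (tangential H)"
  let ?t = "circle_mean (trace_fun G)" and ?D = "circle_mean (tangential G)"
  have fields: "AE x in borel_disk. trace_fun (hess V) x = trace_fun H x \<and> tangential (hess V) x = tangential H x \<and>
      mixed (hess V) x = mixed H x \<and> asymmetry (hess V) x = asymmetry H x"
    using rH by eventually_elim (simp add: trace_fun_def tangential_def mixed_def asymmetry_def)
  have rot: "AE x in borel_disk. trace_fun H (rot y x) = trace_fun H x \<and> tangential H (rot y x) = tangential H x \<and>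
      mixed H (rot y x) = mixed H x \<and> asymmetry H (rot y x) = asymmetry H x" if "y \<noteq> 0" for y
    using rotation_invariance_fields[OF V rad that] fields AE_borel_disk_orthogonal[OF orthogonal_transformation_rot[OF that] fields]
    by eventually_elim simp
  have refl: "AE x in borel_disk. mixed H (reflect x) = - mixed H x \<and> asymmetry H (reflect x) = - asymmetry H x"
    using reflection_odd_fields[OF V rad] fields AE_borel_disk_orthogonal[OF orthogonal_transformation_reflect fields]
    by eventually_elim simp
  have T: "AE x in borel_disk. trace_fun H x = ?T ((norm x)\<^sup>2)"
    by (rule rotation_invariant_eq_circle_mean) (measurable, use rot in \<open>auto elim!: eventually_mono\<close>)
  have F: "AE x in borel_disk. tangential H x = ?F ((norm x)\<^sup>2)"
    by (rule rotation_invariant_eq_circle_mean) (measurable, use rot in \<open>auto elim!: eventually_mono\<close>)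
  have M: "AE x in borel_disk. mixed H x = 0"
    by (rule rotation_invariant_odd_eq_0) (measurable, use rot refl in \<open>auto elim!: eventually_mono\<close>)
  have A: "AE x in borel_disk. asymmetry H x = 0"
    by (rule rotation_invariant_odd_eq_0) (measurable, use rot refl in \<open>auto elim!: eventually_mono\<close>)
  have cof': "AE x in borel_disk. G x \<bullet> cofactor (H x) = 0"
    using cof[unfolded AE_lebesgue_on_disk_iff] rG rH by eventually_elim simp
  \<comment> \<open>The trace of \<open>H\<close> is radial, so of \<open>G\<close> only the circle
    mean of its trace will matter.\<close>
  have prod: "AE x in borel_disk. hess w x \<bullet> hess V x = ?T ((norm x)\<^sup>2) * trace_fun G x"
    using cof' A rG rH T
  proof eventually_elim
    case (elim x)
    from inner_add_inner_cofactor[OF elim(2), of G] elim show ?case by simp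
  qed
  have "AE x in borel_disk. ((norm x)\<^sup>2 * ?F ((norm x)\<^sup>2)) * trace_fun G x +
      ((norm x)\<^sup>2 * ?T ((norm x)\<^sup>2) - 2 * ?F ((norm x)\<^sup>2)) * tangential G x = 0"
    using cof' M A T F
  proof eventually_elim
    case (elim x)
    from rotated_frame_cofactor_identity[OF elim(2,3), of G] elim show ?case by simp
  qed
  then have "AE s in borel_unit. (s * ?F s) * ?t s + (s * ?T s - 2 * ?F s) * ?D s = 0"
    by (intro circle_mean_linear_relation trace_fun_integrable[OF G GL] tangential_integrable[OF G GL]) measurable
  then have rel: "AE s in lborel. s \<in> {0<..<1} \<longrightarrow> (s * ?F s) * ?t s + (s * ?T s - 2 * ?F s) * ?D s = 0"
    by (simp only: AE_borel_unit_iff)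
  \<comment> \<open>\<open>P\<close> and \<open>Q\<close> are the primitives called \<open>F\<close>
    and \<open>M\<close> in the overview. The means \<open>?F\<close> and \<open>?D\<close> of
    \<open>tangential\<close> already contain the factor \<open>s\<close>, so these primitives are
    just their doubles.\<close>
  define P where "P s = (LBINT y:{0..s}. ?T y)" for s
  define Q where "Q s = (LBINT y:{0..s}. ?t y)" for s
  have P: "AE s in lborel. s \<in> {0<..<1} \<longrightarrow> 2 * ?F s = P s"
    unfolding P_def by (rule circle_mean_tangential[OF H HL V rH])
  have Q: "AE s in lborel. s \<in> {0<..<1} \<longrightarrow> 2 * ?D s = Q s"
    unfolding Q_def by (rule circle_mean_tangential[OF G GL w rG])
  have acP: "abs_cont P ?T"
    unfolding P_def by (rule abs_cont_indefinite_integral[OF circle_mean_trace_integrable[OF H HL]])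
  have acQ: "abs_cont Q ?t"
    unfolding Q_def by (rule abs_cont_indefinite_integral[OF circle_mean_trace_integrable[OF G GL]])
  have "AE s in lborel. s \<in> {0<..<1} \<longrightarrow> ?T s * ?t s = 0"
  proof (rule abs_cont_product_vanishes[OF acP acQ])
    show "AE s in lborel. s \<in> {0<..<1} \<longrightarrow> P s * ?t s + ?T s * Q s = P s * Q s / s"
      using P Q rel
    proof eventually_elim
      case (elim s)
      show ?case
      proof
        assume s: "s \<in> {0<..<1}"
        then have p: "P s = 2 * ?F s" and q: "Q s = 2 * ?D s"
          and e: "(s * ?F s) * ?t s + (s * ?T s - 2 * ?F s) * ?D s = 0"
          using elim by auto
        show "P s * ?t s + ?T s * Q s = P s * Q s / s"
          unfolding p q using s e by (simp add: field_simps)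
      qed
    qed
    \<comment> \<open>A product of two square integrable tangential entries. Since the one of
      \<open>H\<close> is radial, the circle mean of the product is
      \<open>?F s / s^2 * ?D s\<close>.\<close>
    have "integrable borel_disk (\<lambda>x. (tangential H x / (norm x)\<^sup>2) * (tangential G x / (norm x)\<^sup>2))"
      by (rule L2_mult_integrable_borel_disk[OF _ _ tangential_L2[OF H HL] tangential_L2[OF G GL]]) measurable
    then have i: "integrable borel_disk (\<lambda>x. ?F ((norm x)\<^sup>2) / ((norm x)\<^sup>2)\<^sup>2 * tangential G x)"
    proof (rule integrable_cong_AE_imp)
      show "(\<lambda>x. ?F ((norm x)\<^sup>2) / ((norm x)\<^sup>2)\<^sup>2 * tangential G x) \<in> borel_measurable borel_disk"
        by (rule borel_measurable_disk) measurable
      show "AE x in borel_disk. (tangential H x / (norm x)\<^sup>2) * (tangential G x / (norm x)\<^sup>2) =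
          ?F ((norm x)\<^sup>2) / ((norm x)\<^sup>2)\<^sup>2 * tangential G x"
        using F by eventually_elim (simp add: power2_eq_square)
    qed
    have "integrable borel_unit (circle_mean (\<lambda>x. ?F ((norm x)\<^sup>2) / ((norm x)\<^sup>2)\<^sup>2 * tangential G x))"
      by (rule circle_mean_integrable(1)[OF _ i]) measurable
    then have "integrable lborel (\<lambda>s. indicator {0<..<1} s *\<^sub>R circle_mean (\<lambda>x. ?F ((norm x)\<^sup>2) / ((norm x)\<^sup>2)\<^sup>2 * tangential G x) s)"
      by (subst (asm) integrable_restrict_space) auto
    \<comment> \<open>The factor \<open>4\<close> comes from \<open>P = 2 ?F\<close> and
      \<open>Q = 2 ?D\<close>.\<close>
    then have i': "integrable lborel (\<lambda>s. 4 * (indicator {0<..<1} s *\<^sub>R circle_mean (\<lambda>x. ?F ((norm x)\<^sup>2) / ((norm x)\<^sup>2)\<^sup>2 * tangential G x) s))"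
      by (rule integrable_mult_right)
    show "set_integrable lborel {0<..<1} (\<lambda>s. P s * Q s / s\<^sup>2)"
      unfolding set_integrable_def
    proof (rule integrable_cong_AE_imp[OF i'])
      have [measurable]: "(\<lambda>s. indicator {0..1} s *\<^sub>R P s) \<in> borel_measurable borel"
        "(\<lambda>s. indicator {0..1} s *\<^sub>R Q s) \<in> borel_measurable borel"
        using borel_measurable_continuous_on_indicator[OF _ abs_cont_continuous[OF acP]]
          borel_measurable_continuous_on_indicator[OF _ abs_cont_continuous[OF acQ]]
        by auto
      have "(\<lambda>s. indicator {0<..<1} s * ((indicator {0..1} s *\<^sub>R P s) * (indicator {0..1} s *\<^sub>R Q s) / s\<^sup>2)) \<in> borel_measurable lborel"
        by measurable
      also have "(\<lambda>s. indicator {0<..<1} s * ((indicator {0..1} s *\<^sub>R P s) * (indicator {0..1} s *\<^sub>R Q s) / s\<^sup>2)) =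
          (\<lambda>s. indicator {0<..<1} s *\<^sub>R (P s * Q s / s\<^sup>2))"
        by (auto simp: fun_eq_iff indicator_def)
      finally show "(\<lambda>s. indicator {0<..<1} s *\<^sub>R (P s * Q s / s\<^sup>2)) \<in> borel_measurable lborel" .
      show "AE s in lborel. 4 * (indicator {0<..<1} s *\<^sub>R circle_mean (\<lambda>x. ?F ((norm x)\<^sup>2) / ((norm x)\<^sup>2)\<^sup>2 * tangential G x) s) =
          indicator {0<..<1} s *\<^sub>R (P s * Q s / s\<^sup>2)"
        using P Q
      proof eventually_elim
        case (elim s)
        show ?case
        proof (cases "s \<in> {0<..<1}")
          case True
          then have "circle_mean (\<lambda>x. ?F ((norm x)\<^sup>2) / ((norm x)\<^sup>2)\<^sup>2 * tangential G x) s = ?F s / s\<^sup>2 * ?D s"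
            by (intro circle_mean_radial_mult[where g = "\<lambda>s. ?F s / s\<^sup>2"]) auto
          moreover have "P s = 2 * ?F s" "Q s = 2 * ?D s" using True elim by auto
          ultimately show ?thesis by simp
        qed simp
      qed
    qed
  qed
  then have Tt: "AE s in borel_unit. ?T s * ?t s = 0"
    by (simp only: AE_borel_unit_iff)
  have "integrable borel_disk (\<lambda>x. trace_fun H x * trace_fun G x)"
    by (rule L2_mult_integrable_borel_disk[OF _ _ trace_fun_L2[OF H HL] trace_fun_L2[OF G GL]]) measurable
  then have i: "integrable borel_disk (\<lambda>x. ?T ((norm x)\<^sup>2) * trace_fun G x)"
  proof (rule integrable_cong_AE_imp)
    show "(\<lambda>x. ?T ((norm x)\<^sup>2) * trace_fun G x) \<in> borel_measurable borel_disk"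
      by (rule borel_measurable_disk) measurable
    show "AE x in borel_disk. trace_fun H x * trace_fun G x = ?T ((norm x)\<^sup>2) * trace_fun G x"
      using T by eventually_elim simp
  qed
  have "mat_ip (hess w) (hess V) = (LINT x|lebesgue_on disk. ?T ((norm x)\<^sup>2) * trace_fun G x)"
    unfolding mat_ip_def
    by (rule integral_lebesgue_on_AE_cong) (simp_all add: AE_lebesgue_on_disk_iff prod)
  also have "\<dots> = (LINT x|borel_disk. ?T ((norm x)\<^sup>2) * trace_fun G x)"
    by (rule lebesgue_on_disk_borel_disk(2)) measurable
  also have "\<dots> = pi * (LINT s|borel_unit. circle_mean (\<lambda>x. ?T ((norm x)\<^sup>2) * trace_fun G x) s)"
    by (rule circle_mean_integrable(3)[OF _ i]) measurable
  also have "(LINT s|borel_unit. circle_mean (\<lambda>x. ?T ((norm x)\<^sup>2) * trace_fun G x) s) = 0"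
  proof (rule integral_eq_zero_AE)
    have "AE s in borel_unit. s \<in> {0<..<1}" by (simp add: AE_borel_unit_iff)
    with Tt show "AE s in borel_unit. circle_mean (\<lambda>x. ?T ((norm x)\<^sup>2) * trace_fun G x) s = 0"
    proof eventually_elim
      case (elim s)
      then have "circle_mean (\<lambda>x. ?T ((norm x)\<^sup>2) * trace_fun G x) s = ?T s * ?t s"
        by (intro circle_mean_radial_mult) auto
      with elim show ?case by simp
    qed
  qed
  finally show ?thesis by simp
qed

theorem proposition1p1:
  fixes V k :: "real^2 \<Rightarrow> real"
  assumes "V \<in> W22"
    and "radially_symmetric V"
    and "AE x in lebesgue_on disk. k x = det (hess V x)"
  shows "stationary k V"
  unfolding stationary_def
proof (intro conjI allI impI)
  show "V \<in> W22" by (rule assms(1))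
  show "AE x in lebesgue_on disk. det (hess V x) = k x"
    using assms(3) by eventually_elim simp
  fix T u
  assume "open T \<and> 0 \<in> T \<and> (\<forall>t\<in>T. u t \<in> W_finite k) \<and> strongly_continuous_on T u \<and>
    (AE x in lebesgue_on disk. u 0 x = V x) \<and> (\<exists>w. has_weak_velocity_at_0 u w)"
  then obtain w where T: "open T" "0 \<in> T" and u: "\<And>t. t \<in> T \<Longrightarrow> u t \<in> W_finite k"
    and sc: "strongly_continuous_on T u" and u0: "AE x in lebesgue_on disk. u 0 x = V x"
    and w: "has_weak_velocity_at_0 u w"
    by auto
  \<comment> \<open>The energy is the quadratic form with \<open>L\<close> the identity.\<close>
  have "((\<lambda>t. mat_ip (hess (u t)) (\<lambda>x. hess (u t) x)) has_real_derivative 2 * mat_ip (hess w) (\<lambda>x. hess (u 0) x)) (at 0)"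
    by (rule quadratic_form_derivative[OF T _ sc w]) (use u in \<open>auto simp: W_finite_def linear_id[unfolded id_def]\<close>)
  moreover have "mat_ip (hess w) (hess V) = 0"
    using w linearized_constraint[OF T u sc w]
    by (intro radial_hessian_orthogonal assms(1,2)) (simp_all add: has_weak_velocity_at_0_def hess_cong[OF u0])
  ultimately show "((\<lambda>t. LINT x|lebesgue_on disk. hess (u t) x \<bullet> hess (u t) x) has_real_derivative 0) (at 0)"
    by (simp add: mat_ip_def hess_cong[OF u0])
qed

end
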